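(* Let $P$ be a time-reversal-symmetric orthogonal projection with $|P_{\mathbf{x},\mathbf{y}}|<C_1e^{-C_2|\mathbf{x}-\mathbf{y}|}$, let $Q$ be its half-flux modification, and for each $r$ let $Q_N,V_N,W_N$ be the truncated matrices on the disk of radius $r$ containing $N$ sites. Let $Q'_N,V'_N,W'_N$ be Hermitian matrices approximating $Q_N,V_N,W_N$ in the sense that $$\|Q_N-Q'_N\|<\rho^2,\qquad \|V_N-V'_N\|<\rho,\qquad \|W_N-W'_N\|<\rho,$$ and such that $$[Q'_N,V'_N]=[Q'_N,W'_N]=V'_NW'_N=W'_NV'_N=0,\qquad (Q'_N)^2-Q'_N=V'_N+W'_N,$$ where $\rho=F(1/\epsilon)\,\epsilon^{1/10}$, $\epsilon=\epsilon(r)\le p(r)e^{-cr}$ for some polynomial $p$ and constant $c>0$, and $F(t)$ (independent of $N$) grows slower than any power of $t$. Simultaneously diagonalize $Q'_N,V'_N,W'_N$ to get triples of eigenvalues $(q',v',w')$, and call a common eigenstate a vertex state if $v'\neq0$, $w'=0$. Then $$\lim_{N\to\infty}\ \sum_{\text{vertex states}}q'=\operatorname{Tr}^v(Q),$$ where $\operatorname{Tr}^v(Q)$ is understood modulo $2$.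
   Context: Setting. Sites $\mathbf{x}$ lie on $\mathbb{Z}^2\subset\mathbb{R}^2$ with a fixed finite number of internal states per site; $P_{\mathbf{x},\mathbf{y}}$ is the matrix element (block) between sites. Time-reversal symmetry of $P$: there is an on-site antiunitary $K$ with $K^2=-1$ commuting with $P$. Half-flux insertion. Fix a point of the plane (the vertex), taken as the origin. Partition the plane into three regions by three boundary curves $l_1,l_2,l_3$ running from the vertex to infinity and disjoint away from the vertex. Let $s_{\mathbf{x},\mathbf{y}}=(-1)^{n_{\mathbf{x},\mathbf{y}}}$ where $n_{\mathbf{x},\mathbf{y}}$ is the number of intersections of the straight segment $(\mathbf{x},\mathbf{y})$ with $l_1\cup l_2\cup l_3$ (generic position assumed). Put $s_{\mathbf{x}\mathbf{y}\mathbf{z}}=s_{\mathbf{x},\mathbf{y}}s_{\mathbf{y},\mathbf{z}}s_{\mathbf{z},\mathbf{x}}$; it is $-1$ exactly when the vertex is in the triangle $\mathbf{x}\mathbf{y}\mathbf{z}$. Set $Q_{\mathbf{x},\mathbf{y}}=s_{\mathbf{x},\mathbf{y}}P_{\mathbf{x},\mathbf{y}}$. Trace over vertex states. $\overline{Q}$ is the spectral flattening of $Q$ (spectral values $\le\frac12$ replaced by $0$, those $>\frac12$ by $1$). $Q-\overline{Q}$ is trace class and $\operatorname{Tr}^v(Q):=\operatorname{Tr}(Q-\overline{Q})$, understood modulo $2$. Truncation. Let $\Lambda_r$ be the set of the $N\sim r^2$ sites inside the circle of radius $r$ about the vertex, and $D$ the set of sites outside. $Q_N$ is the restriction of $Q$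 to $\Lambda_r$, and for $\mathbf{x},\mathbf{y}\in\Lambda_r$ $$(V_N)_{\mathbf{x},\mathbf{y}}=-2s_{\mathbf{x},\mathbf{y}}\sum_{\mathbf{z}\in\Lambda_r,\ s_{\mathbf{x}\mathbf{y}\mathbf{z}}=-1}P_{\mathbf{x},\mathbf{z}}P_{\mathbf{z},\mathbf{y}},\qquad (W_N)_{\mathbf{x},\mathbf{y}}=-s_{\mathbf{x},\mathbf{y}}\sum_{\mathbf{z}\in D}P_{\mathbf{x},\mathbf{z}}P_{\mathbf{z},\mathbf{y}},$$ so that $Q_N^2-Q_N=V_N+W_N$. The norm $\|\cdot\|$ is the operator norm (maximal singular value). The number $\epsilon$ is an upper bound for $\|[Q_N,V_N]\|$, $\|[Q_N,W_N]\|$, $\|V_NW_N\|$ and $\|W_NV_N\|$; Hermitian matrices $Q'_N,V'_N,W'_N$ with the listed properties exist. The sum in the claim runs over a common orthonormal eigenbasis, restricted to vertex states.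
   Formalization: The matrices Q'_N, V'_N, W'_N are also assumed to be time-reversal symmetric (to commute with K); without this the claim modulo 2 fails, e.g. for P = 1, Q'_N = 1 + η|ψ⟩⟨ψ|, V'_N = (η+η²)|ψ⟩⟨ψ|, W'_N = 0. *)

theory Defs
  imports "HOL-Analysis.Analysis" "HOL-Computational_Algebra.Polynomial"
    "HOL-Library.Function_Algebras"
begin

type_synonym site = "int \<times> int"

type_synonym 'n state = "site \<Rightarrow> complex ^ 'n"

text \<open>
  Operators are given by their matrices of blocks between sites. Every bounded operator on the
  square-summable states has a unique such matrix. A matrix on a finite set of sites is represented
  by its extension by zero.
\<close>

type_synonym 'n opr = "site \<Rightarrow> site \<Rightarrow> complex ^ 'n ^ 'n"

definition cdot :: "complex ^ 'n \<Rightarrow> complex ^ 'n \<Rightarrow> complex" where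
  "cdot a b = (\<Sum>i\<in>UNIV. cnj (a $ i) * b $ i)"

definition l2 :: "'n::finite state set" where
  "l2 = {\<psi>. (\<lambda>x. (norm (\<psi> x))\<^sup>2) summable_on UNIV}"

definition l2_norm :: "'n::finite state \<Rightarrow> real" where
  "l2_norm \<psi> = sqrt (\<Sum>\<^sub>\<infinity>x. (norm (\<psi> x))\<^sup>2)"

definition l2_inner :: "'n::finite state \<Rightarrow> 'n state \<Rightarrow> complex" where
  "l2_inner \<phi> \<psi> = (\<Sum>\<^sub>\<infinity>x. cdot (\<phi> x) (\<psi> x))"

definition op_apply :: "'n::finite opr \<Rightarrow> 'n state \<Rightarrow> 'n state" where
  "op_apply A \<psi> = (\<lambda>x. \<Sum>\<^sub>\<infinity>y. A x y *v \<psi> y)"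

definition op_mult :: "'n::finite opr \<Rightarrow> 'n opr \<Rightarrow> 'n opr" (infixl \<open>\<odot>\<close> 70) where
  "A \<odot> B = (\<lambda>x y. \<Sum>\<^sub>\<infinity>z. A x z ** B z y)"

definition commutator :: "'n::finite opr \<Rightarrow> 'n opr \<Rightarrow> 'n opr" where
  "commutator A B = A \<odot> B - B \<odot> A"

definition op_id :: "'n::finite opr" where
  "op_id = (\<lambda>x y. if x = y then mat 1 else 0)"

definition hermitian :: "'n::finite opr \<Rightarrow> bool" where
  "hermitian A \<longleftrightarrow> (\<forall>x y i j. A y x $ i $ j = cnj (A x y $ j $ i))"

definition bounded_op :: "'n::finite opr \<Rightarrow> bool" where
  "bounded_op A \<longleftrightarrow>
     (\<forall>\<psi>\<in>l2. (\<forall>x. (\<lambda>y. A x y *v \<psi> y) summable_on UNIV) \<and> op_apply A \<psi> \<in> l2) \<and>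
     (\<exists>M. \<forall>\<psi>\<in>l2. l2_norm (op_apply A \<psi>) \<le> M * l2_norm \<psi>)"

definition op_norm :: "'n::finite opr \<Rightarrow> real" where
  "op_norm A = Sup {l2_norm (op_apply A \<psi>) | \<psi>. \<psi> \<in> l2 \<and> l2_norm \<psi> \<le> 1}"

definition orthogonal_projection :: "'n::finite opr \<Rightarrow> bool" where
  "orthogonal_projection A \<longleftrightarrow> bounded_op A \<and> hermitian A \<and> A \<odot> A = A"

definition op_trace :: "'n::finite opr \<Rightarrow> complex" where
  "op_trace A = (\<Sum>\<^sub>\<infinity>x. trace (A x x))"

definition supported_on :: "site set \<Rightarrow> 'n::finite opr \<Rightarrow> bool" where
  "supported_on S A \<longleftrightarrow> (\<forall>x y. x \<notin> S \<or> y \<notin> S \<longrightarrow> A x y = 0)"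

text \<open>
  \<open>E\<close> is the projection-valued measure with \<open>A = \<integral> t dE(t)\<close>; the measure \<open>\<mu>\<close> below is
  \<open>B \<mapsto> \<langle>\<psi>, E(B) \<psi>\<rangle>\<close>.
\<close>

definition is_spectral_measure :: "'n::finite opr \<Rightarrow> (real set \<Rightarrow> 'n opr) \<Rightarrow> bool" where
  "is_spectral_measure A E \<longleftrightarrow>
     (\<forall>B\<in>sets borel. orthogonal_projection (E B)) \<and>
     E UNIV = op_id \<and>
     (\<forall>B\<in>sets borel. \<forall>C\<in>sets borel. E (B \<inter> C) = E B \<odot> E C) \<and>
     (\<forall>\<psi>\<in>l2. \<exists>\<mu>. finite_measure \<mu> \<and> sets \<mu> = sets borel \<and>
        (\<forall>B\<in>sets borel. l2_inner \<psi> (op_apply (E B) \<psi>) = of_real (measure \<mu> B)) \<and>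
        integrable \<mu> (\<lambda>t. t) \<and>
        l2_inner \<psi> (op_apply A \<psi>) = of_real (\<integral>t. t \<partial>\<mu>))"

text \<open>
  By the spectral theorem a bounded Hermitian operator has a spectral measure, and its values on
  Borel sets are unique.
\<close>

definition spectral_measure :: "'n::finite opr \<Rightarrow> real set \<Rightarrow> 'n opr" where
  "spectral_measure A = (SOME E. is_spectral_measure A E)"

text \<open>The function of \<open>A\<close> that is \<open>0\<close> on \<open>t \<le> 1/2\<close> and \<open>1\<close> on \<open>t > 1/2\<close>.\<close>

definition spectral_flattening :: "'n::finite opr \<Rightarrow> 'n opr" where
  "spectral_flattening A = spectral_measure A {1/2<..}"

definition vertex_trace :: "'n::finite opr \<Rightarrow> real" where
  "vertex_trace Q = Re (op_trace (Q - spectral_flattening Q))"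

definition antiunitary :: "(complex ^ 'n \<Rightarrow> complex ^ 'n) \<Rightarrow> bool" where
  "antiunitary T \<longleftrightarrow>
     (\<forall>a b. T (a + b) = T a + T b) \<and> (\<forall>c a. T (c *s a) = cnj c *s T a) \<and>
     (\<forall>a b. cdot (T a) (T b) = cnj (cdot a b)) \<and> surj T"

definition time_reversal :: "(site \<Rightarrow> complex ^ 'n \<Rightarrow> complex ^ 'n) \<Rightarrow> bool" where
  "time_reversal K \<longleftrightarrow> (\<forall>x. antiunitary (K x) \<and> (\<forall>a. K x (K x a) = - a))"

definition time_reversal_symmetric ::
  "(site \<Rightarrow> complex ^ 'n \<Rightarrow> complex ^ 'n) \<Rightarrow> 'n::finite opr \<Rightarrow> bool" where
  "time_reversal_symmetric K A \<longleftrightarrow>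
     (\<forall>\<psi>\<in>l2. op_apply A (\<lambda>x. K x (\<psi> x)) = (\<lambda>x. K x (op_apply A \<psi> x)))"

definition pos :: "site \<Rightarrow> real \<times> real" where
  "pos x = (real_of_int (fst x), real_of_int (snd x))"

text \<open>
  The vertex is an arbitrary point of the plane rather than the origin, since generic position
  excludes the lattice points.
\<close>

definition boundary_curves :: "real \<times> real \<Rightarrow> (nat \<Rightarrow> real \<Rightarrow> real \<times> real) \<Rightarrow> bool" where
  "boundary_curves v l \<longleftrightarrow>
     (\<forall>i\<in>{1,2,3}. continuous_on {0..} (l i) \<and> inj_on (l i) {0..} \<and> l i 0 = v \<and>
        filterlim (l i) at_infinity at_top) \<and>
     (\<forall>i\<in>{1,2,3}. \<forall>j\<in>{1,2,3}. i \<noteq> j \<longrightarrow> l i ` {0..} \<inter> l j ` {0..} = {v})"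

definition curve_union :: "(nat \<Rightarrow> real \<Rightarrow> real \<times> real) \<Rightarrow> (real \<times> real) set" where
  "curve_union l = (\<Union>i\<in>{1,2,3}. l i ` {0..})"

text \<open>The sign of \<open>side p q z\<close> tells on which side of the line through \<open>p\<close>, \<open>q\<close> the point \<open>z\<close> lies.\<close>

definition side :: "real \<times> real \<Rightarrow> real \<times> real \<Rightarrow> real \<times> real \<Rightarrow> real" where
  "side p q z = (fst q - fst p) * (snd z - snd p) - (snd q - snd p) * (fst z - fst p)"

text \<open>
  Generic position: no site is on a curve, the vertex is on no segment between sites, and the
  curves meet each such segment in finitely many points, crossing it (from one side of its line to
  the other) at each of them.
\<close>

definition generic_position :: "real \<times> real \<Rightarrow> (nat \<Rightarrow> real \<Rightarrow> real \<times> real) \<Rightarrow> bool" where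
  "generic_position v l \<longleftrightarrow>
     (\<forall>x. pos x \<notin> curve_union l) \<and>
     (\<forall>x y. v \<notin> closed_segment (pos x) (pos y)) \<and>
     (\<forall>x y. finite (closed_segment (pos x) (pos y) \<inter> curve_union l)) \<and>
     (\<forall>x y. \<forall>i\<in>{1,2,3}. \<forall>t>0. l i t \<in> closed_segment (pos x) (pos y) \<longrightarrow>
        (\<exists>\<delta>>0. \<forall>t1\<in>{t-\<delta><..<t}. \<forall>t2\<in>{t<..<t+\<delta>}.
           side (pos x) (pos y) (l i t1) * side (pos x) (pos y) (l i t2) < 0))"

definition crossings :: "(nat \<Rightarrow> real \<Rightarrow> real \<times> real) \<Rightarrow> site \<Rightarrow> site \<Rightarrow> nat" where
  "crossings l x y = card (closed_segment (pos x) (pos y) \<inter> curve_union l)"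

definition flux_sign :: "(nat \<Rightarrow> real \<Rightarrow> real \<times> real) \<Rightarrow> site \<Rightarrow> site \<Rightarrow> real" where
  "flux_sign l x y = (- 1) ^ crossings l x y"

definition flux_sign3 :: "(nat \<Rightarrow> real \<Rightarrow> real \<times> real) \<Rightarrow> site \<Rightarrow> site \<Rightarrow> site \<Rightarrow> real" where
  "flux_sign3 l x y z = flux_sign l x y * flux_sign l y z * flux_sign l z x"

definition half_flux :: "(nat \<Rightarrow> real \<Rightarrow> real \<times> real) \<Rightarrow> 'n::finite opr \<Rightarrow> 'n opr" where
  "half_flux l P = (\<lambda>x y. flux_sign l x y *\<^sub>R P x y)"

definition disk :: "real \<times> real \<Rightarrow> real \<Rightarrow> site set" where
  "disk v r = {x. dist (pos x) v < r}"

definition truncQ ::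
  "real \<times> real \<Rightarrow> (nat \<Rightarrow> real \<Rightarrow> real \<times> real) \<Rightarrow> 'n::finite opr \<Rightarrow> real \<Rightarrow> 'n opr" where
  "truncQ v l P r = (\<lambda>x y. if x \<in> disk v r \<and> y \<in> disk v r then half_flux l P x y else 0)"

definition truncV ::
  "real \<times> real \<Rightarrow> (nat \<Rightarrow> real \<Rightarrow> real \<times> real) \<Rightarrow> 'n::finite opr \<Rightarrow> real \<Rightarrow> 'n opr" where
  "truncV v l P r = (\<lambda>x y. if x \<in> disk v r \<and> y \<in> disk v r
     then (- 2 * flux_sign l x y) *\<^sub>R
       (\<Sum>z\<in>{z \<in> disk v r. flux_sign3 l x y z = - 1}. P x z ** P z y)
     else 0)"

definition truncW ::
  "real \<times> real \<Rightarrow> (nat \<Rightarrow> real \<Rightarrow> real \<times> real) \<Rightarrow> 'n::finite opr \<Rightarrow> real \<Rightarrow> 'n opr" where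
  "truncW v l P r = (\<lambda>x y. if x \<in> disk v r \<and> y \<in> disk v r
     then (- flux_sign l x y) *\<^sub>R (\<Sum>\<^sub>\<infinity>z\<in>- disk v r. P x z ** P z y)
     else 0)"

text \<open>
  A common orthonormal eigenbasis of three matrices on the finite set \<open>S\<close> of sites. The basis
  vectors are labelled by \<open>S \<times> UNIV\<close>, whose cardinality is the dimension, so that an
  orthonormal family of this size is a basis.
\<close>

definition common_eigenbasis ::
  "site set \<Rightarrow> 'n::finite opr \<Rightarrow> 'n opr \<Rightarrow> 'n opr \<Rightarrow> (site \<times> 'n \<Rightarrow> 'n state) \<Rightarrow>
   (site \<times> 'n \<Rightarrow> real) \<Rightarrow> (site \<times> 'n \<Rightarrow> real) \<Rightarrow> (site \<times> 'n \<Rightarrow> real) \<Rightarrow> bool" where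
  "common_eigenbasis S Q V W \<phi> q v w \<longleftrightarrow>
     (\<forall>a\<in>S \<times> UNIV. \<forall>x. x \<notin> S \<longrightarrow> \<phi> a x = 0) \<and>
     (\<forall>a\<in>S \<times> UNIV. \<forall>b\<in>S \<times> UNIV. l2_inner (\<phi> a) (\<phi> b) = (if a = b then 1 else 0)) \<and>
     (\<forall>a\<in>S \<times> UNIV.
        op_apply Q (\<phi> a) = (\<lambda>x. q a *\<^sub>R \<phi> a x) \<and>
        op_apply V (\<phi> a) = (\<lambda>x. v a *\<^sub>R \<phi> a x) \<and>
        op_apply W (\<phi> a) = (\<lambda>x. w a *\<^sub>R \<phi> a x))"

definition vertex_states ::
  "site set \<Rightarrow> (site \<times> 'n \<Rightarrow> real) \<Rightarrow> (site \<times> 'n \<Rightarrow> real) \<Rightarrow> (site \<times> 'n) set" where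
  "vertex_states S v w = {a \<in> S \<times> UNIV. v a \<noteq> 0 \<and> w a = 0}"

definition tendsto_mod2 :: "('a \<Rightarrow> real) \<Rightarrow> real \<Rightarrow> 'a filter \<Rightarrow> bool" where
  "tendsto_mod2 f L G \<longleftrightarrow> (\<exists>k :: 'a \<Rightarrow> int. ((\<lambda>a. f a - 2 * of_int (k a)) \<longlongrightarrow> L) G)"

end

theory Submission
  imports Defs
begin

text \<open>
  Write \<open>g\<^sub>s(t) = t - [t > s]\<close>. On vertex states of the truncated system \<open>v' = q'\<^sup>2 - q'\<close>, hence
  \<open>g\<^sub>s(q') = v' f\<^sub>s(q')\<close> with \<open>f\<^sub>s(t) = 1/(t - 1)\<close> for \<open>t \<le> s\<close> and \<open>f\<^sub>s(t) = 1/t\<close> for \<open>t > s\<close>.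
  By Kramers degeneracy the number of vertex states with \<open>q' > s\<close> is even, so modulo 2 the sum of the
  \<open>q'\<close> is \<open>Tr V' f\<^sub>s(Q')\<close>. Only triangles around the vertex contribute to \<open>V = Q\<^sup>2 - Q\<close>, so its kernel is
  absolutely summable. It follows that \<open>Q\<close> has an eigenbasis, that the trace over vertex states is
  \<open>Tr V f\<^sub>1\<^sub>/\<^sub>2(Q)\<close>, and, by dominated convergence, that \<open>Tr V' Q'\<^sup>m \<rightarrow> Tr V Q\<^sup>m\<close>; Weierstrass approximation extends
  this from powers to continuous functions. The eigenvalues of \<open>Q\<close> do not accumulate at \<open>1/2\<close>, because
  there \<open>V\<close> is close to \<open>-1/4\<close>. Hence \<open>s > 1/2\<close> can be chosen inside a spectral gap adjacent to \<open>1/2\<close>.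
\<close>

subsection \<open>The sign of a triangle\<close>

text \<open>Two obstacles shape the argument. A truncated system may have boundary states with
  eigenvalues anywhere, and \<open>\<rho>\<close> controls operator norms only, so there is no hold
  on traces of functions of \<open>Q'\<close> alone. Every trace is therefore weighted by
  \<open>V'\<close>, which annihilates the states with \<open>w' \<noteq> 0\<close>. Replacing
  \<open>V'\<close> by the truncated \<open>V\<close> entry by entry costs the squared dimension
  times \<open>\<rho>\<close>; this vanishes because the dimension is polynomial in \<open>r\<close>
  and \<open>\<rho>\<close> is smaller than every inverse power of \<open>r\<close>. The second
  obstacle is the cut: values \<open>q'\<close> approaching an eigenvalue 1/2 of \<open>Q\<close>
  may lie on both sides of 1/2, so the number of those above 1/2 is unstable. Kramers pairing acts
  inside the common eigenspaces of \<open>Q'\<close> and \<open>V'\<close>, hence gives even parity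
  for every cut \<open>s\<close>, and the cut is free to move into a gap. A third point is formal:
  \<open>spectral_flattening\<close> rests on a chosen spectral measure, of which only the defining
  properties are known.\<close>

lemma sgn_parity_of_zeros:
  fixes f :: "real \<Rightarrow> real"
  assumes "a \<le> b" "continuous_on {a..b} f" "f a \<noteq> 0" "f b \<noteq> 0" "finite {t\<in>{a..b}. f t = 0}"
    and "\<And>t. t \<in> {a..b} \<Longrightarrow> f t = 0 \<Longrightarrow>
      \<exists>\<delta>>0. \<forall>t1\<in>{t-\<delta><..<t}. \<forall>t2\<in>{t<..<t+\<delta>}. f t1 * f t2 < 0"
  shows "sgn (f a) * sgn (f b) = (- 1) ^ card {t\<in>{a..b}. f t = 0}"
  using assms
proof (induction "card {t\<in>{a..b}. f t = 0}" arbitrary: b)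
  case 0
  then have nz: "\<And>t. t \<in> {a..b} \<Longrightarrow> f t \<noteq> 0" by auto
  have "sgn (f a) = sgn (f b)"
  proof (rule ccontr)
    assume "sgn (f a) \<noteq> sgn (f b)"
    then have "(f a \<le> 0 \<and> 0 \<le> f b) \<or> (f b \<le> 0 \<and> 0 \<le> f a)"
      by (auto simp: sgn_if split: if_splits)
    then obtain t where "a \<le> t" "t \<le> b" "f t = 0"
      using IVT'[of f a 0 b] IVT2'[of f b 0 a] 0 by blast
    then show False using nz by auto
  qed
  moreover have "sgn (f b) * sgn (f b) = 1" using 0(5) by (auto simp: sgn_if)
  ultimately show ?case using 0(1) by simp
next
  case (Suc n)
  let ?Z = "{t\<in>{a..b}. f t = 0}"
  \<comment> \<open>The induction removes the last zero \<open>t0\<close>: the sign flips across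
    \<open>t0\<close>, it stays constant from \<open>t2\<close> to \<open>b\<close> by the
    intermediate value theorem, and the interval from \<open>a\<close> to \<open>t1\<close> contains
    exactly the other zeros.\<close>
  define t0 where "t0 = Max ?Z"
  have "?Z \<noteq> {}" using Suc.hyps(2) by (metis card.empty nat.distinct(1))
  then have t0: "t0 \<in> ?Z" and t0_max: "\<And>t. t \<in> ?Z \<Longrightarrow> t \<le> t0"
    unfolding t0_def using Suc.prems(5) Max_in Max_ge by blast+
  have "a < t0" "t0 < b" using t0 Suc.prems(3,4) by (auto simp: less_le)
  obtain \<delta> where \<delta>: "\<delta> > 0" "\<forall>t1\<in>{t0-\<delta><..<t0}. \<forall>t2\<in>{t0<..<t0+\<delta>}. f t1 * f t2 < 0"
    using Suc.prems(6) t0 by blast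
  \<comment> \<open>Between \<open>m\<close> and \<open>t0\<close> there is no zero and the sign
    condition at \<open>t0\<close> is in force, so any point strictly between them can serve as
    \<open>t1\<close>.\<close>
  define m where "m = Max (insert a (insert (t0 - \<delta>) (?Z - {t0})))"
  have fin: "finite (insert a (insert (t0 - \<delta>) (?Z - {t0})))" using Suc.prems(5) by simp
  have "m < t0"
    unfolding m_def using fin \<open>a < t0\<close> \<delta>(1) t0_max by (subst Max_less_iff) (auto simp: less_le)
  define t1 where "t1 = (m + t0) / 2"
  have m_ge: "\<And>t. t \<in> insert a (insert (t0 - \<delta>) (?Z - {t0})) \<Longrightarrow> t \<le> m"
    unfolding m_def using fin Max_ge by blast
  have t1: "m < t1" "t1 < t0" unfolding t1_def using \<open>m < t0\<close> by auto
  define t2 where "t2 = (t0 + min b (t0 + \<delta>)) / 2"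
  have t2: "t0 < t2" "t2 < b" "t2 < t0 + \<delta>"
    unfolding t2_def using \<open>t0 < b\<close> \<delta>(1) by (auto simp: min_def field_simps)
  have neg: "f t1 * f t2 < 0" using \<delta>(2) t1 t2 m_ge[of "t0 - \<delta>"] by auto
  have Z1: "{t\<in>{a..t1}. f t = 0} = ?Z - {t0}"
  proof (rule set_eqI)
    fix t show "t \<in> {t\<in>{a..t1}. f t = 0} \<longleftrightarrow> t \<in> ?Z - {t0}"
      using t1 \<open>t0 < b\<close> m_ge[of t] by auto
  qed
  have at1: "a \<le> t1" using m_ge[of a] t1 by auto
  have c1: "continuous_on {a..t1} f"
    by (rule continuous_on_subset[OF Suc.prems(2)]) (use t1 \<open>t0 < b\<close> in auto)
  have "sgn (f a) * sgn (f t1) = (- 1) ^ card {t\<in>{a..t1}. f t = 0}"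
  proof (rule Suc.hyps(1))
    show "n = card {t\<in>{a..t1}. f t = 0}" unfolding Z1 using Suc.hyps(2) Suc.prems(5) t0 by auto
    show "f t1 \<noteq> 0" using neg by auto
    show "finite {t\<in>{a..t1}. f t = 0}" unfolding Z1 using Suc.prems(5) by simp
    show "\<exists>\<delta>>0. \<forall>t1\<in>{t-\<delta><..<t}. \<forall>t2\<in>{t<..<t+\<delta>}. f t1 * f t2 < 0"
      if "t \<in> {a..t1}" "f t = 0" for t using Suc.prems(6)[of t] that t1 \<open>t0 < b\<close> by auto
  qed (use at1 c1 Suc.prems(3) in auto)
  moreover have "sgn (f t2) = sgn (f b)"
  proof (rule ccontr)
    assume "sgn (f t2) \<noteq> sgn (f b)"
    then have "(f t2 \<le> 0 \<and> 0 \<le> f b) \<or> (f b \<le> 0 \<and> 0 \<le> f t2)"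
      by (auto simp: sgn_if split: if_splits)
    moreover have "continuous_on {t2..b} f"
      by (rule continuous_on_subset[OF Suc.prems(2)]) (use t2 \<open>a < t0\<close> in auto)
    ultimately obtain t where "t2 \<le> t" "t \<le> b" "f t = 0"
      using IVT'[of f t2 0 b] IVT2'[of f b 0 t2] t2 by (meson less_imp_le)
    then show False using t0_max[of t] t2 \<open>a < t0\<close> by auto
  qed
  moreover have "sgn (f t1) * sgn (f t2) = - 1"
    using neg by (simp add: sgn_mult[symmetric])
  moreover have "(- 1) ^ card ?Z = - ((- 1) ^ card {t\<in>{a..t1}. f t = 0} :: real)"
    unfolding Z1 using Suc.hyps(2)[symmetric] Suc.prems(5) t0 by simp
  moreover have "sgn (f t1) * sgn (f t1) = 1" using neg by (auto simp: sgn_if)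
  ultimately show ?case by (smt (verit) mult.assoc mult.commute mult_cancel_left1 mult_minus_right)
qed

section \<open>Signed areas and barycentric coordinates\<close>

lemma side_sum: "side x y p + side y z p + side z x p = side x y z"
  by (simp add: side_def algebra_simps)

text \<open>\<open>side\<close> is twice a signed area; the areas of the three subtriangles with
  apex \<open>p\<close> are the unnormalised barycentric coordinates of \<open>p\<close>.\<close>

lemma side_barycentric:
  "side x y z *\<^sub>R p = side y z p *\<^sub>R x + side z x p *\<^sub>R y + side x y p *\<^sub>R z"
  by (cases x; cases y; cases z; cases p) (simp add: side_def algebra_simps)

lemma side_affine: "side x y ((1 - u) *\<^sub>R p + u *\<^sub>R q) = (1 - u) * side x y p + u * side x y q"
  by (simp add: side_def algebra_simps)

lemma side_degenerate [simp]: "side x y x = 0" "side x y y = 0" "side x x y = 0"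
  by (simp_all add: side_def algebra_simps)

lemma continuous_on_side [continuous_intros]:
  "continuous_on S f \<Longrightarrow> continuous_on S (\<lambda>t. side x y (f t))"
  unfolding side_def by (intro continuous_intros)

lemma mem_hull_triangle_side:
  assumes "side x y z \<noteq> 0"
  shows "p \<in> convex hull {x, y, z} \<longleftrightarrow>
    side x y p / side x y z \<ge> 0 \<and> side y z p / side x y z \<ge> 0 \<and> side z x p / side x y z \<ge> 0"
    (is "_ \<longleftrightarrow> ?r")
proof
  assume "p \<in> convex hull {x, y, z}"
  then obtain u v w where uvw: "p = u *\<^sub>R x + v *\<^sub>R y + w *\<^sub>R z" "u \<ge> 0" "v \<ge> 0" "w \<ge> 0" "u + v + w = 1"
    by (auto simp: convex_hull_3)
  have u: "u = 1 - v - w" using uvw by auto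
  have "side x y p = w * side x y z" "side y z p = u * side x y z" "side z x p = v * side x y z"
    unfolding uvw(1) u by (simp_all add: side_def algebra_simps)
  then show ?r using assms uvw by simp
next
  assume ?r
  have "p = (1 / side x y z) *\<^sub>R (side x y z *\<^sub>R p)" using assms by simp
  also have "\<dots> = (side y z p / side x y z) *\<^sub>R x + (side z x p / side x y z) *\<^sub>R y
      + (side x y p / side x y z) *\<^sub>R z"
    by (subst side_barycentric) (simp add: scaleR_add_right)
  finally have p: "p = \<dots>" .
  moreover have "side y z p / side x y z + side z x p / side x y z + side x y p / side x y z = 1"
    using assms side_sum[of x y p z] by (simp add: add_divide_distrib[symmetric] add_ac)
  ultimately show "p \<in> convex hull {x, y, z}"
    using \<open>?r\<close> unfolding convex_hull_3 by blast
qed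

text \<open>The barycentric coordinate belonging to \<open>z\<close> is
  \<open>side x y p / side x y z\<close>, and its vanishing singles out the edge opposite to
  \<open>z\<close>.\<close>

lemma mem_edge_side:
  assumes "side x y z \<noteq> 0"
  shows "p \<in> closed_segment x y \<longleftrightarrow> p \<in> convex hull {x, y, z} \<and> side x y p = 0"
proof
  assume "p \<in> closed_segment x y"
  moreover from this obtain u where "p = (1 - u) *\<^sub>R x + u *\<^sub>R y" by (auto simp: in_segment)
  then have "side x y p = 0" by (simp add: side_affine)
  moreover have "closed_segment x y \<subseteq> convex hull {x, y, z}"
    unfolding segment_convex_hull by (rule hull_mono) auto
  ultimately show "p \<in> convex hull {x, y, z} \<and> side x y p = 0" by blast
next
  assume p: "p \<in> convex hull {x, y, z} \<and> side x y p = 0"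
  then obtain u v w where uvw: "p = u *\<^sub>R x + v *\<^sub>R y + w *\<^sub>R z" "u \<ge> 0" "v \<ge> 0" "w \<ge> 0" "u + v + w = 1"
    by (auto simp: convex_hull_3)
  have u: "u = 1 - v - w" using uvw by auto
  have "side x y p = w * side x y z"
    unfolding uvw(1) u by (simp_all add: side_def algebra_simps)
  then have "w = 0" using assms p by auto
  then have "p = (1 - v) *\<^sub>R x + v *\<^sub>R y" "v \<le> 1" using uvw u by auto
  then show "p \<in> closed_segment x y" using uvw by (auto simp: in_segment)
qed

section \<open>Counting crossings along segments and along curves\<close>

lemma crossings_commute: "crossings l x y = crossings l y x"
  by (simp add: crossings_def closed_segment_commute)

lemma flux_sign_commute: "flux_sign l x y = flux_sign l y x"
  by (simp add: flux_sign_def crossings_commute[of l x y])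

text \<open>Serves twice: for two segments that meet only in a site, which is off the curves, and
  for two curves that meet only in the vertex, which is off the segments.\<close>

lemma Int_Int_eq_empty: "A \<inter> B = {y} \<Longrightarrow> y \<notin> C \<Longrightarrow> (A \<inter> C) \<inter> (B \<inter> C) = {}"
  by (auto simp: set_eq_iff)

text \<open>Settles degenerate triangles: the middle site lies on no curve, so no crossing is
  counted twice or lost.\<close>

lemma crossings_between:
  assumes "pos y \<in> closed_segment (pos x) (pos z)" "pos y \<notin> curve_union l"
    and "finite (closed_segment (pos x) (pos z) \<inter> curve_union l)"
  shows "crossings l x z = crossings l x y + crossings l y z"
proof -
  have "closed_segment (pos x) (pos z) \<inter> curve_union l =
      (closed_segment (pos x) (pos y) \<inter> curve_union l) \<union> (closed_segment (pos y) (pos z) \<inter> curve_union l)"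
    using Un_closed_segment[OF assms(1)] by blast
  moreover have "(closed_segment (pos x) (pos y) \<inter> curve_union l) \<inter>
      (closed_segment (pos y) (pos z) \<inter> curve_union l) = {}"
    by (rule Int_Int_eq_empty[OF Int_closed_segment[OF disjI1[OF assms(1)]] assms(2)])
  ultimately show ?thesis
    unfolding crossings_def using assms(3) by (simp add: card_Un_disjoint)
qed

lemma side_zero_collinear:
  assumes "side x y z = 0"
  shows "z \<in> closed_segment x y \<or> x \<in> closed_segment y z \<or> y \<in> closed_segment x z"
proof -
  have "collinear {0, x - y, z - y}"
  proof (cases "x = y")
    case False
    then have "(fst x - fst y)\<^sup>2 + (snd x - snd y)\<^sup>2 \<noteq> 0"
      by (simp add: prod_eq_iff sum_power2_eq_zero_iff)
    \<comment> \<open>\<open>d / N\<close> is the coefficient of the orthogonal projection of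
      \<open>z - y\<close> onto \<open>x - y\<close>; the vanishing area makes this projection
      exact.\<close>
    define N where "N = (fst x - fst y)\<^sup>2 + (snd x - snd y)\<^sup>2"
    define d where "d = (fst x - fst y) * (fst z - fst y) + (snd x - snd y) * (snd z - snd y)"
    have "N \<noteq> 0" unfolding N_def by fact
    have e: "(fst x - fst y) * (snd z - snd y) = (snd x - snd y) * (fst z - fst y)"
      using assms by (simp add: side_def algebra_simps)
    have "N * (fst z - fst y) = d * (fst x - fst y)" "N * (snd z - snd y) = d * (snd x - snd y)"
      using e unfolding N_def d_def by algebra+
    then have "z - y = (d / N) *\<^sub>R (x - y)"
      using \<open>N \<noteq> 0\<close> by (simp add: prod_eq_iff field_simps)
    then show ?thesis unfolding collinear_lemma by blast
  qed simp
  then have "collinear {x, y, z}"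
    using collinear_3[of x y z] by (simp add: NO_MATCH_def)
  then show ?thesis
    unfolding collinear_between_cases between_mem_segment
    by (metis closed_segment_commute)
qed

lemma finite_curve_parameters:
  assumes "inj_on f {0..}" "finite (S \<inter> f ` {0..})"
  shows "finite {t\<in>{0..}. f t \<in> S}"
proof -
  have "f ` {t\<in>{0..}. f t \<in> S} \<subseteq> S \<inter> f ` {0..}" by auto
  then have "finite (f ` {t\<in>{0..}. f t \<in> S})" using assms(2) finite_subset by blast
  then show ?thesis by (rule finite_imageD) (rule inj_on_subset[OF assms(1)], auto)
qed

text \<open>Trades points of the plane for parameter values of single curves, where parity can be
  studied on the real line. Each curve is injective, and different curves share only the vertex,
  which lies on no segment between sites.\<close>

lemma crossings_eq_sum_curves:
  fixes l :: "nat \<Rightarrow> real \<Rightarrow> real \<times> real"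
  assumes "boundary_curves v l" "generic_position v l"
  shows "crossings l x y = (\<Sum>i\<in>{1,2,3}. card {t\<in>{0::real..}. l i t \<in> closed_segment (pos x) (pos y)})"
proof -
  let ?S = "closed_segment (pos x) (pos y)"
  have v: "v \<notin> ?S" and fin: "finite (?S \<inter> curve_union l)"
    using assms(2) unfolding generic_position_def by blast+
  have fin_i: "finite (?S \<inter> l i ` {0..})" if "i \<in> {1,2,3}" for i
    by (rule finite_subset[OF _ fin]) (use that in \<open>auto simp: curve_union_def\<close>)
  have "?S \<inter> curve_union l = (\<Union>i\<in>{1,2,3}. ?S \<inter> l i ` {0..})"
    by (auto simp: curve_union_def)
  then have "crossings l x y = card (\<Union>i\<in>{1,2,3}. ?S \<inter> l i ` {0..})"
    by (simp add: crossings_def)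
  also have "\<dots> = (\<Sum>i\<in>{1,2,3}. card (?S \<inter> l i ` {0..}))"
  proof (rule card_UN_disjoint)
    show "\<forall>i\<in>{1,2,3}. \<forall>j\<in>{1,2,3}. i \<noteq> j \<longrightarrow> ?S \<inter> l i ` {0..} \<inter> (?S \<inter> l j ` {0..}) = {}"
    proof (intro ballI impI)
      fix i j :: nat assume "i \<in> {1,2,3}" "j \<in> {1,2,3}" "i \<noteq> j"
      then have "l i ` {0..} \<inter> l j ` {0..} = {v}" using assms(1) unfolding boundary_curves_def by blast
      then have "(l i ` {0..} \<inter> ?S) \<inter> (l j ` {0..} \<inter> ?S) = {}" using v by (rule Int_Int_eq_empty)
      then show "?S \<inter> l i ` {0..} \<inter> (?S \<inter> l j ` {0..}) = {}" by (simp only: Int_commute)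
    qed
  qed (use fin_i in auto)
  also have "\<dots> = (\<Sum>i\<in>{1,2,3}. card {t\<in>{0..}. l i t \<in> ?S})"
  proof (rule sum.cong[OF refl])
    fix i :: nat assume "i \<in> {1,2,3}"
    then have inj: "inj_on (l i) {0..}" using assms(1) unfolding boundary_curves_def by blast
    have "?S \<inter> l i ` {0..} = l i ` {t\<in>{0..}. l i t \<in> ?S}" by auto
    then show "card (?S \<inter> l i ` {0..}) = card {t\<in>{0..}. l i t \<in> ?S}"
      using card_image[OF inj_on_subset[OF inj]] by (metis (no_types, lifting) mem_Collect_eq subsetI)
  qed
  finally show ?thesis .
qed

text \<open>The minimum \<open>m\<close> of the three barycentric coordinates along the curve is
  negative outside the triangle and vanishes exactly on its boundary. It is negative at the start,
  since the vertex is outside, and negative far out, since the curve tends to infinity. Generic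
  position makes every zero a sign change, so the number of zeros is even.\<close>

lemma even_curve_triangle_crossings:
  assumes "boundary_curves v l" "generic_position v l" and i: "i \<in> {1,2,3}"
    and D: "side (pos x) (pos y) (pos z) \<noteq> 0" and out: "v \<notin> convex hull {pos x, pos y, pos z}"
  shows "even (card {t\<in>{0..}. l i t \<in> closed_segment (pos x) (pos y)}
     + card {t\<in>{0..}. l i t \<in> closed_segment (pos y) (pos z)}
     + card {t\<in>{0..}. l i t \<in> closed_segment (pos z) (pos x)})"
proof -
  define X Y Z where XYZ: "X = pos x" "Y = pos y" "Z = pos z"
  define D where "D = side X Y Z"
  note D_nz = D[folded XYZ, folded D_def]
  have rot: "side Y Z X = D" "side Z X Y = D" by (simp_all add: D_def side_def algebra_simps)
  define a b c where abc: "a = (\<lambda>t. side X Y (l i t) / D)" "b = (\<lambda>t. side Y Z (l i t) / D)"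
    "c = (\<lambda>t. side Z X (l i t) / D)"
  define m where "m = (\<lambda>t. min (a t) (min (b t) (c t)))"
  have hull_eq: "convex hull {Y, Z, X} = convex hull {X, Y, Z}" "convex hull {Z, X, Y} = convex hull {X, Y, Z}"
    by (simp_all add: insert_commute)
  have hull: "l i t \<in> convex hull {X, Y, Z} \<longleftrightarrow> m t \<ge> 0" for t
    using mem_hull_triangle_side[of X Y Z "l i t"] D_nz by (auto simp: D_def abc m_def)
  have edge: "l i t \<in> closed_segment X Y \<longleftrightarrow> m t \<ge> 0 \<and> a t = 0"
      "l i t \<in> closed_segment Y Z \<longleftrightarrow> m t \<ge> 0 \<and> b t = 0"
      "l i t \<in> closed_segment Z X \<longleftrightarrow> m t \<ge> 0 \<and> c t = 0" for t
    using mem_edge_side[of X Y Z "l i t"] mem_edge_side[of Y Z X "l i t"] mem_edge_side[of Z X Y "l i t"]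
      D_nz hull[of t] unfolding rot hull_eq by (simp_all add: D_def abc)
  have li: "continuous_on {0..} (l i)" "inj_on (l i) {0..}" "l i 0 = v" "filterlim (l i) at_infinity at_top"
    using assms(1) i unfolding boundary_curves_def by blast+
  have cont: "continuous_on {0..} a" "continuous_on {0..} b" "continuous_on {0..} c"
    unfolding abc using D_nz by (auto intro!: continuous_intros li(1))
  have "continuous_on {0..} m" unfolding m_def by (intro continuous_intros cont)
  have m0: "m 0 < 0" using hull[of 0] out li(3) by (auto simp: XYZ)
  have "bounded (convex hull {X, Y, Z})" by (rule bounded_convex_hull) auto
  then obtain B where B: "\<And>p. p \<in> convex hull {X, Y, Z} \<Longrightarrow> norm p \<le> B"
    unfolding bounded_iff by blast
  have "eventually (\<lambda>t. norm (l i t) \<ge> B + 1) at_top"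
  proof -
    have "eventually (\<lambda>t. max (B + 1) 1 \<le> norm (l i t)) at_top"
      using li(4) unfolding filterlim_at_infinity[OF order_refl] by (elim allE[of _ "max (B + 1) 1"]) simp
    then show ?thesis by (rule eventually_mono) simp
  qed
  then obtain T where T: "\<And>t. t \<ge> T \<Longrightarrow> norm (l i t) \<ge> B + 1"
    unfolding eventually_at_top_linorder by blast
  define T0 where "T0 = max T 0"
  have far: "m t < 0" if "t \<ge> T0" for t
  proof -
    have "norm (l i t) \<ge> B + 1" using T that by (simp add: T0_def)
    then have "l i t \<notin> convex hull {X, Y, Z}" using B[of "l i t"] by linarith
    then show ?thesis using hull[of t] by linarith
  qed
  have sites: "l i t \<noteq> X" "l i t \<noteq> Y" "l i t \<noteq> Z" if "t \<ge> 0" for t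
  proof -
    have "pos u \<notin> curve_union l" for u using assms(2) unfolding generic_position_def by blast
    moreover have "l i t \<in> curve_union l" unfolding curve_union_def using i that by blast
    ultimately show "l i t \<noteq> X" "l i t \<noteq> Y" "l i t \<noteq> Z" unfolding XYZ by metis+
  qed
  \<comment> \<open>Two vanishing coordinates would put the curve at a corner, which is a site and
    thus off the curves. Hence each boundary point belongs to exactly one edge and the three counts
    add up.\<close>
  have ca: "X = l i t" if "t \<ge> 0" "a t = 0" "c t = 0" for t
    using side_barycentric[of X Y Z "l i t"] side_sum[of X Y "l i t" Z] that D_nz
    by (auto simp: abc D_def[symmetric])
  have ab: "Y = l i t" if "t \<ge> 0" "a t = 0" "b t = 0" for t
    using side_barycentric[of X Y Z "l i t"] side_sum[of X Y "l i t" Z] that D_nz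
    by (auto simp: abc D_def[symmetric])
  have bc: "Z = l i t" if "t \<ge> 0" "b t = 0" "c t = 0" for t
    using side_barycentric[of X Y Z "l i t"] side_sum[of X Y "l i t" Z] that D_nz
    by (auto simp: abc D_def[symmetric])
  have disj: "\<not> (a t = 0 \<and> b t = 0)" "\<not> (b t = 0 \<and> c t = 0)" "\<not> (a t = 0 \<and> c t = 0)" if "t \<ge> 0" for t
    using ca[OF that] ab[OF that] bc[OF that] sites[OF that] by auto
  let ?A = "{t\<in>{0..}. l i t \<in> closed_segment X Y}"
  let ?B = "{t\<in>{0..}. l i t \<in> closed_segment Y Z}"
  let ?C = "{t\<in>{0..}. l i t \<in> closed_segment Z X}"
  have fin: "finite ?A" "finite ?B" "finite ?C"
  proof -
    have "finite (closed_segment (pos x') (pos y') \<inter> l i ` {0..})" for x' y'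
    proof (rule finite_subset)
      show "closed_segment (pos x') (pos y') \<inter> l i ` {0..} \<subseteq> closed_segment (pos x') (pos y') \<inter> curve_union l"
        unfolding curve_union_def using i by blast
      show "finite (closed_segment (pos x') (pos y') \<inter> curve_union l)"
        using assms(2) unfolding generic_position_def by blast
    qed
    then show "finite ?A" "finite ?B" "finite ?C"
      unfolding XYZ by (rule finite_curve_parameters[OF li(2)])+
  qed
  have zeros: "{t\<in>{0..T0}. m t = 0} = ?A \<union> ?B \<union> ?C"
  proof (rule set_eqI)
    fix t show "t \<in> {t\<in>{0..T0}. m t = 0} \<longleftrightarrow> t \<in> ?A \<union> ?B \<union> ?C"
      using far[of t] unfolding edge Un_iff mem_Collect_eq atLeastAtMost_iff atLeast_iff
      by (cases "t \<le> T0") (auto simp: m_def min_def split: if_splits)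
  qed
  have "card (?A \<union> ?B \<union> ?C) = card ?A + card ?B + card ?C"
  proof -
    have "?A \<inter> ?B = {}" "(?A \<union> ?B) \<inter> ?C = {}" using disj unfolding edge by auto
    then show ?thesis using fin by (simp add: card_Un_disjoint)
  qed
  moreover have "sgn (m 0) * sgn (m T0) = (- 1) ^ card {t\<in>{0..T0}. m t = 0}"
  proof (rule sgn_parity_of_zeros)
    show "continuous_on {0..T0} m" by (rule continuous_on_subset[OF \<open>continuous_on {0..} m\<close>]) auto
    show "finite {t\<in>{0..T0}. m t = 0}" unfolding zeros using fin by simp
    fix t assume t: "t \<in> {0..T0}" "m t = 0"
    have t_pos: "t > 0" using t m0 by (cases "t = 0") auto
    have gen: "\<exists>\<delta>>0. \<forall>t1\<in>{t-\<delta><..<t}. \<forall>t2\<in>{t<..<t+\<delta>}.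
           side (pos x') (pos y') (l i t1) * side (pos x') (pos y') (l i t2) < 0"
      if "l i t \<in> closed_segment (pos x') (pos y')" for x' y'
      using assms(2) i t_pos that unfolding generic_position_def by blast
    have pos_near: "\<exists>\<delta>>0. \<forall>s. \<bar>s - t\<bar> < \<delta> \<longrightarrow> g s > 0"
      if g: "continuous_on {0..} g" "g t > 0" for g :: "real \<Rightarrow> real"
    proof -
      have "isCont g t" using g(1) t_pos continuous_on_interior[of "{0..}" g t] by auto
      then have "(g \<longlongrightarrow> g t) (nhds t)"
        unfolding isCont_def by (simp only: tendsto_at_iff_tendsto_nhds)
      then have "eventually (\<lambda>s. g s > 0) (nhds t)"
        using g(2) by (rule order_tendstoD(1))
      then show ?thesis unfolding eventually_nhds_metric by (auto simp: dist_real_def)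
    qed
    \<comment> \<open>One argument for all three edges: \<open>f\<close> is the coordinate that
      vanishes at \<open>t\<close>, while \<open>g\<close> and \<open>h\<close> stay positive
      nearby, so close to \<open>t\<close> the minimum has the sign of \<open>f\<close>. The
      orientation \<open>D\<close> enters only through the positive factor
      \<open>D * D\<close>.\<close>
    have step: "\<exists>\<delta>>0. \<forall>t1\<in>{t-\<delta><..<t}. \<forall>t2\<in>{t<..<t+\<delta>}. m t1 * m t2 < 0"
      if h: "m = (\<lambda>t. min (f t) (min (g t) (h t)))" "continuous_on {0..} g" "continuous_on {0..} h"
        "g t > 0" "h t > 0" "f = (\<lambda>t. side (pos x') (pos y') (l i t) / D)"
        "l i t \<in> closed_segment (pos x') (pos y')" for f g h x' y'
    proof -
      obtain \<delta>1 where 1: "\<delta>1 > 0" "\<And>s. \<bar>s - t\<bar> < \<delta>1 \<Longrightarrow> g s > 0" using pos_near[OF h(2,4)] by blast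
      obtain \<delta>2 where 2: "\<delta>2 > 0" "\<And>s. \<bar>s - t\<bar> < \<delta>2 \<Longrightarrow> h s > 0" using pos_near[OF h(3,5)] by blast
      obtain \<delta>3 where 3: "\<delta>3 > 0" "\<And>t1 t2. t1 \<in> {t-\<delta>3<..<t} \<Longrightarrow> t2 \<in> {t<..<t+\<delta>3} \<Longrightarrow>
           side (pos x') (pos y') (l i t1) * side (pos x') (pos y') (l i t2) < 0"
        using gen[OF h(7)] by blast
      define \<delta> where "\<delta> = min \<delta>1 (min \<delta>2 \<delta>3)"
      have \<delta>_le: "\<delta> \<le> \<delta>1" "\<delta> \<le> \<delta>2" "\<delta> \<le> \<delta>3" by (simp_all add: \<delta>_def)
      have "m t1 * m t2 < 0" if t12: "t1 \<in> {t-\<delta><..<t}" "t2 \<in> {t<..<t+\<delta>}" for t1 t2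
      proof -
        have "side (pos x') (pos y') (l i t1) * side (pos x') (pos y') (l i t2) < 0"
          using 3(2)[of t1 t2] t12 \<delta>_le by simp
        then have "side (pos x') (pos y') (l i t1) * side (pos x') (pos y') (l i t2) / (D * D) < 0"
          using D_nz by (intro divide_neg_pos) (auto simp: zero_less_mult_iff)
        then have "f t1 * f t2 < 0" unfolding h(6) by simp
        moreover have "g t1 > 0" "g t2 > 0" "h t1 > 0" "h t2 > 0"
          using 1(2)[of t1] 1(2)[of t2] 2(2)[of t1] 2(2)[of t2] t12 \<delta>_le by simp_all
        ultimately show ?thesis unfolding h(1) by (auto simp: mult_less_0_iff min_less_iff_disj)
      qed
      moreover have "\<delta> > 0" using 1 2 3 by (simp add: \<delta>_def)
      ultimately show ?thesis by blast
    qed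
    have m': "m = (\<lambda>t. min (b t) (min (a t) (c t)))" "m = (\<lambda>t. min (c t) (min (a t) (b t)))"
      unfolding m_def by (simp_all add: min.assoc min.commute min.left_commute)
    have ge: "a t \<ge> 0" "b t \<ge> 0" "c t \<ge> 0" using t(2) unfolding m_def by (auto simp: min_def split: if_splits)
    consider "a t = 0" | "b t = 0" | "c t = 0" using t(2) unfolding m_def by (auto simp: min_def split: if_splits)
    then show "\<exists>\<delta>>0. \<forall>t1\<in>{t-\<delta><..<t}. \<forall>t2\<in>{t<..<t+\<delta>}. m t1 * m t2 < 0"
    proof cases
      case 1
      show ?thesis
        by (rule step[OF m_def cont(2,3) _ _ abc(1)[unfolded XYZ]])
          (use 1 disj[of t] t_pos ge t(2) edge(1)[of t] in \<open>auto simp: XYZ\<close>)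
    next
      case 2
      show ?thesis
        by (rule step[OF m'(1) cont(1,3) _ _ abc(2)[unfolded XYZ]])
          (use 2 disj[of t] t_pos ge t(2) edge(2)[of t] in \<open>auto simp: XYZ\<close>)
    next
      case 3
      show ?thesis
        by (rule step[OF m'(2) cont(1,2) _ _ abc(3)[unfolded XYZ]])
          (use 3 disj[of t] t_pos ge t(2) edge(3)[of t] in \<open>auto simp: XYZ\<close>)
    qed
  qed (use m0 far[of T0] in \<open>auto simp: T0_def\<close>)
  moreover have "sgn (m 0) * sgn (m T0) = 1" using m0 far[of T0] by simp
  ultimately have "(- 1 :: real) ^ (card ?A + card ?B + card ?C) = 1" unfolding zeros by simp
  then have "even (card ?A + card ?B + card ?C)" by (simp add: minus_one_power_iff split: if_splits)
  then show ?thesis unfolding XYZ .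
qed

text \<open>This is the locality of \<open>Q^2 - Q\<close>: a sign -1 forces the vertex into the
  triangle, and then long hops are unavoidable for sites far from the vertex. A proper triangle is
  handled curve by curve, a collinear triple by additivity along the longest segment.\<close>

theorem flux_sign3_outside:
  assumes "boundary_curves v l" "generic_position v l"
    and out: "v \<notin> convex hull {pos x, pos y, pos z}"
  shows "flux_sign3 l x y z = 1"
proof -
  have flux: "flux_sign3 l x y z = (- 1) ^ (crossings l x y + crossings l y z + crossings l z x)"
    by (simp add: flux_sign3_def flux_sign_def power_add)
  have "even (crossings l x y + crossings l y z + crossings l z x)"
  proof (cases "side (pos x) (pos y) (pos z) = 0")
    case False
    let ?c = "\<lambda>i x y. card {t\<in>{0..}. l i t \<in> closed_segment (pos x) (pos y)}"
    have "crossings l x y + crossings l y z + crossings l z x =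
      (\<Sum>i\<in>{1,2,3}. ?c i x y + ?c i y z + ?c i z x)"
      unfolding crossings_eq_sum_curves[OF assms(1,2)] sum.distrib ..
    moreover have "even \<dots>"
      by (rule dvd_sum) (rule even_curve_triangle_crossings[OF assms(1,2) _ False out])
    ultimately show ?thesis by simp
  next
    case True
    have gen: "pos u \<notin> curve_union l" "finite (closed_segment (pos u) (pos w) \<inter> curve_union l)" for u w
      using assms(2) unfolding generic_position_def by blast+
    consider "pos z \<in> closed_segment (pos x) (pos y)" | "pos x \<in> closed_segment (pos y) (pos z)"
      | "pos y \<in> closed_segment (pos x) (pos z)" using side_zero_collinear[OF True] by blast
    then show ?thesis
    proof cases
      case 1
      from crossings_between[OF 1 gen(1) gen(2)] show ?thesis
        using crossings_commute[of l z y] crossings_commute[of l z x] by presburger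
    next
      case 2
      from crossings_between[OF 2 gen(1) gen(2)] show ?thesis
        using crossings_commute[of l y x] crossings_commute[of l z x] by presburger
    next
      case 3
      from crossings_between[OF 3 gen(1) gen(2)] show ?thesis
        using crossings_commute[of l z y] crossings_commute[of l z x] by presburger
    qed
  qed
  then show ?thesis unfolding flux by simp
qed

subsection \<open>The Hilbert space of square-summable families\<close>

lemma cmod_mult_le_squares: "cmod (a * b) \<le> (cmod a)\<^sup>2 + (cmod b)\<^sup>2"
proof -
  have "2 * (cmod a * cmod b) \<le> (cmod a)\<^sup>2 + (cmod b)\<^sup>2"
    using sum_squares_bound[of "cmod a" "cmod b"] by (simp add: mult.assoc)
  moreover have "0 \<le> cmod a * cmod b" by simp
  ultimately show ?thesis unfolding norm_mult by linarith
qed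

lemma cmod_add_square_le: "(cmod (a + b))\<^sup>2 \<le> 2 * (cmod a)\<^sup>2 + 2 * (cmod b)\<^sup>2"
proof -
  have "(cmod (a + b))\<^sup>2 \<le> (cmod a + cmod b)\<^sup>2"
    by (rule power_mono) (auto intro: norm_triangle_ineq)
  also have "\<dots> \<le> 2 * (cmod a)\<^sup>2 + 2 * (cmod b)\<^sup>2"
    using sum_squares_bound[of "cmod a" "cmod b"] by (simp add: power2_sum)
  finally show ?thesis .
qed

definition square_summable :: "('i \<Rightarrow> complex) \<Rightarrow> bool" where
  "square_summable f \<longleftrightarrow> (\<lambda>x. (cmod (f x))\<^sup>2) summable_on UNIV"

lemma square_summable_add:
  assumes "square_summable f" "square_summable g"
  shows "square_summable (\<lambda>x. f x + g x)"
proof -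
  have "(\<lambda>x. 2 * (cmod (f x))\<^sup>2 + 2 * (cmod (g x))\<^sup>2) summable_on UNIV"
    using assms unfolding square_summable_def by (intro summable_on_add summable_on_cmult_right)
  then show ?thesis unfolding square_summable_def
    by (rule summable_on_comparison_test) (auto intro: cmod_add_square_le)
qed

lemma square_summable_cmult: "square_summable f \<Longrightarrow> square_summable (\<lambda>x. c * f x)"
  unfolding square_summable_def norm_mult power_mult_distrib by (intro summable_on_cmult_right)

lemma square_summable_finite: "finite {x. f x \<noteq> 0} \<Longrightarrow> square_summable f"
  unfolding square_summable_def by (rule finite_nonzero_values_imp_summable_on) simp

lemma abs_summable_cnj_mult:
  assumes "square_summable f" "square_summable g"
  shows "(\<lambda>x. cmod (cnj (f x) * g x)) summable_on UNIV"
proof -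
  have "(\<lambda>x. (cmod (f x))\<^sup>2 + (cmod (g x))\<^sup>2) summable_on UNIV"
    using assms unfolding square_summable_def by (intro summable_on_add)
  then show ?thesis
    by (rule summable_on_comparison_test) (use cmod_mult_le_squares[of "cnj (f _)"] in auto)
qed

lemma square_summable_bound:
  assumes "\<And>F. finite F \<Longrightarrow> (\<Sum>x\<in>F. (cmod (f x))\<^sup>2) \<le> B"
  shows "square_summable f" "(\<Sum>\<^sub>\<infinity>x. (cmod (f x))\<^sup>2) \<le> B"
proof -
  show ss: "square_summable f" unfolding square_summable_def
    by (rule nonneg_bdd_above_summable_on) (use assms in \<open>auto intro!: bdd_aboveI2\<close>)
  show "(\<Sum>\<^sub>\<infinity>x. (cmod (f x))\<^sup>2) \<le> B"
    by (rule infsum_le_finite_sums) (use ss assms in \<open>auto simp: square_summable_def\<close>)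
qed

text \<open>A type in place of the set \<open>l2\<close> makes the class machinery of inner product
  and Banach spaces available: limits, bounded linear maps, unordered sums. The index type stays
  general; sites paired with internal states are used later.\<close>

typedef 'i ell2 = "{f :: 'i \<Rightarrow> complex. square_summable f}"
  morphisms nth_ell2 Abs_ell2
  by (rule exI[of _ "\<lambda>_. 0"]) (simp add: square_summable_def)

lemma square_summable_nth [simp]: "square_summable (nth_ell2 f)"
  using nth_ell2 by blast

lemma nth_Abs_ell2: "square_summable f \<Longrightarrow> nth_ell2 (Abs_ell2 f) = f"
  by (simp add: Abs_ell2_inverse)

lemma ell2_eqI: "(\<And>x. nth_ell2 f x = nth_ell2 g x) \<Longrightarrow> f = g"
  by (metis ext nth_ell2_inject)

definition cinner :: "'i ell2 \<Rightarrow> 'i ell2 \<Rightarrow> complex" where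
  "cinner f g = (\<Sum>\<^sub>\<infinity>x. cnj (nth_ell2 f x) * nth_ell2 g x)"

definition scaleC :: "complex \<Rightarrow> 'i ell2 \<Rightarrow> 'i ell2" (infixr \<open>*\<^sub>c\<close> 75) where
  "c *\<^sub>c f = Abs_ell2 (\<lambda>x. c * nth_ell2 f x)"

lemma nth_scaleC [simp]: "nth_ell2 (c *\<^sub>c f) x = c * nth_ell2 f x"
  by (simp add: scaleC_def nth_Abs_ell2 square_summable_cmult)

lemma abs_summable_cinner: "(\<lambda>x. cmod (cnj (nth_ell2 f x) * nth_ell2 g x)) summable_on UNIV"
  by (rule abs_summable_cnj_mult) simp_all

lemma has_sum_cinner: "((\<lambda>x. cnj (nth_ell2 f x) * nth_ell2 g x) has_sum cinner f g) UNIV"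
  unfolding cinner_def by (rule has_sum_infsum) (rule abs_summable_summable[OF abs_summable_cinner])

lemma cinner_commute: "cinner g f = cnj (cinner f g)"
  unfolding cinner_def infsum_cnj[symmetric] by (simp add: mult.commute)

text \<open>The class asks for a real inner product, so the real part of \<open>cinner\<close> is
  taken. It induces the same norm, and \<open>cinner\<close> itself remains in use wherever phases
  matter.\<close>

instantiation ell2 :: (type) real_inner
begin

definition "0 = Abs_ell2 (\<lambda>_. 0)"
definition "f + g = Abs_ell2 (\<lambda>x. nth_ell2 f x + nth_ell2 g x)"
definition "- f = (- 1) *\<^sub>c (f :: 'a ell2)"
definition "f - g = f + - (g :: 'a ell2)"
definition "r *\<^sub>R f = of_real r *\<^sub>c (f :: 'a ell2)"
definition "inner f g = Re (cinner f (g :: 'a ell2))"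
definition "norm f = sqrt (inner f (f :: 'a ell2))"
definition "sgn f = inverse (norm f) *\<^sub>R (f :: 'a ell2)"
definition "dist f g = norm (f - (g :: 'a ell2))"
definition "uniformity = (INF e\<in>{0<..}. principal {(f, g :: 'a ell2). dist f g < e})"
definition "open U = (\<forall>f\<in>U. \<forall>\<^sub>F (f', g) in uniformity. f' = f \<longrightarrow> (g :: 'a ell2) \<in> U)"

lemma nth_zero [simp]: "nth_ell2 0 x = 0"
  by (simp add: zero_ell2_def nth_Abs_ell2 square_summable_def)

lemma nth_add [simp]: "nth_ell2 (f + g) x = nth_ell2 f x + nth_ell2 g x"
  by (simp add: plus_ell2_def nth_Abs_ell2 square_summable_add)

lemma nth_minus [simp]: "nth_ell2 (- f) x = - nth_ell2 f x"
  by (simp add: uminus_ell2_def)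

lemma nth_diff [simp]: "nth_ell2 (f - g) x = nth_ell2 f x - nth_ell2 g x"
  by (simp add: minus_ell2_def)

lemma nth_scaleR [simp]: "nth_ell2 (r *\<^sub>R f) x = of_real r * nth_ell2 f x"
  by (simp add: scaleR_ell2_def)

lemma cinner_add_right: "cinner f (g + h) = cinner f g + cinner f h"
  using has_sum_add[OF has_sum_cinner[of f g] has_sum_cinner[of f h]] has_sum_cinner[of f "g + h"]
  by (simp add: distrib_left has_sum_unique)

lemma cinner_add_left: "cinner (g + h) f = cinner g f + cinner h f"
  by (metis cinner_add_right cinner_commute complex_cnj_add)

lemma cinner_scaleC_right [simp]: "cinner f (c *\<^sub>c g) = c * cinner f g"
  using has_sum_cmult_right[OF has_sum_cinner[of f g], of c] has_sum_cinner[of f "c *\<^sub>c g"]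
  by (simp add: mult.left_commute has_sum_unique)

lemma cinner_scaleC_left [simp]: "cinner (c *\<^sub>c f) g = cnj c * cinner f g"
  by (metis cinner_commute cinner_scaleC_right complex_cnj_mult)

lemma cinner_self_Re: "((\<lambda>x. (cmod (nth_ell2 f x))\<^sup>2) has_sum Re (cinner f f)) UNIV"
  using has_sum_Re[OF has_sum_cinner[of f f]]
  unfolding cmod_power2 by (simp add: power2_eq_square)

instance
proof
  fix f g h :: "'a ell2" and a b :: real
  show "f + g + h = f + (g + h)" "f + g = g + f" "0 + f = f" "- f + f = 0" "f - g = f + - g"
    "a *\<^sub>R (f + g) = a *\<^sub>R f + a *\<^sub>R g" "(a + b) *\<^sub>R f = a *\<^sub>R f + b *\<^sub>R f"
    "a *\<^sub>R b *\<^sub>R f = (a * b) *\<^sub>R f" "1 *\<^sub>R f = f"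
    by (auto intro!: ell2_eqI simp: algebra_simps)
  show "dist f g = norm (f - g)" by (rule dist_ell2_def)
  show "sgn f = inverse (norm f) *\<^sub>R f" by (rule sgn_ell2_def)
  show "uniformity = (INF e\<in>{0<..}. principal {(f, g :: 'a ell2). dist f g < e})"
    by (rule uniformity_ell2_def)
  show "open U = (\<forall>f\<in>U. \<forall>\<^sub>F (f', g) in uniformity. f' = f \<longrightarrow> g \<in> U)" for U :: "'a ell2 set"
    by (rule open_ell2_def)
  show "inner f g = inner g f" unfolding inner_ell2_def by (metis cinner_commute complex_cnj(1) cnj.simps(1))
  show "inner (f + g) h = inner f h + inner g h" by (simp add: inner_ell2_def cinner_add_left)
  show "inner (a *\<^sub>R f) g = a * inner f g" by (simp add: inner_ell2_def scaleR_ell2_def)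
  show "0 \<le> inner f f" unfolding inner_ell2_def
    by (rule has_sum_nonneg[OF cinner_self_Re]) simp
  show "inner f f = 0 \<longleftrightarrow> f = 0"
  proof
    assume "inner f f = 0"
    then have "(cmod (nth_ell2 f x))\<^sup>2 = 0" for x
      using nonneg_has_sum_le_0D[OF cinner_self_Re[of f], of x] by (simp add: inner_ell2_def)
    then show "f = 0" by (intro ell2_eqI) simp
  next
    assume "f = 0"
    then show "inner f f = 0" by (simp add: inner_ell2_def cinner_def)
  qed
  show "norm f = sqrt (inner f f)" by (rule norm_ell2_def)
qed

end

lemma Re_cinner: "Re (cinner f g) = inner f g"
  by (simp add: inner_ell2_def)

lemma has_sum_norm_square: "((\<lambda>x. (cmod (nth_ell2 f x))\<^sup>2) has_sum (norm f)\<^sup>2) UNIV"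
  using cinner_self_Re[of f] by (simp add: Re_cinner power2_norm_eq_inner)

lemma cinner_self: "cinner f f = of_real ((norm f)\<^sup>2)"
proof (rule complex_eqI)
  have "cnj (cinner f f) = cinner f f" by (rule cinner_commute[symmetric])
  then show "Im (cinner f f) = Im (of_real ((norm f)\<^sup>2))" by (simp add: complex_eq_iff)
qed (simp add: Re_cinner power2_norm_eq_inner)

lemma scaleR_scaleC: "r *\<^sub>R f = of_real r *\<^sub>c f"
  by (simp add: scaleR_ell2_def)

lemma scaleC_simps [simp]: "c *\<^sub>c 0 = 0" "0 *\<^sub>c f = 0" "1 *\<^sub>c f = f" "c *\<^sub>c d *\<^sub>c f = (c * d) *\<^sub>c f"
  by (auto intro: ell2_eqI)

lemma cinner_zero [simp]: "cinner 0 f = 0" "cinner f 0 = 0"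
  by (simp_all add: cinner_def)

lemma cinner_scaleR_right [simp]: "cinner f (r *\<^sub>R g) = of_real r * cinner f g"
  and cinner_scaleR_left [simp]: "cinner (r *\<^sub>R f) g = of_real r * cinner f g"
  by (simp_all add: scaleR_scaleC)

lemma cinner_minus_right [simp]: "cinner f (- g) = - cinner f g"
  and cinner_minus_left [simp]: "cinner (- f) g = - cinner f g"
  by (simp_all add: uminus_ell2_def)

lemma cinner_diff_right: "cinner f (g - h) = cinner f g - cinner f h"
  and cinner_diff_left: "cinner (g - h) f = cinner g f - cinner h f"
  by (simp_all only: minus_ell2_def cinner_add_right cinner_add_left cinner_minus_right
    cinner_minus_left diff_conv_add_uminus)

lemma cinner_sum_right: "cinner f (sum g A) = (\<Sum>a\<in>A. cinner f (g a))"
  by (induction A rule: infinite_finite_induct) (simp_all add: cinner_add_right)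

lemma cinner_sum_left: "cinner (sum g A) f = (\<Sum>a\<in>A. cinner (g a) f)"
  by (induction A rule: infinite_finite_induct) (simp_all add: cinner_add_left)

lemma norm_scaleC: "norm (c *\<^sub>c f) = cmod c * norm f"
proof -
  have "cinner (c *\<^sub>c f) (c *\<^sub>c f) = of_real ((cmod c * norm f)\<^sup>2)"
    unfolding cinner_scaleC_left cinner_scaleC_right cinner_self[of f] mult.assoc[symmetric]
      complex_norm_square[symmetric] power_mult_distrib of_real_mult by simp
  then have "(norm (c *\<^sub>c f))\<^sup>2 = (cmod c * norm f)\<^sup>2"
    unfolding cinner_self of_real_eq_iff .
  then show ?thesis by (simp add: power2_eq_iff_nonneg)
qed

lemma norm_cinner_le: "cmod (cinner f g) \<le> norm f * norm g"
proof (cases "cinner f g = 0")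
  case False
  define z where "z = cinner f g"
  have "(cmod z)\<^sup>2 = inner (z *\<^sub>c f) g"
    unfolding Re_cinner[symmetric] cinner_scaleC_left z_def[symmetric]
    by (simp add: complex_norm_square[symmetric] mult.commute flip: of_real_power)
  also have "\<dots> \<le> norm (z *\<^sub>c f) * norm g" by (rule norm_cauchy_schwarz)
  finally have "cmod z * cmod z \<le> cmod z * (norm f * norm g)"
    by (simp add: norm_scaleC power2_eq_square mult.assoc)
  moreover have "cmod z > 0" using False by (simp add: z_def)
  ultimately show ?thesis unfolding z_def by (simp only: mult_le_cancel_left_pos)
qed simp

lemma bounded_linear_cinner: "bounded_linear (cinner f)"
  by (rule bounded_linear_intro[where K = "norm f"])
    (use norm_cinner_le[of f] in \<open>auto simp: cinner_add_right scaleR_conv_of_real mult.commute\<close>)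

definition delta :: "'i \<Rightarrow> 'i ell2" where
  "delta x = Abs_ell2 (\<lambda>y. if y = x then 1 else 0)"

lemma nth_delta: "nth_ell2 (delta x) y = (if y = x then 1 else 0)"
  by (simp add: delta_def nth_Abs_ell2 square_summable_finite)

lemma cinner_delta [simp]: "cinner (delta x) f = nth_ell2 f x"
proof -
  have "((\<lambda>y. cnj (nth_ell2 (delta x) y) * nth_ell2 f y) has_sum nth_ell2 f x) UNIV"
    by (rule has_sum_finite_neutralI[where B = "{x}"]) (auto simp: nth_delta)
  then show ?thesis using has_sum_cinner has_sum_unique by blast
qed

lemma norm_delta [simp]: "norm (delta x) = 1"
proof -
  have "of_real ((norm (delta x))\<^sup>2) = (1 :: complex)"
    unfolding cinner_self[symmetric] by (simp add: nth_delta)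
  then have "(norm (delta x))\<^sup>2 = 1\<^sup>2" by (simp only: of_real_eq_1_iff power_one)
  then show ?thesis by (simp only: power2_eq_iff_nonneg norm_ge_zero zero_le_one)
qed

lemma norm_nth_ell2_le: "cmod (nth_ell2 f x) \<le> norm f"
  using norm_cinner_le[of "delta x" f] by simp

lemma bounded_linear_nth: "bounded_linear (\<lambda>f. nth_ell2 f x)"
proof -
  have "cinner (delta x) = (\<lambda>f. nth_ell2 f x)" by (rule ext) simp
  then show ?thesis using bounded_linear_cinner[of "delta x"] by metis
qed

lemma cinner_eqI:
  assumes "\<And>g. cinner g f = cinner g f'"
  shows "f = f'"
  using assms[of "delta _"] by (intro ell2_eqI) simp

lemma sum_nth_squares_le: "finite F \<Longrightarrow> (\<Sum>x\<in>F. (cmod (nth_ell2 f x))\<^sup>2) \<le> (norm f)\<^sup>2"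
  by (rule finite_sum_le_has_sum[OF has_sum_norm_square]) auto

text \<open>Coordinates of a Cauchy sequence converge. The Cauchy estimate, restricted to finite
  sets of coordinates, survives the limit with a bound independent of the set, which gives both
  square-summability of the limit and convergence in norm.\<close>

instance ell2 :: (type) banach
proof
  fix X :: "nat \<Rightarrow> 'a ell2" assume X: "Cauchy X"
  have "Cauchy (\<lambda>n. nth_ell2 (X n) x)" for x
    by (rule bounded_linear.Cauchy[OF bounded_linear_nth X])
  then have "\<exists>L. (\<lambda>n. nth_ell2 (X n) x) \<longlonglongrightarrow> L" for x
    using Cauchy_convergent convergent_def by blast
  then obtain L where L: "\<And>x. (\<lambda>n. nth_ell2 (X n) x) \<longlonglongrightarrow> L x" by metis
  have bound: "\<exists>N. \<forall>n\<ge>N. \<forall>F. finite F \<longrightarrow> (\<Sum>x\<in>F. (cmod (nth_ell2 (X n) x - L x))\<^sup>2) \<le> e\<^sup>2"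
    if "e > 0" for e
  proof -
    obtain N where N: "\<And>m n. m \<ge> N \<Longrightarrow> n \<ge> N \<Longrightarrow> norm (X m - X n) < e"
      using X \<open>e > 0\<close> unfolding Cauchy_def dist_norm by metis
    have "(\<Sum>x\<in>F. (cmod (nth_ell2 (X n) x - L x))\<^sup>2) \<le> e\<^sup>2" if "n \<ge> N" "finite F" for n F
    proof (rule tendsto_upperbound)
      show "(\<lambda>m. \<Sum>x\<in>F. (cmod (nth_ell2 (X n) x - nth_ell2 (X m) x))\<^sup>2) \<longlonglongrightarrow>
          (\<Sum>x\<in>F. (cmod (nth_ell2 (X n) x - L x))\<^sup>2)"
        by (intro tendsto_intros L)
      have "(\<Sum>x\<in>F. (cmod (nth_ell2 (X n) x - nth_ell2 (X m) x))\<^sup>2) \<le> e\<^sup>2" if "m \<ge> N" for m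
      proof -
        have "(\<Sum>x\<in>F. (cmod (nth_ell2 (X n - X m) x))\<^sup>2) \<le> (norm (X n - X m))\<^sup>2"
          by (rule sum_nth_squares_le) fact
        also have "\<dots> \<le> e\<^sup>2" using N[OF \<open>n \<ge> N\<close> that] by (intro power_mono) auto
        finally show ?thesis by simp
      qed
      then show "\<forall>\<^sub>F m in sequentially. (\<Sum>x\<in>F. (cmod (nth_ell2 (X n) x - nth_ell2 (X m) x))\<^sup>2) \<le> e\<^sup>2"
        unfolding eventually_sequentially by blast
    qed simp
    then show ?thesis by blast
  qed
  define d where "d n = (\<lambda>x. nth_ell2 (X n) x - L x)" for n
  obtain N1 where "\<And>F. finite F \<Longrightarrow> (\<Sum>x\<in>F. (cmod (d N1 x))\<^sup>2) \<le> 1\<^sup>2"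
    using bound[of 1] unfolding d_def by auto
  then have "square_summable (d N1)" by (rule square_summable_bound)
  then have "square_summable (\<lambda>x. nth_ell2 (X N1) x + (- 1) * d N1 x)"
    by (intro square_summable_add square_summable_cmult) simp_all
  then have L_ss: "square_summable L" by (simp add: d_def)
  have "X \<longlonglongrightarrow> Abs_ell2 L"
  proof (rule LIMSEQ_I)
    fix e :: real assume "e > 0"
    then obtain N where N: "\<And>n F. n \<ge> N \<Longrightarrow> finite F \<Longrightarrow> (\<Sum>x\<in>F. (cmod (d n x))\<^sup>2) \<le> (e/2)\<^sup>2"
      using bound[of "e/2"] unfolding d_def by auto
    have "norm (X n - Abs_ell2 L) < e" if "n \<ge> N" for n
    proof -
      have "(norm (X n - Abs_ell2 L))\<^sup>2 \<le> (e/2)\<^sup>2"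
        by (rule has_sum_le_finite_sums[OF has_sum_norm_square])
          (use N[OF that] in \<open>simp add: nth_Abs_ell2 L_ss d_def\<close>)
      then have "norm (X n - Abs_ell2 L) \<le> e/2" using \<open>e > 0\<close> by (simp add: power_mono_iff)
      then show ?thesis using \<open>e > 0\<close> by linarith
    qed
    then show "\<exists>no. \<forall>n\<ge>no. norm (X n - Abs_ell2 L) < e" by blast
  qed
  then show "convergent X" unfolding convergent_def by blast
qed

subsection \<open>Orthonormal families and symmetric operators\<close>

text \<open>Finite sums containing a common core \<open>F0\<close> differ only by sums over sets
  disjoint from \<open>F0\<close>, so the net of finite sums is Cauchy and completeness
  applies.\<close>

lemma summable_on_Cauchy_criterion:
  fixes f :: "'a \<Rightarrow> 'b :: banach"
  assumes "\<And>e. e > 0 \<Longrightarrow>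
    \<exists>F0. finite F0 \<and> F0 \<subseteq> A \<and> (\<forall>F. finite F \<longrightarrow> F \<subseteq> A - F0 \<longrightarrow> norm (sum f F) < e)"
  shows "f summable_on A"
proof -
  have "\<exists>P. eventually P (finite_subsets_at_top A) \<and>
      (\<forall>F F'. P F \<and> P F' \<longrightarrow> dist (sum f F) (sum f F') < e)" if e: "e > 0" for e
  proof -
    obtain F0 where F0: "finite F0" "F0 \<subseteq> A" "\<And>F. finite F \<Longrightarrow> F \<subseteq> A - F0 \<Longrightarrow> norm (sum f F) < e/2"
      using assms[of "e/2"] e by auto
    define P where "P F \<longleftrightarrow> finite F \<and> F0 \<subseteq> F \<and> F \<subseteq> A" for F
    have "eventually P (finite_subsets_at_top A)"
      unfolding P_def eventually_finite_subsets_at_top using F0(1,2) by blast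
    moreover have "dist (sum f F) (sum f F') < e" if "P F" "P F'" for F F'
    proof -
      have "sum f F = sum f F0 + sum f (F - F0)" "sum f F' = sum f F0 + sum f (F' - F0)"
        using sum.subset_diff[of F0 F f] sum.subset_diff[of F0 F' f] that
        unfolding P_def by (simp_all add: add.commute)
      then have "dist (sum f F) (sum f F') = norm (sum f (F - F0) - sum f (F' - F0))"
        by (simp add: dist_norm)
      also have "\<dots> \<le> norm (sum f (F - F0)) + norm (sum f (F' - F0))" by (rule norm_triangle_ineq4)
      also have "\<dots> < e/2 + e/2"
        by (intro add_strict_mono F0(3)) (use that in \<open>auto simp: P_def\<close>)
      finally show ?thesis by simp
    qed
    ultimately show ?thesis by blast
  qed
  then have "cauchy_filter (filtermap (sum f) (finite_subsets_at_top A))"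
    by (simp add: cauchy_filter_metric_filtermap)
  moreover have "complete (UNIV :: 'b set)"
    by (meson Cauchy_convergent UNIV_I complete_def convergent_def)
  ultimately obtain L where "(sum f \<longlongrightarrow> L) (finite_subsets_at_top A)"
    using complete_uniform[where S = UNIV] by (force simp add: filterlim_def)
  then show ?thesis
    using summable_on_def has_sum_def by blast
qed

definition orthonormal_family :: "'k set \<Rightarrow> ('k \<Rightarrow> 'i ell2) \<Rightarrow> bool" where
  "orthonormal_family S e \<longleftrightarrow> (\<forall>a\<in>S. \<forall>b\<in>S. cinner (e a) (e b) = (if a = b then 1 else 0))"

lemma orthonormal_familyD:
  "orthonormal_family S e \<Longrightarrow> a \<in> S \<Longrightarrow> b \<in> S \<Longrightarrow> cinner (e a) (e b) = (if a = b then 1 else 0)"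
  by (simp add: orthonormal_family_def)

lemma orthonormal_family_subset: "orthonormal_family S e \<Longrightarrow> A \<subseteq> S \<Longrightarrow> orthonormal_family A e"
  unfolding orthonormal_family_def by blast

lemma norm_orthonormal: "orthonormal_family S e \<Longrightarrow> a \<in> S \<Longrightarrow> norm (e a) = 1"
proof -
  assume "orthonormal_family S e" "a \<in> S"
  then have "of_real ((norm (e a))\<^sup>2) = (1 :: complex)"
    using orthonormal_familyD[of S e a a] unfolding cinner_self by simp
  then have "(norm (e a))\<^sup>2 = 1\<^sup>2" by (simp only: of_real_eq_1_iff power_one)
  then show "norm (e a) = 1" by (simp only: power2_eq_iff_nonneg norm_ge_zero zero_le_one)
qed

lemma cinner_sum_orthonormal:
  assumes "orthonormal_family S e" "finite F" "F \<subseteq> S" "b \<in> S"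
  shows "cinner (e b) (\<Sum>a\<in>F. c a *\<^sub>c e a) = (if b \<in> F then c b else 0)"
proof -
  have "cinner (e b) (\<Sum>a\<in>F. c a *\<^sub>c e a) = (\<Sum>a\<in>F. if b = a then c a else 0)"
    unfolding cinner_sum_right
    by (rule sum.cong[OF refl]) (use assms in \<open>auto simp: orthonormal_familyD subset_iff\<close>)
  then show ?thesis using assms(2) by simp
qed

lemma norm_square_sum_orthonormal:
  assumes "orthonormal_family S e" "finite F" "F \<subseteq> S"
  shows "(norm (\<Sum>a\<in>F. c a *\<^sub>c e a))\<^sup>2 = (\<Sum>a\<in>F. (cmod (c a))\<^sup>2)"
proof -
  let ?s = "\<Sum>a\<in>F. c a *\<^sub>c e a"
  have "cinner ?s ?s = (\<Sum>a\<in>F. cnj (c a) * cinner (e a) ?s)"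
    by (subst cinner_sum_left) simp
  also have "\<dots> = (\<Sum>a\<in>F. cnj (c a) * c a)"
    by (rule sum.cong[OF refl]) (use assms in \<open>auto simp: cinner_sum_orthonormal subset_iff\<close>)
  also have "\<dots> = of_real (\<Sum>a\<in>F. (cmod (c a))\<^sup>2)"
    unfolding of_real_sum complex_norm_square by (simp add: mult.commute)
  finally show ?thesis unfolding cinner_self of_real_eq_iff .
qed

text \<open>The squared distance from \<open>f\<close> to its finite expansion is the difference of
  the two sides.\<close>

lemma bessel:
  assumes "orthonormal_family S e" "finite F" "F \<subseteq> S"
  shows "(\<Sum>a\<in>F. (cmod (cinner (e a) f))\<^sup>2) \<le> (norm f)\<^sup>2"
proof -
  let ?s = "\<Sum>a\<in>F. cinner (e a) f *\<^sub>c e a"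
  let ?B = "\<Sum>a\<in>F. (cmod (cinner (e a) f))\<^sup>2"
  have "cinner ?s f = (\<Sum>a\<in>F. cnj (cinner (e a) f) * cinner (e a) f)"
    unfolding cinner_sum_left by simp
  also have "\<dots> = of_real ?B"
    unfolding of_real_sum complex_norm_square by (simp add: mult.commute)
  finally have "inner ?s f = ?B" unfolding Re_cinner[symmetric] by simp
  then have "(norm (f - ?s))\<^sup>2 = (norm f)\<^sup>2 - 2 * ?B + (norm ?s)\<^sup>2"
    using inner_commute[of f ?s] by (simp add: power2_norm_eq_inner inner_diff_left inner_diff_right)
  also have "(norm ?s)\<^sup>2 = ?B" by (rule norm_square_sum_orthonormal[OF assms])
  finally show ?thesis using zero_le_power2[of "norm (f - ?s)"] by linarith
qed

lemma bessel_summable: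
  assumes "orthonormal_family S e"
  shows "(\<lambda>a. (cmod (cinner (e a) f))\<^sup>2) summable_on S"
  by (rule nonneg_bdd_above_summable_on) (use bessel[OF assms] in \<open>auto intro!: bdd_aboveI2\<close>)

lemma summable_on_tail:
  fixes g :: "'a \<Rightarrow> real"
  assumes "g summable_on S" "\<And>a. a \<in> S \<Longrightarrow> g a \<ge> 0" "d > 0"
  shows "\<exists>F0. finite F0 \<and> F0 \<subseteq> S \<and> (\<forall>F. finite F \<longrightarrow> F \<subseteq> S - F0 \<longrightarrow> sum g F < d)"
proof -
  obtain F0 where F0: "finite F0" "F0 \<subseteq> S" "dist (sum g F0) (infsum g S) \<le> d/2"
    using infsum_finite_approximation[OF assms(1), of "d/2"] assms(3) by auto
  have "sum g F < d" if F: "finite F" "F \<subseteq> S - F0" for F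
  proof -
    have "sum g (F0 \<union> F) \<le> infsum g S"
      by (rule finite_sum_le_infsum[OF assms(1)]) (use F F0 assms(2) in auto)
    moreover have "sum g (F0 \<union> F) = sum g F0 + sum g F"
      using F F0(1) by (intro sum.union_disjoint) auto
    ultimately show ?thesis using F0(3) assms(3) unfolding dist_real_def by linarith
  qed
  then show ?thesis using F0 by blast
qed

lemma riesz_fischer:
  assumes "orthonormal_family S e" "(\<lambda>a. (cmod (c a))\<^sup>2) summable_on S"
  shows "(\<lambda>a. c a *\<^sub>c e a) summable_on S"
proof (rule summable_on_Cauchy_criterion)
  fix d :: real assume "d > 0"
  then obtain F0 where F0: "finite F0" "F0 \<subseteq> S"
    "\<And>F. finite F \<Longrightarrow> F \<subseteq> S - F0 \<Longrightarrow> (\<Sum>a\<in>F. (cmod (c a))\<^sup>2) < d\<^sup>2"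
    using summable_on_tail[OF assms(2), of "d\<^sup>2"] by auto
  have "norm (\<Sum>a\<in>F. c a *\<^sub>c e a) < d" if F: "finite F" "F \<subseteq> S - F0" for F
  proof -
    have "F \<subseteq> S" using F by blast
    have "(norm (\<Sum>a\<in>F. c a *\<^sub>c e a))\<^sup>2 < d\<^sup>2"
      using F0(3)[OF F] unfolding norm_square_sum_orthonormal[OF assms(1) F(1) \<open>F \<subseteq> S\<close>] .
    then show ?thesis using \<open>d > 0\<close> by (intro power_less_imp_less_base[of _ 2 d]) simp_all
  qed
  then show "\<exists>F0. finite F0 \<and> F0 \<subseteq> S \<and>
      (\<forall>F. finite F \<longrightarrow> F \<subseteq> S - F0 \<longrightarrow> norm (\<Sum>a\<in>F. c a *\<^sub>c e a) < d)" using F0 by blast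
qed

text \<open>For an orthonormal family this is the orthogonal projection onto the closed span.
  Unordered sums admit families of any cardinality, which suits a basis obtained from Zorn's
  lemma.\<close>

definition span_proj :: "'k set \<Rightarrow> ('k \<Rightarrow> 'i ell2) \<Rightarrow> 'i ell2 \<Rightarrow> 'i ell2" where
  "span_proj S e f = (\<Sum>\<^sub>\<infinity>a\<in>S. cinner (e a) f *\<^sub>c e a)"

lemma has_sum_span_proj:
  assumes "orthonormal_family S e"
  shows "((\<lambda>a. cinner (e a) f *\<^sub>c e a) has_sum span_proj S e f) S"
  unfolding span_proj_def
  by (rule has_sum_infsum) (rule riesz_fischer[OF assms bessel_summable[OF assms]])

lemma has_sum_cinner_span_proj:
  assumes "orthonormal_family S e"
  shows "((\<lambda>a. cinner g (e a) * cinner (e a) f) has_sum cinner g (span_proj S e f)) S"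
  using has_sum_bounded_linear[OF bounded_linear_cinner has_sum_span_proj[OF assms]]
  by (simp add: mult.commute)

lemma span_proj_symmetric:
  assumes "orthonormal_family S e"
  shows "cinner g (span_proj S e f) = cinner (span_proj S e g) f"
proof -
  have "((\<lambda>a. cnj (cinner f (e a) * cinner (e a) g)) has_sum cnj (cinner f (span_proj S e g))) S"
    unfolding has_sum_cnj_iff by (rule has_sum_cinner_span_proj[OF assms])
  then have "((\<lambda>a. cinner g (e a) * cinner (e a) f) has_sum cinner (span_proj S e g) f) S"
    by (simp add: cinner_commute[symmetric] mult.commute)
  then show ?thesis using has_sum_cinner_span_proj[OF assms] has_sum_unique by blast
qed

lemma cinner_basis_span_proj:
  assumes "orthonormal_family S e" "A \<subseteq> S" "b \<in> S"
  shows "cinner (e b) (span_proj A e f) = (if b \<in> A then cinner (e b) f else 0)"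
proof -
  have A: "orthonormal_family A e" using assms orthonormal_family_subset by blast
  have "((\<lambda>a. cinner (e b) (e a) * cinner (e a) f) has_sum (if b \<in> A then cinner (e b) f else 0)) A"
    by (rule has_sum_finite_neutralI[where B = "{b} \<inter> A"])
      (use assms in \<open>auto simp: orthonormal_familyD subset_iff\<close>)
  then show ?thesis using has_sum_cinner_span_proj[OF A] has_sum_unique by blast
qed

lemma span_proj_span_proj:
  assumes S: "orthonormal_family S e" and "A \<subseteq> S" "B \<subseteq> S"
  shows "span_proj A e (span_proj B e f) = span_proj (A \<inter> B) e f"
proof -
  have on: "orthonormal_family A e" "orthonormal_family (A \<inter> B) e"
    using assms orthonormal_family_subset by blast+
  have "((\<lambda>a. cinner (e a) (span_proj B e f) *\<^sub>c e a) has_sum span_proj (A \<inter> B) e f) A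
    \<longleftrightarrow> ((\<lambda>a. cinner (e a) f *\<^sub>c e a) has_sum span_proj (A \<inter> B) e f) (A \<inter> B)"
    by (rule has_sum_cong_neutral)
      (use assms in \<open>auto simp: cinner_basis_span_proj[OF S \<open>B \<subseteq> S\<close>] subset_iff\<close>)
  then show ?thesis
    using has_sum_span_proj[OF on(2)] has_sum_span_proj[OF on(1)] has_sum_unique by blast
qed

lemma has_sum_norm_span_proj:
  assumes "orthonormal_family S e"
  shows "((\<lambda>a. (cmod (cinner (e a) f))\<^sup>2) has_sum (norm (span_proj S e f))\<^sup>2) S"
proof -
  have "cinner f (span_proj S e f) = cinner (span_proj S e f) (span_proj S e f)"
    unfolding span_proj_symmetric[OF assms, symmetric]
    using span_proj_span_proj[OF assms order_refl order_refl, of f] by simp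
  then have "((\<lambda>a. cinner f (e a) * cinner (e a) f) has_sum of_real ((norm (span_proj S e f))\<^sup>2)) S"
    using has_sum_cinner_span_proj[OF assms, of f f] by (simp add: cinner_self)
  from has_sum_Re[OF this] show ?thesis
    unfolding cinner_commute[of "e _" f] by (simp add: cmod_def power2_eq_square)
qed

lemma norm_span_proj_le:
  assumes "orthonormal_family S e"
  shows "norm (span_proj S e f) \<le> norm f"
proof -
  have "(norm (span_proj S e f))\<^sup>2 \<le> (norm f)\<^sup>2"
    by (rule has_sum_le_finite_sums[OF has_sum_norm_span_proj[OF assms]]) (rule bessel[OF assms])
  then show ?thesis by (rule power2_le_imp_le) simp
qed

text \<open>Completeness is phrased as a trivial orthogonal complement, the form in which maximality
  of a family delivers it; the expansion of vectors is then \<open>span_proj_basis\<close>.\<close>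

definition orthonormal_basis :: "'k set \<Rightarrow> ('k \<Rightarrow> 'i ell2) \<Rightarrow> bool" where
  "orthonormal_basis S e \<longleftrightarrow>
    orthonormal_family S e \<and> (\<forall>f. (\<forall>a\<in>S. cinner (e a) f = 0) \<longrightarrow> f = 0)"

lemma orthonormal_basis_family: "orthonormal_basis S e \<Longrightarrow> orthonormal_family S e"
  by (simp add: orthonormal_basis_def)

lemma span_proj_basis:
  assumes "orthonormal_basis S e"
  shows "span_proj S e f = f"
proof -
  have S: "orthonormal_family S e" using assms by (simp add: orthonormal_basis_def)
  have "\<forall>a\<in>S. cinner (e a) (f - span_proj S e f) = 0"
    by (simp add: cinner_diff_right cinner_basis_span_proj[OF S order_refl])
  then have "f - span_proj S e f = 0" using assms unfolding orthonormal_basis_def by blast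
  then show ?thesis by simp
qed

lemma orthonormal_basis_delta: "orthonormal_basis UNIV delta"
  unfolding orthonormal_basis_def orthonormal_family_def
  by (auto simp: nth_delta intro: ell2_eqI)

lemma has_sum_delta:
  fixes f :: "'i ell2"
  shows "((\<lambda>x. nth_ell2 f x *\<^sub>c delta x) has_sum f) UNIV"
proof -
  have "orthonormal_family UNIV (delta :: 'i \<Rightarrow> 'i ell2)"
    by (rule orthonormal_basis_family[OF orthonormal_basis_delta])
  from has_sum_span_proj[OF this, of f] show ?thesis
    by (simp add: span_proj_basis[OF orthonormal_basis_delta])
qed

text \<open>Linearity is not part of the definition because the adjoint identity forces it, as the
  lemmas below show.\<close>

definition symmetric_op :: "('i ell2 \<Rightarrow> 'i ell2) \<Rightarrow> bool" where
  "symmetric_op T \<longleftrightarrow> (\<forall>f g. cinner f (T g) = cinner (T f) g) \<and> (\<exists>M. \<forall>f. norm (T f) \<le> M * norm f)"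

lemma symmetric_opD: "symmetric_op T \<Longrightarrow> cinner f (T g) = cinner (T f) g"
  by (simp add: symmetric_op_def)

lemma symmetric_op_add: "symmetric_op T \<Longrightarrow> T (f + g) = T f + T g"
  by (rule cinner_eqI) (simp add: symmetric_opD cinner_add_right)

lemma symmetric_op_scaleC: "symmetric_op T \<Longrightarrow> T (c *\<^sub>c f) = c *\<^sub>c T f"
  by (rule cinner_eqI) (simp add: symmetric_opD)

lemma symmetric_op_scaleR: "symmetric_op T \<Longrightarrow> T (r *\<^sub>R f) = r *\<^sub>R T f"
  unfolding scaleR_scaleC by (rule symmetric_op_scaleC)

lemma symmetric_op_bounded:
  assumes "symmetric_op T"
  obtains M where "M \<ge> 0" "\<And>f. norm (T f) \<le> M * norm f"
proof -
  obtain M where M: "\<And>f. norm (T f) \<le> M * norm f" using assms unfolding symmetric_op_def by blast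
  have "norm (T f) \<le> max M 0 * norm f" for f
    using M[of f] mult_right_mono[of M "max M 0" "norm f"] by auto
  then show thesis using that[of "max M 0"] by simp
qed

lemma bounded_linear_symmetric_op: "symmetric_op T \<Longrightarrow> bounded_linear T"
proof -
  assume T: "symmetric_op T"
  then obtain M where "\<And>f. norm (T f) \<le> M * norm f" using symmetric_op_bounded by blast
  then show ?thesis
    by (intro bounded_linear_intro[where K = M])
      (simp_all add: symmetric_op_add[OF T] symmetric_op_scaleR[OF T] mult.commute)
qed

lemma symmetric_op_diff_arg: "symmetric_op T \<Longrightarrow> T (f - g) = T f - T g"
  by (rule cinner_eqI) (simp add: symmetric_opD cinner_diff_right)

lemma symmetric_op_zero_arg: "symmetric_op T \<Longrightarrow> T 0 = 0"
  using symmetric_op_diff_arg[of T 0 0] by simp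

lemma symmetric_op_id: "symmetric_op (\<lambda>f. f)"
  unfolding symmetric_op_def by (auto intro: exI[of _ 1])

lemma symmetric_op_scaled:
  assumes T: "symmetric_op T"
  shows "symmetric_op (\<lambda>f. r *\<^sub>R T f)"
proof -
  obtain M where M: "\<And>f. norm (T f) \<le> M * norm f" using symmetric_op_bounded[OF T] by blast
  have "norm (r *\<^sub>R T f) \<le> (\<bar>r\<bar> * M) * norm f" for f
    using mult_left_mono[OF M[of f], of "\<bar>r\<bar>"] by (simp only: norm_scaleR mult.assoc abs_ge_zero)
  moreover have "cinner f (r *\<^sub>R T g) = cinner (r *\<^sub>R T f) g" for f g
    by (simp only: symmetric_opD[OF T] cinner_scaleR_left cinner_scaleR_right)
  ultimately show ?thesis unfolding symmetric_op_def by blast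
qed

lemma symmetric_op_plus:
  assumes T: "symmetric_op T" and U: "symmetric_op U"
  shows "symmetric_op (\<lambda>f. T f + U f)"
proof -
  obtain M where M: "\<And>f. norm (T f) \<le> M * norm f" using symmetric_op_bounded[OF T] by blast
  obtain N where N: "\<And>f. norm (U f) \<le> N * norm f" using symmetric_op_bounded[OF U] by blast
  have "norm (T f + U f) \<le> (M + N) * norm f" for f
    using norm_triangle_ineq[of "T f" "U f"] M[of f] N[of f] unfolding distrib_right by linarith
  moreover have "cinner f (T g + U g) = cinner (T f + U f) g" for f g
    by (simp only: cinner_add_left cinner_add_right symmetric_opD[OF T] symmetric_opD[OF U])
  ultimately show ?thesis unfolding symmetric_op_def by blast
qed

lemma symmetric_op_minus:
  assumes "symmetric_op T" "symmetric_op U"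
  shows "symmetric_op (\<lambda>f. T f - U f)"
  using symmetric_op_plus[OF assms(1) symmetric_op_scaled[OF assms(2), of "- 1"]] by simp

lemma symmetric_op_compose_self:
  assumes T: "symmetric_op T"
  shows "symmetric_op (\<lambda>f. T (T f))"
proof -
  obtain M where M: "M \<ge> 0" "\<And>f. norm (T f) \<le> M * norm f" using symmetric_op_bounded[OF T] by blast
  have "norm (T (T f)) \<le> (M * M) * norm f" for f
    using M(2)[of "T f"] mult_left_mono[OF M(2)[of f] M(1)] by (simp add: mult.assoc)
  moreover have "cinner f (T (T g)) = cinner (T (T f)) g" for f g
    by (simp only: symmetric_opD[OF T])
  ultimately show ?thesis unfolding symmetric_op_def by blast
qed

lemma symmetric_op_span_proj: "orthonormal_family S e \<Longrightarrow> symmetric_op (span_proj S e)"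
  unfolding symmetric_op_def
  by (intro conjI allI exI[of _ 1]) (simp_all add: span_proj_symmetric norm_span_proj_le)

lemma has_sum_eigen_expansion:
  assumes "orthonormal_basis S e" "symmetric_op T" "\<And>a. a \<in> S \<Longrightarrow> T (e a) = q a *\<^sub>R e a"
  shows "((\<lambda>a. (of_real (q a) * cinner (e a) f) *\<^sub>c e a) has_sum T f) S"
proof -
  have S: "orthonormal_family S e" using assms(1) by (simp add: orthonormal_basis_def)
  have "((\<lambda>a. T (cinner (e a) f *\<^sub>c e a)) has_sum T f) S"
    using has_sum_bounded_linear[OF bounded_linear_symmetric_op[OF assms(2)] has_sum_span_proj[OF S, of f]]
    unfolding span_proj_basis[OF assms(1)] .
  moreover have "T (cinner (e a) f *\<^sub>c e a) = (of_real (q a) * cinner (e a) f) *\<^sub>c e a" if "a \<in> S" for a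
    using assms(3)[OF that] by (simp add: symmetric_op_scaleC[OF assms(2)] scaleR_scaleC mult.commute)
  ultimately show ?thesis by (simp cong: has_sum_cong)
qed

subsection \<open>Kernels of operators\<close>

lemma summable_on_Sigma_normI:
  fixes f :: "'a \<Rightarrow> 'b \<Rightarrow> 'c :: banach"
  assumes "\<And>x. x \<in> A \<Longrightarrow> (\<lambda>y. norm (f x y)) summable_on B x"
    and "\<And>x. x \<in> A \<Longrightarrow> (\<Sum>\<^sub>\<infinity>y\<in>B x. norm (f x y)) \<le> g x" "g summable_on A"
  shows "(\<lambda>(x, y). f x y) summable_on Sigma A B"
proof -
  have "(\<lambda>x. norm (\<Sum>\<^sub>\<infinity>y\<in>B x. norm (f x y))) summable_on A"
    by (rule Infinite_Sum.abs_summable_on_comparison_test'[OF assms(3)])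
      (use assms(2) in \<open>simp add: abs_of_nonneg infsum_nonneg\<close>)
  then have "(\<lambda>z. norm (case z of (x, y) \<Rightarrow> f x y)) summable_on Sigma A B"
    unfolding Infinite_Sum.abs_summable_on_Sigma_iff using assms(1) by simp
  then show ?thesis by (rule abs_summable_summable)
qed

definition entry :: "('i ell2 \<Rightarrow> 'i ell2) \<Rightarrow> 'i \<Rightarrow> 'i \<Rightarrow> complex" where
  "entry T x y = nth_ell2 (T (delta y)) x"

lemma cinner_delta_right [simp]: "cinner f (delta x) = cnj (nth_ell2 f x)"
  by (subst cinner_commute) simp

lemma entry_hermitian: "symmetric_op T \<Longrightarrow> entry T y x = cnj (entry T x y)"
  using symmetric_opD[of T "delta y" "delta x"] by (simp add: entry_def)

lemma has_sum_entry:
  assumes "symmetric_op T"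
  shows "((\<lambda>y. entry T x y * nth_ell2 f y) has_sum nth_ell2 (T f) x) UNIV"
    and "(\<lambda>y. cmod (entry T x y * nth_ell2 f y)) summable_on UNIV"
proof -
  have e: "cnj (nth_ell2 (T (delta x)) y) = entry T x y" for y
    using entry_hermitian[OF assms, of x y] by (simp add: entry_def)
  have "nth_ell2 (T f) x = cinner (T (delta x)) f"
    using symmetric_opD[OF assms, of "delta x" f] by simp
  then show "((\<lambda>y. entry T x y * nth_ell2 f y) has_sum nth_ell2 (T f) x) UNIV"
    using has_sum_cinner[of "T (delta x)" f] unfolding e by simp
  show "(\<lambda>y. cmod (entry T x y * nth_ell2 f y)) summable_on UNIV"
    using abs_summable_cinner[of "T (delta x)" f] unfolding e .
qed

lemma symmetric_op_eqI:
  assumes "symmetric_op T" "symmetric_op U" "\<And>x y. entry T x y = entry U x y"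
  shows "T = U"
proof (rule ext, rule ell2_eqI)
  fix f x
  show "nth_ell2 (T f) x = nth_ell2 (U f) x"
    using has_sum_entry(1)[OF assms(1), of x f] has_sum_entry(1)[OF assms(2), of x f]
    unfolding assms(3) by (rule has_sum_unique)
qed

text \<open>The Hermitian matrix gives the adjoint identity against the unit vectors; expanding the
  second argument in unit vectors extends it by linearity and continuity.\<close>

lemma symmetric_op_of_entries:
  assumes add: "\<And>f g. T (f + g) = T f + T g" and scale: "\<And>c f. T (c *\<^sub>c f) = c *\<^sub>c T f"
    and bound: "\<And>f. norm (T f) \<le> M * norm f"
    and herm: "\<And>x y. entry T y x = cnj (entry T x y)"
  shows "symmetric_op T"
proof -
  have lin: "bounded_linear T"
    by (rule bounded_linear_intro[where K = M])
      (use bound in \<open>simp_all add: add scale scaleR_scaleC mult.commute\<close>)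
  have expand: "((\<lambda>y. nth_ell2 g y * cinner h (T (delta y))) has_sum cinner h (T g)) UNIV" for h g
    using has_sum_bounded_linear[OF bounded_linear_cinner[of h] has_sum_bounded_linear[OF lin has_sum_delta[of g]]]
    by (simp add: scale)
  have col: "cinner f (T (delta y)) = cnj (nth_ell2 (T f) y)" for f y
  proof -
    have e: "cnj (entry T x y) = entry T y x" for x using herm[of y x] by simp
    have "((\<lambda>x. cnj (cnj (nth_ell2 f x) * nth_ell2 (T (delta y)) x)) has_sum cnj (cinner f (T (delta y)))) UNIV"
      unfolding has_sum_cnj_iff by (rule has_sum_cinner)
    then have "((\<lambda>x. nth_ell2 f x * nth_ell2 (T (delta x)) y) has_sum cnj (cinner f (T (delta y)))) UNIV"
      using e by (simp add: entry_def)
    moreover have "((\<lambda>x. nth_ell2 f x * nth_ell2 (T (delta x)) y) has_sum nth_ell2 (T f) y) UNIV"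
      using expand[where h = "delta y" and g = f] by simp
    ultimately have "cnj (cinner f (T (delta y))) = nth_ell2 (T f) y" by (rule has_sum_unique)
    then show ?thesis by (metis complex_cnj_cnj)
  qed
  have "cinner f (T g) = cinner (T f) g" for f g
  proof -
    have "((\<lambda>y. nth_ell2 g y * cnj (nth_ell2 (T f) y)) has_sum cinner f (T g)) UNIV"
      using expand[of g f] unfolding col .
    moreover have "((\<lambda>y. nth_ell2 g y * cnj (nth_ell2 (T f) y)) has_sum cinner (T f) g) UNIV"
      using has_sum_cinner[of "T f" g] by (simp add: mult.commute)
    ultimately show ?thesis by (rule has_sum_unique)
  qed
  then show ?thesis unfolding symmetric_op_def using bound by blast
qed

text \<open>Cauchy-Schwarz for the families \<open>sqrt (cmod (k y))\<close> and
  \<open>sqrt (cmod (k y)) * cmod (f y)\<close>, realised as the vectors \<open>u\<close> and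
  \<open>w\<close>. It is the row estimate of the Schur test.\<close>

lemma has_sum_square_le:
  fixes k f :: "'i \<Rightarrow> complex"
  assumes k: "(\<lambda>y. cmod (k y)) summable_on UNIV" "(\<Sum>\<^sub>\<infinity>y. cmod (k y)) \<le> M"
    and f: "\<And>y. cmod (f y) \<le> B"
  shows "(\<lambda>y. cmod (k y * f y)) summable_on UNIV"
    and "(\<lambda>y. cmod (k y) * (cmod (f y))\<^sup>2) summable_on UNIV"
    and "(cmod (\<Sum>\<^sub>\<infinity>y. k y * f y))\<^sup>2 \<le> M * (\<Sum>\<^sub>\<infinity>y. cmod (k y) * (cmod (f y))\<^sup>2)"
proof -
  show s1: "(\<lambda>y. cmod (k y * f y)) summable_on UNIV"
    by (rule summable_on_comparison_test[OF summable_on_cmult_left[OF k(1), of B]])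
      (use f in \<open>auto simp: norm_mult intro!: mult_left_mono\<close>)
  have "(cmod (f y))\<^sup>2 \<le> B\<^sup>2" for y by (rule power_mono) (use f in auto)
  then show s2: "(\<lambda>y. cmod (k y) * (cmod (f y))\<^sup>2) summable_on UNIV"
    by (intro summable_on_comparison_test[OF summable_on_cmult_left[OF k(1), of "B\<^sup>2"]])
      (auto intro!: mult_left_mono)
  define u where "u = Abs_ell2 (\<lambda>y. complex_of_real (sqrt (cmod (k y))))"
  define w where "w = Abs_ell2 (\<lambda>y. complex_of_real (sqrt (cmod (k y)) * cmod (f y)))"
  have nu: "nth_ell2 u = (\<lambda>y. complex_of_real (sqrt (cmod (k y))))"
    unfolding u_def by (rule nth_Abs_ell2) (use k(1) in \<open>simp add: square_summable_def\<close>)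
  have nw: "nth_ell2 w = (\<lambda>y. complex_of_real (sqrt (cmod (k y)) * cmod (f y)))"
    unfolding w_def
    by (rule nth_Abs_ell2) (use s2 in \<open>simp add: square_summable_def norm_mult power_mult_distrib\<close>)
  have "cinner u w = (\<Sum>\<^sub>\<infinity>y. complex_of_real (cmod (k y * f y)))"
    unfolding cinner_def nu nw by (simp add: norm_mult flip: of_real_mult mult.assoc)
  also have "\<dots> = complex_of_real (\<Sum>\<^sub>\<infinity>y. cmod (k y * f y))"
    by (rule infsumI) (rule has_sum_of_real, rule has_sum_infsum, rule s1)
  finally have c: "(\<Sum>\<^sub>\<infinity>y. cmod (k y * f y)) = cmod (cinner u w)"
    by (simp add: infsum_nonneg)
  have nru: "(norm u)\<^sup>2 = (\<Sum>\<^sub>\<infinity>y. cmod (k y))"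
    using infsumI[OF has_sum_norm_square[of u]] unfolding nu by simp
  have nrw: "(norm w)\<^sup>2 = (\<Sum>\<^sub>\<infinity>y. cmod (k y) * (cmod (f y))\<^sup>2)"
    using infsumI[OF has_sum_norm_square[of w]] unfolding nw by (simp add: norm_mult power_mult_distrib)
  have "cmod (\<Sum>\<^sub>\<infinity>y. k y * f y) \<le> cmod (cinner u w)"
    unfolding c[symmetric] by (rule norm_infsum_bound)  (rule s1)
  also have "\<dots> \<le> norm u * norm w" by (rule norm_cinner_le)
  finally have "(cmod (\<Sum>\<^sub>\<infinity>y. k y * f y))\<^sup>2 \<le> (norm u * norm w)\<^sup>2" by (rule power_mono) simp
  also have "\<dots> = (\<Sum>\<^sub>\<infinity>y. cmod (k y)) * (\<Sum>\<^sub>\<infinity>y. cmod (k y) * (cmod (f y))\<^sup>2)"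
    by (simp add: power_mult_distrib nru nrw)
  also have "\<dots> \<le> M * (\<Sum>\<^sub>\<infinity>y. cmod (k y) * (cmod (f y))\<^sup>2)"
    by (rule mult_right_mono[OF k(2)]) (auto intro!: infsum_nonneg)
  finally show "(cmod (\<Sum>\<^sub>\<infinity>y. k y * f y))\<^sup>2 \<le> \<dots>" .
qed

text \<open>The Schur test: rows bound \<open>k f x\<close> pointwise, columns bound the sum over
  \<open>x\<close>.\<close>

lemma symmetric_op_of_kernel:
  fixes K :: "'i \<Rightarrow> 'i \<Rightarrow> complex"
  assumes herm: "\<And>x y. K y x = cnj (K x y)"
    and K: "\<And>x. (\<lambda>y. cmod (K x y)) summable_on UNIV" "\<And>x. (\<Sum>\<^sub>\<infinity>y. cmod (K x y)) \<le> M"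
  obtains T where "symmetric_op T" "\<And>x y. entry T x y = K x y" "\<And>f. norm (T f) \<le> M * norm f"
proof -
  \<comment> \<open>Any row would do: its nonnegative sum is at most \<open>M\<close>.\<close>
  have "0 \<le> (\<Sum>\<^sub>\<infinity>y. cmod (K undefined y))" by (rule infsum_nonneg) simp
  then have M: "M \<ge> 0" using K(2) order_trans by blast
  note sq = has_sum_square_le[OF K norm_nth_ell2_le]
  define k where "k f x = (\<Sum>\<^sub>\<infinity>y. K x y * nth_ell2 f y)" for f x
  define T where "T f = Abs_ell2 (k f)" for f
  have bound: "(\<Sum>x\<in>F. (cmod (k f x))\<^sup>2) \<le> (M * norm f)\<^sup>2" if F: "finite F" for F f
  proof -
    let ?n = "\<lambda>y. (cmod (nth_ell2 f y))\<^sup>2"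
    \<comment> \<open>Hermitian symmetry turns the bound on row sums into the same bound on column
      sums.\<close>
    have col: "(\<Sum>x\<in>F. cmod (K x y)) \<le> M" for y
    proof -
      have "cmod (K x y) = cmod (K y x)" for x using herm[of x y] by simp
      then have "(\<Sum>x\<in>F. cmod (K x y)) = (\<Sum>x\<in>F. cmod (K y x))" by simp
      also have "\<dots> \<le> (\<Sum>\<^sub>\<infinity>x. cmod (K y x))"
        by (rule finite_sum_le_infsum[OF K(1) F]) auto
      also have "\<dots> \<le> M" by (rule K(2))
      finally show ?thesis .
    qed
    have "(\<Sum>x\<in>F. \<Sum>\<^sub>\<infinity>y. cmod (K x y) * ?n y) = (\<Sum>\<^sub>\<infinity>y. \<Sum>x\<in>F. cmod (K x y) * ?n y)"
    proof -
      have "((\<lambda>y. \<Sum>x\<in>F. cmod (K x y) * ?n y) has_sum (\<Sum>x\<in>F. \<Sum>\<^sub>\<infinity>y. cmod (K x y) * ?n y)) UNIV"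
        using F by (induction rule: finite_induct) (auto intro!: has_sum_add has_sum_infsum sq(2))
      then show ?thesis by (rule infsumI[symmetric])
    qed
    also have "\<dots> \<le> (\<Sum>\<^sub>\<infinity>y. M * ?n y)"
    proof (rule infsum_mono)
      show s: "(\<lambda>y. M * ?n y) summable_on UNIV"
        using square_summable_nth[of f] unfolding square_summable_def by (rule summable_on_cmult_right)
      show le: "(\<Sum>x\<in>F. cmod (K x y) * ?n y) \<le> M * ?n y" for y
        using mult_right_mono[OF col, of "?n y" y] by (simp add: sum_distrib_right)
      show "(\<lambda>y. \<Sum>x\<in>F. cmod (K x y) * ?n y) summable_on UNIV"
        by (rule summable_on_comparison_test[OF s le]) (auto intro!: sum_nonneg)
    qed
    also have "(\<Sum>\<^sub>\<infinity>y. M * ?n y) = M * (norm f)\<^sup>2"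
      using has_sum_cmult_right[OF has_sum_norm_square[of f], of M] by (rule infsumI)
    finally have le: "(\<Sum>x\<in>F. \<Sum>\<^sub>\<infinity>y. cmod (K x y) * ?n y) \<le> M * (norm f)\<^sup>2" .
    have "(\<Sum>x\<in>F. (cmod (k f x))\<^sup>2) \<le> (\<Sum>x\<in>F. M * (\<Sum>\<^sub>\<infinity>y. cmod (K x y) * ?n y))"
      unfolding k_def by (intro sum_mono sq(3))
    also have "\<dots> = M * (\<Sum>x\<in>F. \<Sum>\<^sub>\<infinity>y. cmod (K x y) * ?n y)" by (simp add: sum_distrib_left)
    also have "\<dots> \<le> M * (M * (norm f)\<^sup>2)" by (rule mult_left_mono[OF le M])
    finally show ?thesis by (simp add: power2_eq_square mult_ac)
  qed
  have nT: "nth_ell2 (T f) x = k f x" for f x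
    unfolding T_def by (subst nth_Abs_ell2[OF square_summable_bound(1)[OF bound]]) simp_all
  have norm_T: "norm (T f) \<le> M * norm f" for f
  proof -
    have "(norm (T f))\<^sup>2 \<le> (M * norm f)\<^sup>2"
      by (rule has_sum_le_finite_sums[OF has_sum_norm_square]) (simp add: nT bound)
    then show ?thesis by (rule power2_le_imp_le) (use M in simp)
  qed
  have ks: "((\<lambda>y. K x y * nth_ell2 f y) has_sum k f x) UNIV" for f x
    unfolding k_def by (rule has_sum_infsum) (rule abs_summable_summable[OF sq(1)])
  have entry: "entry T x y = K x y" for x y
  proof -
    have "((\<lambda>z. K x z * nth_ell2 (delta y) z) has_sum K x y) UNIV"
      by (rule has_sum_finite_neutralI[where B = "{y}"]) (auto simp: nth_delta)
    then have "k (delta y) x = K x y" using ks has_sum_unique by blast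
    then show ?thesis by (simp add: entry_def nT)
  qed
  have "symmetric_op T"
  proof (rule symmetric_op_of_entries[OF _ _ norm_T])
    show "T (f + g) = T f + T g" for f g
    proof (rule ell2_eqI)
      fix x
      have "((\<lambda>y. K x y * nth_ell2 (f + g) y) has_sum k f x + k g x) UNIV"
        using has_sum_add[OF ks[of x f] ks[of x g]] by (simp add: distrib_left)
      then show "nth_ell2 (T (f + g)) x = nth_ell2 (T f + T g) x"
        using ks[of x "f + g"] has_sum_unique by (fastforce simp: nT)
    qed
    show "T (c *\<^sub>c f) = c *\<^sub>c T f" for c f
    proof (rule ell2_eqI)
      fix x
      have "((\<lambda>y. K x y * nth_ell2 (c *\<^sub>c f) y) has_sum c * k f x) UNIV"
        using has_sum_cmult_right[OF ks[of x f], of c] by (simp add: mult.left_commute)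
      then show "nth_ell2 (T (c *\<^sub>c f)) x = nth_ell2 (c *\<^sub>c T f) x"
        using ks[of x "c *\<^sub>c f"] has_sum_unique by (fastforce simp: nT)
    qed
    show "entry T y x = cnj (entry T x y)" for x y unfolding entry by (rule herm)
  qed
  then show thesis using that entry norm_T by blast
qed

text \<open>Stronger than trace class and dependent on the basis. It suits the lattice, where the
  kernel of \<open>V\<close> decays in both arguments; it makes the quadratic form weakly continuous
  on the unit ball and allows double sums to be interchanged.\<close>

definition summable_kernel :: "('i \<Rightarrow> 'i \<Rightarrow> complex) \<Rightarrow> bool" where
  "summable_kernel K \<longleftrightarrow> (\<lambda>(x, y). cmod (K x y)) summable_on UNIV"

lemma has_sum_cinner_kernel:
  assumes A: "symmetric_op A" and K: "summable_kernel (entry A)"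
  shows "((\<lambda>(x, y). entry A x y * (cnj (nth_ell2 f x) * nth_ell2 f y)) has_sum cinner f (A f)) UNIV"
proof -
  let ?g = "\<lambda>(x, y). entry A x y * (cnj (nth_ell2 f x) * nth_ell2 f y)"
  have "(?g has_sum cinner f (A f)) (UNIV \<times> UNIV)"
  proof (rule has_sum_SigmaI)
    show "((\<lambda>y. ?g (x, y)) has_sum cnj (nth_ell2 f x) * nth_ell2 (A f) x) UNIV" for x
      using has_sum_cmult_right[OF has_sum_entry(1)[OF A, of x f], of "cnj (nth_ell2 f x)"]
      by (simp add: mult_ac)
    show "((\<lambda>x. cnj (nth_ell2 f x) * nth_ell2 (A f) x) has_sum cinner f (A f)) UNIV"
      by (rule has_sum_cinner)
    have "(\<lambda>z. cmod (?g z)) summable_on UNIV"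
    proof (rule summable_on_comparison_test)
      show "(\<lambda>z. (norm f)\<^sup>2 * (case z of (x, y) \<Rightarrow> cmod (entry A x y))) summable_on UNIV"
        using K unfolding summable_kernel_def by (rule summable_on_cmult_right)
      show "cmod (?g z) \<le> (norm f)\<^sup>2 * (case z of (x, y) \<Rightarrow> cmod (entry A x y))" for z
      proof -
        have "cmod (nth_ell2 f (fst z)) * cmod (nth_ell2 f (snd z)) \<le> norm f * norm f"
          by (intro mult_mono norm_nth_ell2_le) auto
        from mult_left_mono[OF this, of "cmod (entry A (fst z) (snd z))"] show ?thesis
          by (simp add: case_prod_beta norm_mult power2_eq_square mult_ac)
      qed
    qed simp
    then show "?g summable_on UNIV \<times> UNIV" using abs_summable_summable by auto
  qed
  then show ?thesis by simp
qed

subsection \<open>Eigenbases\<close>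

text \<open>The unit ball is placed in the space of all functions, whose product topology is
  pointwise convergence; on the ball this is the weak topology, and compactness comes from
  Tychonoff's theorem. Bounding finite sums only makes closedness evident.\<close>

definition l2_ball :: "('i \<Rightarrow> complex) set" where
  "l2_ball = {g. \<forall>F. finite F \<longrightarrow> (\<Sum>x\<in>F. (cmod (g x))\<^sup>2) \<le> 1}"

lemma continuous_on_coordinate: "continuous_on S (\<lambda>g :: 'a \<Rightarrow> 'b :: topological_space. g x)"
  by (rule continuous_on_subset[OF continuous_on_product_coordinates]) simp

lemma closed_l2_ball: "closed (l2_ball :: ('i \<Rightarrow> complex) set)"
proof -
  have "closed {g :: 'i \<Rightarrow> complex. (\<Sum>x\<in>F. (cmod (g x))\<^sup>2) \<le> 1}" for F
    by (intro closed_Collect_le continuous_intros continuous_on_coordinate)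
  then have "closed (\<Inter>F\<in>{F. finite F}. {g :: 'i \<Rightarrow> complex. (\<Sum>x\<in>F. (cmod (g x))\<^sup>2) \<le> 1})"
    by blast
  moreover have "(\<Inter>F\<in>{F. finite F}. {g :: 'i \<Rightarrow> complex. (\<Sum>x\<in>F. (cmod (g x))\<^sup>2) \<le> 1}) = l2_ball"
    by (auto simp: l2_ball_def)
  ultimately show ?thesis by simp
qed

text \<open>A closed subset of a product of closed unit discs.\<close>

lemma compact_l2_ball: "compact (l2_ball :: ('i \<Rightarrow> complex) set)"
proof -
  have "compactin (product_topology (\<lambda>i. euclidean) UNIV) (\<Pi>\<^sub>E i\<in>(UNIV :: 'i set). cball (0 :: complex) 1)"
    unfolding compactin_PiE by simp
  then have comp: "compact (\<Pi>\<^sub>E i\<in>(UNIV :: 'i set). cball (0 :: complex) 1)"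
    unfolding euclidean_product_topology by simp
  have "l2_ball \<subseteq> (\<Pi>\<^sub>E i\<in>(UNIV :: 'i set). cball (0 :: complex) 1)"
  proof
    fix g :: "'i \<Rightarrow> complex" assume "g \<in> l2_ball"
    then have "(cmod (g x))\<^sup>2 \<le> 1" for x
      unfolding l2_ball_def by (auto dest: spec[of _ "{x}"])
    then show "g \<in> (\<Pi>\<^sub>E i\<in>UNIV. cball 0 1)" by (simp add: abs_square_le_1 PiE_UNIV_domain Pi_def)
  qed
  then show ?thesis
    using compact_Int_closed[OF comp closed_l2_ball] by (simp only: inf.absorb2)
qed

lemma l2_ball_nth: "norm f \<le> 1 \<Longrightarrow> nth_ell2 f \<in> l2_ball"
proof -
  assume "norm f \<le> 1"
  then have "(norm f)\<^sup>2 \<le> 1" by (simp add: abs_square_le_1)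
  then show "nth_ell2 f \<in> l2_ball"
    unfolding l2_ball_def using sum_nth_squares_le[of _ f] order_trans by blast
qed

lemma l2_ball_Abs:
  assumes "g \<in> l2_ball"
  shows "nth_ell2 (Abs_ell2 g) = g" "norm (Abs_ell2 g) \<le> 1"
proof -
  have b: "\<And>F. finite F \<Longrightarrow> (\<Sum>x\<in>F. (cmod (g x))\<^sup>2) \<le> 1" using assms by (simp add: l2_ball_def)
  show n: "nth_ell2 (Abs_ell2 g) = g" by (rule nth_Abs_ell2[OF square_summable_bound(1)[OF b]])
  have "(norm (Abs_ell2 g))\<^sup>2 \<le> 1"
    by (rule has_sum_le_finite_sums[OF has_sum_norm_square]) (simp add: n b)
  then show "norm (Abs_ell2 g) \<le> 1" by (simp add: abs_square_le_1)
qed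

text \<open>Finite truncations of \<open>h\<close> give functions of finitely many coordinates. They
  converge to \<open>h\<close> in norm, and on the ball Cauchy-Schwarz turns that into uniform
  convergence.\<close>

lemma continuous_on_cinner_l2_ball:
  fixes h :: "'i ell2"
  shows "continuous_on l2_ball (\<lambda>g. cinner h (Abs_ell2 g))"
proof (rule uniform_limit_theorem)
  let ?h = "\<lambda>F. \<Sum>x\<in>F. nth_ell2 h x *\<^sub>c delta x"
  let ?f = "\<lambda>F (g :: 'i \<Rightarrow> complex). \<Sum>x\<in>F. cnj (nth_ell2 h x) * g x"
  show "\<forall>\<^sub>F F in finite_subsets_at_top UNIV. continuous_on l2_ball (?f F)"
    by (intro always_eventually allI continuous_intros continuous_on_coordinate)
  show "uniform_limit l2_ball ?f (\<lambda>g. cinner h (Abs_ell2 g)) (finite_subsets_at_top UNIV)"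
  proof (rule uniform_limitI)
    fix e :: real assume "e > 0"
    have "(?h \<longlongrightarrow> h) (finite_subsets_at_top UNIV)" using has_sum_delta unfolding has_sum_def .
    then have "\<forall>\<^sub>F F in finite_subsets_at_top UNIV. dist (?h F) h < e"
      using \<open>e > 0\<close> by (rule tendstoD)
    then show "\<forall>\<^sub>F F in finite_subsets_at_top UNIV. \<forall>g\<in>l2_ball. dist (?f F g) (cinner h (Abs_ell2 g)) < e"
    proof (rule eventually_mono, intro ballI)
      fix F and g :: "'i \<Rightarrow> complex" assume F: "dist (?h F) h < e" and g: "g \<in> l2_ball"
      have "?f F g = cinner (?h F) (Abs_ell2 g)"
        unfolding cinner_sum_left by (simp add: l2_ball_Abs(1)[OF g])
      then have "dist (?f F g) (cinner h (Abs_ell2 g)) = cmod (cinner (?h F - h) (Abs_ell2 g))"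
        by (simp add: dist_norm cinner_diff_left)
      also have "\<dots> \<le> norm (?h F - h) * norm (Abs_ell2 g)" by (rule norm_cinner_le)
      also have "\<dots> \<le> norm (?h F - h) * 1" by (intro mult_left_mono l2_ball_Abs(2)[OF g]) simp
      also have "\<dots> < e" using F by (simp add: dist_norm)
      finally show "dist (?f F g) (cinner h (Abs_ell2 g)) < e" .
    qed
  qed
qed simp

text \<open>Coordinates on the ball have modulus at most 1, so the summable kernel is a Weierstrass
  majorant for the double sum. This replaces compactness of the operator.\<close>

lemma continuous_on_quadratic_form_l2_ball:
  fixes A :: "'a ell2 \<Rightarrow> 'a ell2"
  assumes "symmetric_op A" "summable_kernel (entry A)"
  shows "continuous_on l2_ball (\<lambda>g. inner (Abs_ell2 g) (A (Abs_ell2 g)))"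
proof -
  let ?t = "\<lambda>z (g :: 'a \<Rightarrow> complex). entry A (fst z) (snd z) * (cnj (g (fst z)) * g (snd z))"
  have "continuous_on l2_ball (\<lambda>g. \<Sum>\<^sub>\<infinity>z. ?t z g)"
  proof (rule uniform_limit_theorem)
    show "\<forall>\<^sub>F F in finite_subsets_at_top UNIV. continuous_on l2_ball (\<lambda>g. \<Sum>z\<in>F. ?t z g)"
      by (intro always_eventually allI continuous_intros continuous_on_coordinate)
    show "uniform_limit l2_ball (\<lambda>F g. \<Sum>z\<in>F. ?t z g) (\<lambda>g. \<Sum>\<^sub>\<infinity>z. ?t z g) (finite_subsets_at_top UNIV)"
    proof (rule Weierstrass_m_test_general)
      show "(\<lambda>z. case z of (x, y) \<Rightarrow> cmod (entry A x y)) summable_on UNIV"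
        using assms(2) unfolding summable_kernel_def .
      fix z :: "'a \<times> 'a" and g :: "'a \<Rightarrow> complex" assume "g \<in> l2_ball"
      note g = l2_ball_Abs[OF this]
      have "cmod (g x) \<le> 1" for x using norm_nth_ell2_le[of "Abs_ell2 g" x] g by auto
      then have "cmod (g (fst z)) * cmod (g (snd z)) \<le> 1" by (intro mult_le_one) auto
      from mult_left_mono[OF this, of "cmod (entry A (fst z) (snd z))"]
      show "norm (?t z g) \<le> (case z of (x, y) \<Rightarrow> cmod (entry A x y))"
        by (simp add: norm_mult case_prod_beta)
    qed
  qed simp
  then have "continuous_on l2_ball (\<lambda>g. Re (\<Sum>\<^sub>\<infinity>z. ?t z g))" by (intro continuous_intros)
  moreover have "Re (\<Sum>\<^sub>\<infinity>z. ?t z g) = inner (Abs_ell2 g) (A (Abs_ell2 g))" if "g \<in> l2_ball" for g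
  proof -
    have "((\<lambda>z. ?t z g) has_sum cinner (Abs_ell2 g) (A (Abs_ell2 g))) UNIV"
      using has_sum_cinner_kernel[OF assms, of "Abs_ell2 g"]
      unfolding l2_ball_Abs(1)[OF that] by (simp add: case_prod_unfold)
    from infsumI[OF this] show ?thesis by (simp add: Re_cinner)
  qed
  ultimately show ?thesis by (simp cong: continuous_on_cong)
qed

section \<open>Eigenvectors by maximising a quadratic form on an orthogonal complement\<close>

definition ortho :: "'i ell2 set \<Rightarrow> 'i ell2 set" where
  "ortho H = {f. \<forall>h\<in>H. cinner h f = 0}"

lemma ortho_closed:
  "f \<in> ortho H \<Longrightarrow> g \<in> ortho H \<Longrightarrow> f + g \<in> ortho H"
  "f \<in> ortho H \<Longrightarrow> g \<in> ortho H \<Longrightarrow> f - g \<in> ortho H"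
  "f \<in> ortho H \<Longrightarrow> r *\<^sub>R f \<in> ortho H"
  "f \<in> ortho H \<Longrightarrow> c *\<^sub>c f \<in> ortho H"
  by (simp_all add: ortho_def cinner_add_right cinner_diff_right)

lemma quadratic_form_attains_sup:
  fixes A :: "'a ell2 \<Rightarrow> 'a ell2"
  assumes "symmetric_op A" "summable_kernel (entry A)"
  shows "\<exists>f\<in>ortho H. norm f \<le> 1 \<and>
    (\<forall>g\<in>ortho H. norm g \<le> 1 \<longrightarrow> inner g (A g) \<le> inner f (A f))"
proof -
  let ?K = "l2_ball \<inter> (\<Inter>h\<in>H. {g \<in> l2_ball. cinner h (Abs_ell2 g) = 0})"
  have "closed (\<Inter>h\<in>H. {g \<in> l2_ball. cinner h (Abs_ell2 g) = 0})"
    by (intro closed_INT ballI continuous_closed_preimage_constant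
      continuous_on_cinner_l2_ball closed_l2_ball)
  then have compact: "compact ?K" by (rule compact_Int_closed[OF compact_l2_ball])
  have nth_mem: "nth_ell2 f \<in> ?K" if "f \<in> ortho H" "norm f \<le> 1" for f
    using that(1) l2_ball_nth[OF that(2)] by (simp add: ortho_def nth_ell2_inverse)
  have "0 \<in> ortho H" by (simp add: ortho_def)
  then have "nth_ell2 0 \<in> ?K" by (intro nth_mem) simp_all
  then have ne: "?K \<noteq> {}" by (metis empty_iff)
  have "continuous_on ?K (\<lambda>g. inner (Abs_ell2 g) (A (Abs_ell2 g)))"
    by (rule continuous_on_subset[OF continuous_on_quadratic_form_l2_ball[OF assms]]) (rule Int_lower1)
  from continuous_attains_sup[OF compact ne this] obtain g where g: "g \<in> ?K"
    "\<forall>k\<in>?K. inner (Abs_ell2 k) (A (Abs_ell2 k)) \<le> inner (Abs_ell2 g) (A (Abs_ell2 g))"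
    by (elim bexE) (rule that)
  show ?thesis
  proof (intro bexI[of _ "Abs_ell2 g"] conjI ballI impI)
    show "Abs_ell2 g \<in> ortho H" using g(1) by (simp add: ortho_def)
    show "norm (Abs_ell2 g) \<le> 1" by (rule l2_ball_Abs(2)[OF IntD1[OF g(1)]])
    fix k assume "k \<in> ortho H" "norm k \<le> 1"
    from bspec[OF g(2) nth_mem[OF this]] show "inner k (A k) \<le> inner (Abs_ell2 g) (A (Abs_ell2 g))"
      by (simp add: nth_ell2_inverse)
  qed
qed

lemma symmetric_op_inner: "symmetric_op A \<Longrightarrow> inner f (A g) = inner (A f) g"
  unfolding Re_cinner[symmetric] by (simp add: symmetric_opD)

text \<open>
  At a maximiser \<open>f\<close> of the quadratic form, with maximum \<open>l\<close>, the nonnegative form \<open>l |g|\<^sup>2 - \<langle>g, A g\<rangle>\<close>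
  vanishes, so that \<open>f\<close> is in its kernel.
\<close>

lemma exists_positive_eigenvector:
  assumes A: "symmetric_op A" "summable_kernel (entry A)"
    and inv: "\<And>f. f \<in> ortho H \<Longrightarrow> A f \<in> ortho H"
    and f0: "f0 \<in> ortho H" "inner f0 (A f0) > 0"
  shows "\<exists>f\<in>ortho H. f \<noteq> 0 \<and> (\<exists>\<mu>>0. A f = \<mu> *\<^sub>R f)"
proof -
  obtain f where f: "f \<in> ortho H" "norm f \<le> 1"
    "\<And>g. g \<in> ortho H \<Longrightarrow> norm g \<le> 1 \<Longrightarrow> inner g (A g) \<le> inner f (A f)"
    using quadratic_form_attains_sup[OF A] by blast
  define l where "l = inner f (A f)"
  have scaled: "inner g (A g) \<le> l * inner g g" if "g \<in> ortho H" for g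
  proof (cases "g = 0")
    case False
    define k where "k = (1 / norm g) *\<^sub>R g"
    have "inner k (A k) \<le> l"
      unfolding l_def using that False by (intro f(3)) (auto simp: k_def ortho_closed)
    moreover have "inner k (A k) = inner g (A g) / inner g g"
      by (simp add: k_def symmetric_op_scaleR[OF A(1)] power2_norm_eq_inner[symmetric] power2_eq_square)
    moreover have "inner g g > 0" using False by simp
    ultimately show ?thesis by (simp add: divide_simps)
  qed simp
  have "f0 \<noteq> 0" using f0(2) by auto
  then have "l > 0"
  proof -
    have "0 < l * inner f0 f0" using scaled[OF f0(1)] f0(2) by linarith
    moreover have "inner f0 f0 > 0" using \<open>f0 \<noteq> 0\<close> by simp
    ultimately show ?thesis by (simp add: zero_less_mult_iff)
  qed
  define h where "h = l *\<^sub>R f - A f"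
  have h: "h \<in> ortho H" unfolding h_def by (intro ortho_closed inv f(1))
  define B where "B = (\<lambda>g. l * inner g g - inner g (A g))"
  have "inner f f \<le> 1" using f(2) by (simp add: power2_norm_eq_inner[symmetric] abs_square_le_1)
  then have Bf: "B f \<le> 0" using \<open>l > 0\<close> by (simp add: B_def l_def[symmetric])
  have Bh: "B h \<ge> 0" unfolding B_def using scaled[OF h] by simp
  \<comment> \<open>\<open>h\<close> is half the gradient of \<open>B\<close> at \<open>f\<close>.
    As \<open>B f \<le> 0\<close> while \<open>B\<close> is nonnegative on \<open>ortho H\<close>,
    the linear term in \<open>t\<close> has to vanish, and that term is a multiple of the squared
    norm of \<open>h\<close>.\<close>
  have expand: "B (f + t *\<^sub>R h) = B f + 2 * t * inner h h + t\<^sup>2 * B h" for t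
  proof -
    have "inner f (A h) = inner h (A f)"
      using symmetric_op_inner[OF A(1), of f h] inner_commute[of "A f" h] by simp
    moreover have "inner h h = l * inner f h - inner h (A f)"
      using inner_commute[of h f] by (subst h_def) (simp add: inner_diff_left inner_commute[of "A f" h])
    moreover have "B (f + t *\<^sub>R h) = l * (inner f f + 2 * t * inner f h + t\<^sup>2 * inner h h)
        - (inner f (A f) + t * inner f (A h) + t * inner h (A f) + t\<^sup>2 * inner h (A h))"
      unfolding B_def using inner_commute[of h f]
      by (simp add: symmetric_op_add[OF A(1)] symmetric_op_scaleR[OF A(1)] inner_add_left inner_add_right
          power2_eq_square distrib_left)
    moreover have "l * (ff + 2 * t * fh + t\<^sup>2 * hh) - (fAf + t * x + t * y + t\<^sup>2 * hAh)
        = l * ff - fAf + 2 * t * hh + t\<^sup>2 * (l * hh - hAh)"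
      if "x = y" "hh = l * fh - y" for ff fh hh fAf x y hAh :: real
      unfolding that by (simp add: algebra_simps)
    ultimately show ?thesis by (simp only: B_def)
  qed
  \<comment> \<open>The minimiser of \<open>2 * t * inner h h + t^2 * (B h + 1)\<close>; the added 1
    keeps the denominator positive when \<open>B h = 0\<close>.\<close>
  define t where "t = - inner h h / (B h + 1)"
  have "0 \<le> B (f + t *\<^sub>R h)"
    unfolding B_def using scaled[of "f + t *\<^sub>R h"] h f(1) by (simp add: ortho_closed)
  then have "0 \<le> 2 * t * inner h h + t\<^sup>2 * B h" using expand Bf by simp
  moreover have "t\<^sup>2 * B h \<le> (inner h h)\<^sup>2 / (B h + 1)"
  proof -
    have "t\<^sup>2 * B h = (inner h h)\<^sup>2 / (B h + 1) * (B h / (B h + 1))"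
      by (simp add: t_def power2_eq_square)
    also have "\<dots> \<le> (inner h h)\<^sup>2 / (B h + 1) * 1"
      using Bh by (intro mult_left_mono) simp_all
    finally show ?thesis by simp
  qed
  moreover have "2 * t * inner h h = - 2 * ((inner h h)\<^sup>2 / (B h + 1))"
    by (simp add: t_def power2_eq_square)
  ultimately have "(inner h h)\<^sup>2 / (B h + 1) \<le> 0" by linarith
  then have "inner h h = 0" using Bh by (simp add: divide_le_0_iff)
  then have "A f = l *\<^sub>R f" by (simp add: h_def)
  moreover have "f \<noteq> 0" using \<open>l > 0\<close> by (auto simp: l_def)
  ultimately show ?thesis using f(1) \<open>l > 0\<close> by blast
qed

lemma summable_kernel_uminus: "summable_kernel (entry A) \<Longrightarrow> summable_kernel (entry (\<lambda>f. (- 1) *\<^sub>R A f))"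
  by (simp add: summable_kernel_def entry_def)

text \<open>The operator with the summable kernel is \<open>V = Q^2 - Q\<close>, not
  \<open>Q\<close>. If its form is not identically zero on the subspace, \<open>V\<close> or
  \<open>-V\<close> has an eigenvector \<open>f\<close> there; then
  \<open>Q^2 f = Q f + l f\<close>, so \<open>Q\<close> preserves the span of \<open>f\<close> and
  \<open>Q f\<close> and an eigenvector lies in it. If the form vanishes, \<open>V\<close> is zero
  on the subspace, \<open>Q\<close> is idempotent there, and \<open>g\<close> or \<open>Q g\<close>
  is an eigenvector.\<close>

lemma exists_eigenvector_ortho:
  assumes Q: "symmetric_op Q" and V: "summable_kernel (entry (\<lambda>f. Q (Q f) - Q f))"
    and inv: "\<And>f. f \<in> ortho H \<Longrightarrow> Q f \<in> ortho H" and nz: "g \<in> ortho H" "g \<noteq> 0"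
  shows "\<exists>f\<in>ortho H. f \<noteq> 0 \<and> (\<exists>\<mu>. Q f = \<mu> *\<^sub>R f)"
proof -
  define V where "V f = Q (Q f) - Q f" for f
  have VV: "symmetric_op V" unfolding V_def by (intro symmetric_op_minus symmetric_op_compose_self Q)
  have kV: "summable_kernel (entry V)" using V unfolding V_def[abs_def] .
  have invV: "V f \<in> ortho H" if "f \<in> ortho H" for f
    unfolding V_def by (intro ortho_closed inv that)
  show ?thesis
  proof (cases "\<exists>f\<in>ortho H. inner f (V f) \<noteq> 0")
    case True
    then obtain f0 where f0: "f0 \<in> ortho H" "inner f0 (V f0) \<noteq> 0" by blast
    obtain f l where f: "f \<in> ortho H" "f \<noteq> 0" "V f = l *\<^sub>R f"
    proof (cases "inner f0 (V f0) > 0")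
      case True
      then show ?thesis using exists_positive_eigenvector[OF VV kV invV f0(1)] that by blast
    next
      case False
      have "\<exists>f\<in>ortho H. f \<noteq> 0 \<and> (\<exists>\<mu>>0. (- 1) *\<^sub>R V f = \<mu> *\<^sub>R f)"
        by (rule exists_positive_eigenvector[OF symmetric_op_scaled[OF VV] summable_kernel_uminus[OF kV] _ f0(1)])
          (use False f0(2) invV ortho_closed(3)[of _ H "- 1"] in auto)
      then obtain f \<mu> where "f \<in> ortho H" "f \<noteq> 0" "(- 1) *\<^sub>R V f = \<mu> *\<^sub>R f" by blast
      moreover have "V f = (- \<mu>) *\<^sub>R f" using calculation(3)
        by (simp add: eq_neg_iff_add_eq_0 neg_eq_iff_add_eq_0 add.commute)
      ultimately show ?thesis by (intro that[of f "- \<mu>"])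
    qed
    have QQ: "Q (Q f) = l *\<^sub>R f + Q f" using f(3) by (simp add: V_def algebra_simps)
    \<comment> \<open>On \<open>f\<close> the operator \<open>(Q - 1/2)^2\<close> equals
      \<open>V + 1/4\<close>, that is \<open>l + 1/4\<close>, which is thus nonnegative and has a
      real root \<open>s\<close>.\<close>
    have "0 \<le> inner (Q f - (1/2) *\<^sub>R f) (Q f - (1/2) *\<^sub>R f)" by simp
    also have "\<dots> = inner f (Q (Q f)) - inner f (Q f) + inner f f / 4"
      using symmetric_op_inner[OF Q, of f "Q f"] inner_commute[of "Q f" f]
      by (simp add: inner_diff_left inner_diff_right field_simps)
    also have "\<dots> = (l + 1/4) * inner f f" by (simp add: QQ inner_add_right algebra_simps)
    finally have nonneg: "0 \<le> (l + 1/4) * inner f f" .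
    have "l + 1/4 \<ge> 0"
    proof (rule ccontr)
      assume "\<not> 0 \<le> l + 1/4"
      then have "(l + 1/4) * inner f f < 0" using f(2) by (intro mult_neg_pos) auto
      then show False using nonneg by linarith
    qed
    define s where "s = sqrt (l + 1/4)"
    have s: "s * s = l + 1/4" using \<open>l + 1/4 \<ge> 0\<close> by (simp add: s_def)
    \<comment> \<open>From \<open>(Q - 1/2 - s) (Q - 1/2 + s) f = 0\<close>: either \<open>e\<close>
      is zero and \<open>f\<close> itself is an eigenvector, or \<open>e\<close> is an eigenvector
      with eigenvalue \<open>1/2 + s\<close>.\<close>
    define e where "e = Q f - (1/2 - s) *\<^sub>R f"
    show ?thesis
    proof (cases "e = 0")
      case True
      then show ?thesis using f by (auto simp: e_def)
    next
      case False
      have "Q e = l *\<^sub>R f + Q f - (1/2 - s) *\<^sub>R Q f"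
        by (simp add: e_def symmetric_op_diff_arg[OF Q] symmetric_op_scaleR[OF Q] QQ)
      also have "\<dots> = (1/2 + s) *\<^sub>R Q f - (1/4 - s * s) *\<^sub>R f"
      proof -
        have "Q f - (1/2 - s) *\<^sub>R Q f = (1 - (1/2 - s)) *\<^sub>R Q f"
          by (simp only: scaleR_diff_left scaleR_one)
        moreover have "1 - (1/2 - s) = 1/2 + s" by simp
        moreover have "l *\<^sub>R f = - ((1/4 - s * s) *\<^sub>R f)" unfolding s by simp
        ultimately show ?thesis by (simp only: add_diff_eq[symmetric]) simp
      qed
      also have "\<dots> = (1/2 + s) *\<^sub>R e"
        by (simp add: e_def algebra_simps)
      finally have "Q e = (1/2 + s) *\<^sub>R e" .
      moreover have "e \<in> ortho H" unfolding e_def by (intro ortho_closed inv f(1))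
      ultimately show ?thesis using False by blast
    qed
  next
    case False
    have V0: "V f = 0" if "f \<in> ortho H" for f
    proof -
      \<comment> \<open>Polarisation: a symmetric form that vanishes on the diagonal of an invariant
        subspace vanishes there, tested on \<open>f\<close> and \<open>V f\<close>.\<close>
      have "inner (f + V f) (V (f + V f)) = 0" "inner f (V f) = 0" "inner (V f) (V (V f)) = 0"
        using False that invV ortho_closed(1) by blast+
      then have "inner f (V (V f)) + inner (V f) (V f) = 0"
        by (simp add: symmetric_op_add[OF VV] inner_add_left inner_add_right)
      then have "inner (V f) (V f) = 0" using symmetric_op_inner[OF VV, of f "V f"] by simp
      then show ?thesis by simp
    qed
    show ?thesis
    proof (cases "Q g = 0")
      case True
      then have "Q g = 0 *\<^sub>R g" by simp
      then show ?thesis using nz by blast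
    next
      case False
      have "Q (Q g) = 1 *\<^sub>R Q g" using V0[OF nz(1)] by (simp add: V_def)
      then show ?thesis using False inv[OF nz(1)] by blast
    qed
  qed
qed

text \<open>A maximal orthonormal set of eigenvectors exists by Zorn's lemma. Its orthogonal
  complement is invariant under \<open>Q\<close>, so a nonzero vector in it would produce one more
  eigenvector. The basis is a set of vectors indexed by itself.\<close>

theorem eigenbasis_exists:
  assumes Q: "symmetric_op Q" and V: "summable_kernel (entry (\<lambda>f. Q (Q f) - Q f))"
  obtains S q where "orthonormal_basis S (\<lambda>e. e)" "\<And>e. e \<in> S \<Longrightarrow> Q e = q e *\<^sub>R e"
proof -
  define P where "P = {S. orthonormal_family S (\<lambda>e. e) \<and> (\<forall>e\<in>S. \<exists>\<mu>. Q e = \<mu> *\<^sub>R e)}"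
  have "\<exists>M\<in>P. \<forall>X\<in>P. M \<subseteq> X \<longrightarrow> X = M"
  proof (rule subset_Zorn')
    fix C assume C: "subset.chain P C"
    then have sub: "C \<subseteq> P" and tot: "\<And>X Y. X \<in> C \<Longrightarrow> Y \<in> C \<Longrightarrow> X \<subseteq> Y \<or> Y \<subseteq> X"
      unfolding subset_chain_def by blast+
    have "orthonormal_family (\<Union>C) (\<lambda>e. e)"
      unfolding orthonormal_family_def
    proof (intro ballI)
      fix a b assume "a \<in> \<Union>C" "b \<in> \<Union>C"
      then obtain X where "X \<in> C" "a \<in> X" "b \<in> X" using tot by blast
      then show "cinner a b = (if a = b then 1 else 0)"
        using sub orthonormal_familyD[of X "\<lambda>e. e" a b] unfolding P_def by blast
    qed
    then show "\<Union>C \<in> P" unfolding P_def using sub[unfolded P_def] by blast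
  qed
  then obtain S where "S \<in> P" and max: "\<And>X. X \<in> P \<Longrightarrow> S \<subseteq> X \<Longrightarrow> X = S" by blast
  then have S: "orthonormal_family S (\<lambda>e. e)" "\<And>e. e \<in> S \<Longrightarrow> \<exists>\<mu>. Q e = \<mu> *\<^sub>R e"
    unfolding P_def by blast+
  have inv: "Q f \<in> ortho S" if "f \<in> ortho S" for f
    unfolding ortho_def
  proof (rule CollectI, rule ballI)
    fix h assume "h \<in> S"
    then obtain \<mu> where "Q h = \<mu> *\<^sub>R h" using S(2) by blast
    then show "cinner h (Q f) = 0"
      using that \<open>h \<in> S\<close> by (simp add: symmetric_opD[OF Q] ortho_def)
  qed
  have "f = 0" if "\<forall>e\<in>S. cinner e f = 0" for f
  proof (rule ccontr)
    assume "f \<noteq> 0"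
    moreover have "f \<in> ortho S" using that by (simp add: ortho_def)
    ultimately obtain g \<mu> where g: "g \<in> ortho S" "g \<noteq> 0" "Q g = \<mu> *\<^sub>R g"
      using exists_eigenvector_ortho[OF Q V inv] by blast
    define e where "e = (1 / norm g) *\<^sub>R g"
    have "norm e = 1" using g(2) by (simp add: e_def)
    then have ee: "cinner e e = 1" by (simp add: cinner_self)
    have eo: "cinner h e = 0" "cinner e h = 0" if "h \<in> S" for h
    proof -
      show "cinner h e = 0" using g(1) that by (simp add: e_def ortho_def)
      then show "cinner e h = 0" by (subst cinner_commute) simp
    qed
    have "Q e = \<mu> *\<^sub>R e" by (simp add: e_def symmetric_op_scaleR[OF Q] g(3))
    moreover have "orthonormal_family (insert e S) (\<lambda>e. e)"
      unfolding orthonormal_family_def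
    proof (intro ballI)
      fix a b assume "a \<in> insert e S" "b \<in> insert e S"
      then show "cinner a b = (if a = b then 1 else 0)"
        using ee eo orthonormal_familyD[OF S(1), of a b] by (metis insert_iff zero_neq_one)
    qed
    ultimately have "insert e S \<in> P" unfolding P_def using S(2) by blast
    then have "e \<in> S" using max by blast
    then show False using eo(1)[of e] ee by simp
  qed
  then have "orthonormal_basis S (\<lambda>e. e)" unfolding orthonormal_basis_def using S(1) by blast
  moreover obtain q where "\<And>e. e \<in> S \<Longrightarrow> Q e = q e *\<^sub>R e" using S(2) by metis
  ultimately show thesis using that by blast
qed

subsection \<open>Operators given by matrices of blocks\<close>

lemma norm_square_complex_vec: "(norm (a :: complex ^ 'n))\<^sup>2 = (\<Sum>i\<in>UNIV. (cmod (a $ i))\<^sup>2)"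
  by (simp add: norm_vec_def L2_set_def sum_nonneg)

lemma has_sum_vecI:
  fixes f :: "'a \<Rightarrow> ('b :: {comm_monoid_add, topological_space}) ^ 'n"
  assumes "\<And>i. ((\<lambda>x. f x $ i) has_sum s $ i) A"
  shows "(f has_sum s) A"
  unfolding has_sum_def
  by (rule vec_tendstoI) (use assms in \<open>simp add: has_sum_def sum_component\<close>)

lemma has_sum_blocks:
  fixes f :: "'a \<times> 'n::finite \<Rightarrow> 'b :: banach"
  assumes "(f has_sum s) UNIV"
  shows "((\<lambda>x. \<Sum>i\<in>UNIV. f (x, i)) has_sum s) UNIV"
proof (rule has_sum_SigmaD)
  show "(f has_sum s) (UNIV \<times> UNIV)" using assms by simp
  show "((\<lambda>i. f (x, i)) has_sum (\<Sum>i\<in>UNIV. f (x, i))) UNIV" for x by (rule has_sum_finite) simp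
qed

lemma summable_on_blocks:
  fixes f :: "'a \<times> 'n::finite \<Rightarrow> real"
  assumes "\<And>z. f z \<ge> 0"
  shows "f summable_on UNIV \<longleftrightarrow> (\<lambda>x. \<Sum>i\<in>UNIV. f (x, i)) summable_on UNIV"
proof
  assume "f summable_on UNIV"
  then show "(\<lambda>x. \<Sum>i\<in>UNIV. f (x, i)) summable_on UNIV"
    using has_sum_blocks has_sum_infsum summable_on_def by blast
next
  assume s: "(\<lambda>x. \<Sum>i\<in>UNIV. f (x, i)) summable_on UNIV"
  have "f summable_on (UNIV \<times> UNIV)"
  proof (rule summable_on_SigmaI)
    show "((\<lambda>i. f (x, i)) has_sum (\<Sum>i\<in>UNIV. f (x, i))) UNIV" for x by (rule has_sum_finite) simp
  qed (use s assms in auto)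
  then show "f summable_on UNIV" by simp
qed

text \<open>Connects blockwise states with scalar families over sites and internal states. Outside
  \<open>l2\<close> the value of \<open>Abs_ell2\<close> is unspecified, so membership in
  \<open>l2\<close> accompanies every use.\<close>

definition vec_of_state :: "'n::finite state \<Rightarrow> (site \<times> 'n) ell2" where
  "vec_of_state \<psi> = Abs_ell2 (\<lambda>z. \<psi> (fst z) $ snd z)"

definition state_of_vec :: "(site \<times> 'n::finite) ell2 \<Rightarrow> 'n state" where
  "state_of_vec f = (\<lambda>x. \<chi> i. nth_ell2 f (x, i))"

lemma state_of_vec_nth [simp]: "state_of_vec f x $ i = nth_ell2 f (x, i)"
  by (simp add: state_of_vec_def)

lemma l2_iff_square_summable: "\<psi> \<in> l2 \<longleftrightarrow> square_summable (\<lambda>z. \<psi> (fst z) $ snd z)"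
  unfolding square_summable_def l2_def by (subst summable_on_blocks) (simp_all add: norm_square_complex_vec)

lemma nth_vec_of_state: "\<psi> \<in> l2 \<Longrightarrow> nth_ell2 (vec_of_state \<psi>) z = \<psi> (fst z) $ snd z"
  by (simp add: vec_of_state_def nth_Abs_ell2 l2_iff_square_summable)

lemma state_of_vec_l2 [simp]: "state_of_vec f \<in> l2"
  by (simp add: l2_iff_square_summable)

lemma vec_of_state_of_vec [simp]: "vec_of_state (state_of_vec f) = f"
  by (rule ell2_eqI) (simp add: nth_vec_of_state)

lemma state_of_vec_of_state: "\<psi> \<in> l2 \<Longrightarrow> state_of_vec (vec_of_state \<psi>) = \<psi>"
  by (rule ext) (simp add: vec_eq_iff nth_vec_of_state)

lemma l2_inner_vec:
  assumes "\<phi> \<in> l2" "\<psi> \<in> l2"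
  shows "l2_inner \<phi> \<psi> = cinner (vec_of_state \<phi>) (vec_of_state \<psi>)"
  unfolding l2_inner_def
  by (rule infsumI)
    (use has_sum_blocks[OF has_sum_cinner[of "vec_of_state \<phi>" "vec_of_state \<psi>"]] assms
      in \<open>simp add: nth_vec_of_state cdot_def\<close>)

lemma l2_norm_vec:
  assumes "\<psi> \<in> l2"
  shows "l2_norm \<psi> = norm (vec_of_state \<psi>)"
proof -
  have "(\<Sum>\<^sub>\<infinity>x. (norm (\<psi> x))\<^sup>2) = (norm (vec_of_state \<psi>))\<^sup>2"
    by (rule infsumI)
      (use has_sum_blocks[OF has_sum_norm_square[of "vec_of_state \<psi>"]] assms
        in \<open>simp add: nth_vec_of_state norm_square_complex_vec\<close>)
  then show ?thesis by (simp add: l2_norm_def)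
qed

definition opr_of :: "((site \<times> 'n) ell2 \<Rightarrow> (site \<times> 'n) ell2) \<Rightarrow> 'n::finite opr" where
  "opr_of T = (\<lambda>x y. \<chi> i j. entry T (x, i) (y, j))"

lemma opr_of_nth [simp]: "opr_of T x y $ i $ j = entry T (x, i) (y, j)"
  by (simp add: opr_of_def)

lemma opr_eq_iff: "(A :: 'n::finite opr) = B \<longleftrightarrow> (\<forall>x y i j. A x y $ i $ j = B x y $ i $ j)"
  by (auto simp: fun_eq_iff vec_eq_iff)

lemma opr_of_inject:
  assumes "symmetric_op T" "symmetric_op U" "opr_of T = opr_of U"
  shows "T = U"
  by (rule symmetric_op_eqI[OF assms(1,2)]) (use assms(3) in \<open>auto simp: opr_eq_iff\<close>)

text \<open>Needed for products of two symmetric operators, which are in general not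
  symmetric.\<close>

lemma opr_of_inject_linear:
  assumes T: "bounded_linear T" "\<And>c f. T (c *\<^sub>c f) = c *\<^sub>c T f"
    and U: "bounded_linear U" "\<And>c f. U (c *\<^sub>c f) = c *\<^sub>c U f"
    and eq: "opr_of T = opr_of U"
  shows "T f = U f"
proof -
  have "entry T z w = entry U z w" for z w
    using opr_of_nth[of T "fst z" "fst w" "snd z" "snd w"] opr_of_nth[of U "fst z" "fst w" "snd z" "snd w"]
    unfolding eq by simp
  then have cols: "T (delta w) = U (delta w)" for w
    by (intro ell2_eqI) (simp add: entry_def)
  have "((\<lambda>w. nth_ell2 f w *\<^sub>c T (delta w)) has_sum T f) UNIV"
    using has_sum_bounded_linear[OF T(1) has_sum_delta[of f]] unfolding T(2) .
  moreover have "((\<lambda>w. nth_ell2 f w *\<^sub>c T (delta w)) has_sum U f) UNIV"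
    using has_sum_bounded_linear[OF U(1) has_sum_delta[of f]] unfolding U(2) cols .
  ultimately show ?thesis by (rule has_sum_unique)
qed

lemma op_apply_opr_of:
  assumes T: "symmetric_op T" and \<psi>: "\<psi> \<in> l2"
  shows "((\<lambda>y. opr_of T x y *v \<psi> y) has_sum state_of_vec (T (vec_of_state \<psi>)) x) UNIV"
    and "op_apply (opr_of T) \<psi> = state_of_vec (T (vec_of_state \<psi>))"
proof -
  show *: "((\<lambda>y. opr_of T x y *v \<psi> y) has_sum state_of_vec (T (vec_of_state \<psi>)) x) UNIV" for x
  proof (rule has_sum_vecI)
    fix i
    show "((\<lambda>y. (opr_of T x y *v \<psi> y) $ i) has_sum state_of_vec (T (vec_of_state \<psi>)) x $ i) UNIV"
      using has_sum_blocks[OF has_sum_entry(1)[OF T, of "(x, i)" "vec_of_state \<psi>"]]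
      by (simp add: matrix_vector_mult_def nth_vec_of_state[OF \<psi>])
  qed
  show "op_apply (opr_of T) \<psi> = state_of_vec (T (vec_of_state \<psi>))"
    unfolding op_apply_def by (rule ext) (rule infsumI[OF *])
qed

lemma l2_inner_opr_of:
  assumes "symmetric_op T" "\<psi> \<in> l2"
  shows "l2_inner \<psi> (op_apply (opr_of T) \<psi>) = cinner (vec_of_state \<psi>) (T (vec_of_state \<psi>))"
  by (simp add: op_apply_opr_of(2)[OF assms] l2_inner_vec assms)

lemma bounded_op_opr_of:
  assumes T: "symmetric_op T"
  shows "bounded_op (opr_of T)"
proof -
  obtain M where M: "\<And>f. norm (T f) \<le> M * norm f" using symmetric_op_bounded[OF T] by blast
  have "l2_norm (op_apply (opr_of T) \<psi>) \<le> M * l2_norm \<psi>" if "\<psi> \<in> l2" for \<psi>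
    using M[of "vec_of_state \<psi>"] by (simp add: op_apply_opr_of(2)[OF T that] l2_norm_vec that)
  moreover have "(\<lambda>y. opr_of T x y *v \<psi> y) summable_on UNIV" if "\<psi> \<in> l2" for \<psi> x
    using op_apply_opr_of(1)[OF T that] summable_on_def by blast
  moreover have "op_apply (opr_of T) \<psi> \<in> l2" if "\<psi> \<in> l2" for \<psi>
    by (simp add: op_apply_opr_of(2)[OF T that])
  ultimately show ?thesis unfolding bounded_op_def by blast
qed

lemma hermitian_opr_of: "symmetric_op T \<Longrightarrow> hermitian (opr_of T)"
  unfolding hermitian_def opr_of_nth by (intro allI entry_hermitian)

lemma op_mult_opr_of:
  assumes "symmetric_op T"
  shows "opr_of T \<odot> opr_of U = opr_of (\<lambda>f. T (U f))"
proof -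
  have "((\<lambda>z. opr_of T x z ** opr_of U z y) has_sum opr_of (\<lambda>f. T (U f)) x y) UNIV" for x y
  proof (intro has_sum_vecI)
    fix i j
    show "((\<lambda>z. (opr_of T x z ** opr_of U z y) $ i $ j) has_sum opr_of (\<lambda>f. T (U f)) x y $ i $ j) UNIV"
      using has_sum_blocks[OF has_sum_entry(1)[OF assms, of "(x, i)" "U (delta (y, j))"]]
      by (simp add: matrix_matrix_mult_def entry_def)
  qed
  then show ?thesis unfolding op_mult_def by (intro ext infsumI)
qed

lemma opr_of_id: "opr_of (\<lambda>f. f) = op_id"
  by (auto simp: opr_eq_iff op_id_def entry_def nth_delta mat_def)

text \<open>The way from the block matrices of the statement back to operators: bounded Hermitian
  matrices are exactly the values of \<open>opr_of\<close> on symmetric operators.\<close>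

lemma symmetric_op_of_opr:
  fixes A :: "'n::finite opr"
  assumes A: "bounded_op A" "hermitian A"
  obtains T where "symmetric_op T" "A = opr_of T"
proof -
  have summable: "(\<lambda>y. A x y *v \<psi> y) summable_on UNIV" and mem: "op_apply A \<psi> \<in> l2" if "\<psi> \<in> l2" for \<psi> x
    using A(1) that unfolding bounded_op_def by blast+
  obtain M where M: "\<And>\<psi>. \<psi> \<in> l2 \<Longrightarrow> l2_norm (op_apply A \<psi>) \<le> M * l2_norm \<psi>"
    using A(1) unfolding bounded_op_def by blast
  define T where "T f = vec_of_state (op_apply A (state_of_vec f))" for f
  have nth_T: "nth_ell2 (T f) (x, i) = op_apply A (state_of_vec f) x $ i" for f x i
    by (simp add: T_def nth_vec_of_state mem)
  have hs: "((\<lambda>y. A x y *v state_of_vec f y) has_sum op_apply A (state_of_vec f) x) UNIV" for f x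
    unfolding op_apply_def by (rule has_sum_infsum) (rule summable, simp)
  have entry: "entry T (x, i) (y, j) = A x y $ i $ j" for x y i j
  proof -
    have "((\<lambda>z. A x z *v state_of_vec (delta (y, j)) z) has_sum (\<chi> i. A x y $ i $ j)) UNIV"
    proof (rule has_sum_finite_neutralI[where B = "{y}"])
      have "(A x y *v state_of_vec (delta (y, j)) y) $ i = A x y $ i $ j" for i
        by (simp add: matrix_vector_mult_def nth_delta if_distrib cong: if_cong)
      then show "(\<chi> i. A x y $ i $ j) = (\<Sum>z\<in>{y}. A x z *v state_of_vec (delta (y, j)) z)"
        by (simp add: vec_eq_iff)
      fix z assume "z \<in> UNIV - {y}"
      then have "state_of_vec (delta (y, j)) z = 0" by (simp add: vec_eq_iff nth_delta)
      then show "A x z *v state_of_vec (delta (y, j)) z = 0" by simp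
    qed auto
    then have "op_apply A (state_of_vec (delta (y, j))) x = (\<chi> i. A x y $ i $ j)"
      using hs has_sum_unique by blast
    then show ?thesis by (simp add: entry_def nth_T)
  qed
  have "symmetric_op T"
  proof (rule symmetric_op_of_entries)
    show "T (f + g) = T f + T g" for f g
    proof (rule ell2_eqI)
      fix z :: "site \<times> 'n"
      have "state_of_vec (f + g) y = state_of_vec f y + state_of_vec g y" for y
        by (simp add: vec_eq_iff)
      then have "((\<lambda>y. A (fst z) y *v state_of_vec (f + g) y) has_sum
          op_apply A (state_of_vec f) (fst z) + op_apply A (state_of_vec g) (fst z)) UNIV"
        using has_sum_add[OF hs[of "fst z" f] hs[of "fst z" g]] by (simp add: matrix_vector_right_distrib)
      then have "op_apply A (state_of_vec (f + g)) (fst z) =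
          op_apply A (state_of_vec f) (fst z) + op_apply A (state_of_vec g) (fst z)"
        using hs has_sum_unique by blast
      then show "nth_ell2 (T (f + g)) z = nth_ell2 (T f + T g) z"
        using nth_T[of _ "fst z" "snd z"] by simp
    qed
    show "T (c *\<^sub>c f) = c *\<^sub>c T f" for c f
    proof (rule ell2_eqI)
      fix z :: "site \<times> 'n"
      have bl: "bounded_linear (\<lambda>a :: complex ^ 'n. c *s a)"
      proof (rule bounded_linear_intro[where K = "cmod c"])
        show "norm (c *s a) \<le> norm a * cmod c" for a :: "complex ^ 'n"
          by (simp add: norm_vec_def L2_set_left_distrib[symmetric] norm_mult L2_set_right_distrib mult.commute)
      qed (simp_all add: vec_eq_iff algebra_simps)
      have "A (fst z) y *v state_of_vec (c *\<^sub>c f) y = c *s (A (fst z) y *v state_of_vec f y)" for y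
        by (simp add: vec_eq_iff matrix_vector_mult_def sum_distrib_left mult_ac)
      then have "((\<lambda>y. A (fst z) y *v state_of_vec (c *\<^sub>c f) y) has_sum
          c *s op_apply A (state_of_vec f) (fst z)) UNIV"
        using has_sum_bounded_linear[OF bl hs[of "fst z" f]] by simp
      then have "op_apply A (state_of_vec (c *\<^sub>c f)) (fst z) = c *s op_apply A (state_of_vec f) (fst z)"
        using hs has_sum_unique by blast
      then show "nth_ell2 (T (c *\<^sub>c f)) z = nth_ell2 (c *\<^sub>c T f) z"
        using nth_T[of _ "fst z" "snd z"] by simp
    qed
    show "norm (T f) \<le> M * norm f" for f
      using M[of "state_of_vec f"] by (simp add: T_def l2_norm_vec mem)
    show "entry T y x = cnj (entry T x y)" for x y
      using A(2)[unfolded hermitian_def, rule_format, of "fst y" "fst x" "snd y" "snd x"]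
        entry[of "fst x" "snd x" "fst y" "snd y"] entry[of "fst y" "snd y" "fst x" "snd x"]
      by simp
  qed
  moreover have "A = opr_of T" by (simp add: opr_eq_iff entry)
  ultimately show thesis using that by blast
qed

lemma orthogonal_projection_opr_of:
  assumes "symmetric_op T"
  shows "orthogonal_projection (opr_of T) \<longleftrightarrow> (\<forall>f. T (T f) = T f)"
proof -
  have "opr_of T \<odot> opr_of T = opr_of T \<longleftrightarrow> (\<lambda>f. T (T f)) = T"
    unfolding op_mult_opr_of[OF assms]
    using opr_of_inject[OF symmetric_op_compose_self[OF assms] assms] by metis
  then show ?thesis
    using bounded_op_opr_of[OF assms] hermitian_opr_of[OF assms]
    by (simp add: orthogonal_projection_def fun_eq_iff)
qed

subsection \<open>Spectral measures\<close>

text \<open>Put mass \<open>g a\<close> on each index and push forward along \<open>q\<close>: an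
  atomic measure on the line. Boundedness of \<open>q\<close> makes the identity integrable.\<close>

lemma discrete_measure:
  fixes g q :: "'k \<Rightarrow> real"
  assumes g: "g summable_on S" "\<And>a. g a \<ge> 0" and q: "\<And>a. a \<in> S \<Longrightarrow> \<bar>q a\<bar> \<le> M"
  obtains \<mu> where "finite_measure \<mu>" "sets \<mu> = sets borel"
    "\<And>B. B \<in> sets borel \<Longrightarrow> measure \<mu> B = (\<Sum>\<^sub>\<infinity>a\<in>{a\<in>S. q a \<in> B}. g a)"
    "integrable \<mu> (\<lambda>t. t)" "(\<integral>t. t \<partial>\<mu>) = (\<Sum>\<^sub>\<infinity>a\<in>S. q a * g a)"
proof -
  define \<mu> where "\<mu> = distr (density (count_space S) g) borel q"
  have main: "integrable \<mu> f \<and> (\<integral>t. f t \<partial>\<mu>) = (\<Sum>\<^sub>\<infinity>a\<in>S. f (q a) * g a)"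
    if f: "f \<in> borel_measurable borel" "\<And>a. a \<in> S \<Longrightarrow> \<bar>f (q a)\<bar> \<le> N" for f :: "real \<Rightarrow> real" and N
  proof -
    have "(\<lambda>a. norm (f (q a) * g a)) summable_on S"
      by (rule summable_on_comparison_test[OF summable_on_cmult_right[OF g(1), of N]])
        (use f(2) g(2) in \<open>auto simp: abs_mult intro!: mult_right_mono\<close>)
    then have s: "Infinite_Set_Sum.abs_summable_on (\<lambda>a. f (q a) * g a) S"
      using abs_summable_equivalent by blast
    have q_meas: "q \<in> measurable (density (count_space S) g) borel" by simp
    have "integrable \<mu> f"
      unfolding \<mu>_def integrable_distr_eq[OF q_meas f(1)]
      by (subst integrable_density) (use s g(2) in \<open>auto simp: Infinite_Set_Sum.abs_summable_on_def mult.commute\<close>)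
    moreover have "(\<integral>t. f t \<partial>\<mu>) = (\<integral>a. f (q a) \<partial>density (count_space S) g)"
      unfolding \<mu>_def by (rule integral_distr[OF q_meas f(1)])
    moreover have "\<dots> = (\<integral>a. g a *\<^sub>R f (q a) \<partial>count_space S)"
      by (rule integral_density) (use g(2) in auto)
    moreover have "\<dots> = infsetsum (\<lambda>a. f (q a) * g a) S"
      unfolding infsetsum_def by (simp add: mult.commute)
    moreover have "\<dots> = (\<Sum>\<^sub>\<infinity>a\<in>S. f (q a) * g a)" by (rule infsetsum_infsum[OF s])
    ultimately show ?thesis by simp
  qed
  show thesis
  proof (rule that[of \<mu>])
    show sets: "sets \<mu> = sets borel" by (simp add: \<mu>_def)
    have "integrable \<mu> (\<lambda>_. 1 :: real)" using main[of "\<lambda>_. 1" 1] by simp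
    then show fin: "finite_measure \<mu>"
      by (intro finite_measureI) (simp add: integrable_iff_bounded)
    show "integrable \<mu> (\<lambda>t. t)" "(\<integral>t. t \<partial>\<mu>) = (\<Sum>\<^sub>\<infinity>a\<in>S. q a * g a)"
      using main[of "\<lambda>t. t" M] q by auto
    fix B :: "real set" assume B: "B \<in> sets borel"
    have "measure \<mu> B = (\<integral>t. indicator B t \<partial>\<mu>)"
      using B sets sets_eq_imp_space_eq[OF sets] by simp
    also have "\<dots> = (\<Sum>\<^sub>\<infinity>a\<in>S. indicator B (q a) * g a)"
      using main[of "indicator B" 1] B by (simp add: indicator_def)
    also have "\<dots> = (\<Sum>\<^sub>\<infinity>a\<in>{a\<in>S. q a \<in> B}. g a)"
      by (rule infsum_cong_neutral) (auto simp: indicator_def)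
    finally show "measure \<mu> B = (\<Sum>\<^sub>\<infinity>a\<in>{a\<in>S. q a \<in> B}. g a)" .
  qed
qed

lemma eigenvalue_bound:
  assumes "orthonormal_family S e" "a \<in> S" "T (e a) = q a *\<^sub>R e a" "norm (T (e a)) \<le> M * norm (e a)"
  shows "\<bar>q a\<bar> \<le> M"
  using assms(3,4) norm_orthonormal[OF assms(1,2)] by simp

lemma cinner_span_proj_self:
  assumes "orthonormal_family S e"
  shows "cinner f (span_proj S e f) = of_real (\<Sum>\<^sub>\<infinity>a\<in>S. (cmod (cinner (e a) f))\<^sup>2)"
proof -
  have "cinner f (span_proj S e f) = cinner (span_proj S e f) (span_proj S e f)"
    unfolding span_proj_symmetric[OF assms, symmetric]
    using span_proj_span_proj[OF assms order_refl order_refl, of f] by simp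
  then show ?thesis unfolding cinner_self infsumI[OF has_sum_norm_span_proj[OF assms]] .
qed

text \<open>The existence half of the spectral theorem for diagonalisable operators: project onto
  the eigenvectors with eigenvalue in \<open>B\<close>. It justifies the choice operator in
  \<open>spectral_measure\<close>. The scalar measure of a state has mass equal to the squared
  modulus of its \<open>a\<close>-th coefficient at \<open>q a\<close>.\<close>

lemma is_spectral_measure_eigenbasis:
  fixes T :: "(site \<times> 'n::finite) ell2 \<Rightarrow> (site \<times> 'n) ell2"
  assumes T: "symmetric_op T" and S: "orthonormal_basis S e" and q: "\<And>a. a \<in> S \<Longrightarrow> T (e a) = q a *\<^sub>R e a"
  shows "is_spectral_measure (opr_of T) (\<lambda>B. opr_of (span_proj {a\<in>S. q a \<in> B} e))"
proof -
  have on: "orthonormal_family S e" by (rule orthonormal_basis_family[OF S])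
  have on_B: "orthonormal_family {a\<in>S. q a \<in> B} e" for B
    by (rule orthonormal_family_subset[OF on]) auto
  note sym_B = symmetric_op_span_proj[OF on_B]
  have proj_B: "span_proj {a\<in>S. q a \<in> B} e (span_proj {a\<in>S. q a \<in> C} e f) =
      span_proj {a\<in>S. q a \<in> B \<inter> C} e f" for B C f
  proof -
    have "{a\<in>S. q a \<in> B} \<inter> {a\<in>S. q a \<in> C} = {a\<in>S. q a \<in> B \<inter> C}" by auto
    then show ?thesis using span_proj_span_proj[OF on, of "{a\<in>S. q a \<in> B}" "{a\<in>S. q a \<in> C}" f] by simp
  qed
  obtain M where M: "\<And>f. norm (T f) \<le> M * norm f" using symmetric_op_bounded[OF T] by blast
  have spec: "\<exists>\<mu>. finite_measure \<mu> \<and> sets \<mu> = sets borel \<and>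
        (\<forall>B\<in>sets borel. l2_inner \<psi> (op_apply (opr_of (span_proj {a\<in>S. q a \<in> B} e)) \<psi>) = of_real (measure \<mu> B)) \<and>
        integrable \<mu> (\<lambda>t. t) \<and>
        l2_inner \<psi> (op_apply (opr_of T) \<psi>) = of_real (\<integral>t. t \<partial>\<mu>)" if \<psi>: "\<psi> \<in> l2" for \<psi>
  proof -
    let ?f = "vec_of_state \<psi>"
    let ?g = "\<lambda>a. (cmod (cinner (e a) ?f))\<^sup>2"
    obtain \<mu> where \<mu>: "finite_measure \<mu>" "sets \<mu> = sets borel"
      "\<And>B. B \<in> sets borel \<Longrightarrow> measure \<mu> B = (\<Sum>\<^sub>\<infinity>a\<in>{a\<in>S. q a \<in> B}. ?g a)"
      "integrable \<mu> (\<lambda>t. t)" "(\<integral>t. t \<partial>\<mu>) = (\<Sum>\<^sub>\<infinity>a\<in>S. q a * ?g a)"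
    proof (rule discrete_measure[of ?g S q M])
      show "?g summable_on S" by (rule bessel_summable[OF on])
      show "\<bar>q a\<bar> \<le> M" if "a \<in> S" for a
        by (rule eigenvalue_bound[where T = T and e = e and q = q, OF on that q[OF that]]) (rule M)
    qed auto
    have "l2_inner \<psi> (op_apply (opr_of (span_proj {a\<in>S. q a \<in> B} e)) \<psi>) = of_real (measure \<mu> B)"
      if "B \<in> sets borel" for B
      unfolding l2_inner_opr_of[OF sym_B \<psi>] cinner_span_proj_self[OF on_B] \<mu>(3)[OF that] ..
    moreover have "l2_inner \<psi> (op_apply (opr_of T) \<psi>) = of_real (\<integral>t. t \<partial>\<mu>)"
    proof -
      have hs0: "((\<lambda>a. cinner ?f ((of_real (q a) * cinner (e a) ?f) *\<^sub>c e a)) has_sum cinner ?f (T ?f)) S"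
        by (rule has_sum_bounded_linear[OF bounded_linear_cinner has_sum_eigen_expansion[OF S T q]])
      have "cinner ?f ((of_real (q a) * cinner (e a) ?f) *\<^sub>c e a) = of_real (q a * ?g a)" for a
        unfolding cinner_scaleC_right cinner_commute[of ?f "e a"] of_real_mult complex_norm_square
        by simp
      then have hs: "((\<lambda>a. complex_of_real (q a * ?g a)) has_sum cinner ?f (T ?f)) S"
        using hs0 by (simp only:)
      then have "((\<lambda>a. q a * ?g a) has_sum Re (cinner ?f (T ?f))) S" using has_sum_Re by fastforce
      then have "((\<lambda>a. complex_of_real (q a * ?g a)) has_sum of_real (Re (cinner ?f (T ?f)))) S"
        by (rule has_sum_of_real)
      then have "cinner ?f (T ?f) = of_real (Re (cinner ?f (T ?f)))" using hs has_sum_unique by blast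
      moreover have "Re (cinner ?f (T ?f)) = (\<integral>t. t \<partial>\<mu>)"
        unfolding \<mu>(5) by (rule infsumI[symmetric]) fact
      ultimately show ?thesis by (simp add: l2_inner_opr_of[OF T \<psi>])
    qed
    ultimately show ?thesis using \<mu>(1,2,4) by blast
  qed
  have "orthogonal_projection (opr_of (span_proj {a\<in>S. q a \<in> B} e))" for B
    unfolding orthogonal_projection_opr_of[OF sym_B] proj_B by simp
  moreover have "opr_of (span_proj {a\<in>S. q a \<in> UNIV} e) = op_id"
  proof -
    have "span_proj {a\<in>S. q a \<in> UNIV} e = (\<lambda>f. f)" by (rule ext) (simp add: span_proj_basis[OF S])
    then show ?thesis by (simp only: opr_of_id)
  qed
  moreover have "opr_of (span_proj {a\<in>S. q a \<in> B \<inter> C} e) =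
      opr_of (span_proj {a\<in>S. q a \<in> B} e) \<odot> opr_of (span_proj {a\<in>S. q a \<in> C} e)" for B C
    unfolding op_mult_opr_of[OF sym_B] proj_B by simp
  ultimately show ?thesis unfolding is_spectral_measure_def using spec by blast
qed

text \<open>Strictness matters: it is what excludes a component above \<open>c\<close> for an
  eigenvalue equal to \<open>c\<close>, in accordance with the half-line being open.\<close>

lemma integral_indicator_pos:
  fixes \<mu> :: "real measure"
  assumes "finite_measure \<mu>" "sets \<mu> = sets borel" "integrable \<mu> (\<lambda>t. t)" "measure \<mu> {c<..} > 0"
  shows "(\<integral>t. indicator {c<..} t * t \<partial>\<mu>) > c * measure \<mu> {c<..}"
proof -
  interpret finite_measure \<mu> by fact
  have B: "{c<..} \<in> sets \<mu>" using assms(2) by simp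
  let ?h = "\<lambda>t. indicator {c<..} t * (t - c)"
  have int: "integrable \<mu> (\<lambda>t. indicator {c<..} t * t)"
    using integrable_mult_indicator[OF B assms(3)] by simp
  have intc: "integrable \<mu> (\<lambda>t. indicator {c<..} t * c)"
    using integrable_mult_indicator[OF B, of "\<lambda>_. c"] by simp
  have eq: "?h = (\<lambda>t. indicator {c<..} t * t - indicator {c<..} t * c)" by (auto simp: algebra_simps)
  have inth: "integrable \<mu> ?h" unfolding eq using int intc by (rule Bochner_Integration.integrable_diff)
  have nonneg: "AE t in \<mu>. 0 \<le> ?h t" by (auto simp: indicator_def)
  have "(\<integral>t. ?h t \<partial>\<mu>) \<noteq> 0"
  proof
    assume "(\<integral>t. ?h t \<partial>\<mu>) = 0"
    then have "AE t in \<mu>. ?h t = 0" using integral_nonneg_eq_0_iff_AE[OF inth nonneg] by blast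
    then have "AE t in \<mu>. t \<notin> {c<..}" by (rule AE_mp) (auto simp: indicator_def)
    then have "emeasure \<mu> {c<..} = 0"
      using B AE_iff_null_sets[OF B] by (auto simp: null_sets_def)
    then show False using assms(4) by (simp add: measure_def)
  qed
  moreover have "0 \<le> (\<integral>t. ?h t \<partial>\<mu>)" by (rule integral_nonneg_AE[OF nonneg])
  ultimately have "0 < (\<integral>t. ?h t \<partial>\<mu>)" by simp
  also have "(\<integral>t. ?h t \<partial>\<mu>) = (\<integral>t. indicator {c<..} t * t \<partial>\<mu>) - c * measure \<mu> {c<..}"
    unfolding eq using Bochner_Integration.integral_diff[OF int intc] B by simp
  finally show ?thesis by simp
qed

lemma integral_indicator_le:
  fixes \<mu> :: "real measure"
  assumes "finite_measure \<mu>" "sets \<mu> = sets borel" "integrable \<mu> (\<lambda>t. t)"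
  shows "(\<integral>t. indicator {..c} t * t \<partial>\<mu>) \<le> c * measure \<mu> {..c}"
proof -
  interpret finite_measure \<mu> by fact
  have B: "{..c} \<in> sets \<mu>" using assms(2) by simp
  have "(\<integral>t. indicator {..c} t * t \<partial>\<mu>) \<le> (\<integral>t. indicator {..c} t * c \<partial>\<mu>)"
  proof (rule integral_mono)
    show "integrable \<mu> (\<lambda>t. indicator {..c} t * t)" using integrable_mult_indicator[OF B assms(3)] by simp
    show "integrable \<mu> (\<lambda>t. indicator {..c} t * c)" using integrable_mult_indicator[OF B, of "\<lambda>_. c"] by simp
  qed (auto simp: indicator_def)
  also have "\<dots> = c * measure \<mu> {..c}" using B by simp
  finally show ?thesis .
qed

text \<open>Takes the place of uniqueness of spectral measures. Split \<open>f\<close> into the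
  parts \<open>?a\<close> above and \<open>?b\<close> at or below \<open>c\<close>. The eigenvalue
  equation gives each part the quadratic form \<open>l\<close> times its squared norm, whereas the
  scalar measure makes the form exceed \<open>c\<close> times the squared norm for a nonzero
  \<open>?a\<close> and not exceed it for \<open>?b\<close>. So only the part on the correct side
  survives.\<close>

theorem spectral_projection_eigenvector:
  fixes T :: "(site \<times> 'n::finite) ell2 \<Rightarrow> (site \<times> 'n) ell2"
  assumes T: "symmetric_op T" and E: "is_spectral_measure (opr_of T) E"
  obtains R where "symmetric_op R" "E {c<..} = opr_of R"
    "\<And>f l. T f = l *\<^sub>R f \<Longrightarrow> R f = (if l > c then f else 0)"
proof -
  have "\<exists>R. symmetric_op R \<and> E B = opr_of R \<and> (\<forall>f. R (R f) = R f)" if "B \<in> sets borel" for B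
  proof -
    have op: "orthogonal_projection (E B)" using E that unfolding is_spectral_measure_def by blast
    then obtain R where R: "symmetric_op R" "E B = opr_of R"
      using symmetric_op_of_opr unfolding orthogonal_projection_def by blast
    then show ?thesis using op orthogonal_projection_opr_of[OF R(1)] by auto
  qed
  then obtain R where R: "\<And>B. B \<in> sets borel \<Longrightarrow> symmetric_op (R B)"
    "\<And>B. B \<in> sets borel \<Longrightarrow> E B = opr_of (R B)" "\<And>B f. B \<in> sets borel \<Longrightarrow> R B (R B f) = R B f" by metis
  have R_Int: "R (B \<inter> C) f = R B (R C f)" if BC: "B \<in> sets borel" "C \<in> sets borel" for B C f
  proof -
    have "E (B \<inter> C) = E B \<odot> E C" using E BC unfolding is_spectral_measure_def by blast
    then have eq: "opr_of (R (B \<inter> C)) = opr_of (\<lambda>f. R B (R C f))"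
      using R(2) BC by (simp add: op_mult_opr_of[OF R(1)])
    have BC': "B \<inter> C \<in> sets borel" using BC by blast
    show ?thesis
    proof (rule opr_of_inject_linear[OF _ _ _ _ eq])
      show "bounded_linear (R (B \<inter> C))" by (rule bounded_linear_symmetric_op[OF R(1)[OF BC']])
      show "R (B \<inter> C) (c *\<^sub>c f) = c *\<^sub>c R (B \<inter> C) f" for c f
        by (rule symmetric_op_scaleC[OF R(1)[OF BC']])
      show "bounded_linear (\<lambda>f. R B (R C f))"
        by (rule bounded_linear_compose[OF bounded_linear_symmetric_op[OF R(1)[OF BC(1)]]
              bounded_linear_symmetric_op[OF R(1)[OF BC(2)]]])
      show "R B (R C (c *\<^sub>c f)) = c *\<^sub>c R B (R C f)" for c f
        by (simp add: symmetric_op_scaleC[OF R(1)] BC)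
    qed
  qed
  have meas: "\<exists>\<mu>. finite_measure \<mu> \<and> sets \<mu> = sets borel \<and>
        (\<forall>B\<in>sets borel. cinner f (R B f) = of_real (measure \<mu> B)) \<and>
        integrable \<mu> (\<lambda>t. t) \<and> cinner f (T f) = of_real (\<integral>t. t \<partial>\<mu>)" for f
  proof -
    have "\<forall>\<psi>\<in>l2. \<exists>\<mu>. finite_measure \<mu> \<and> sets \<mu> = sets borel \<and>
        (\<forall>B\<in>sets borel. l2_inner \<psi> (op_apply (E B) \<psi>) = of_real (measure \<mu> B)) \<and>
        integrable \<mu> (\<lambda>t. t) \<and> l2_inner \<psi> (op_apply (opr_of T) \<psi>) = of_real (\<integral>t. t \<partial>\<mu>)"
      using E unfolding is_spectral_measure_def by (elim conjE)
    from bspec[OF this state_of_vec_l2[of f]] obtain \<mu> where \<mu>: "finite_measure \<mu>" "sets \<mu> = sets borel"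
      "\<forall>B\<in>sets borel. l2_inner (state_of_vec f) (op_apply (E B) (state_of_vec f)) = of_real (measure \<mu> B)"
      "integrable \<mu> (\<lambda>t. t)"
      "l2_inner (state_of_vec f) (op_apply (opr_of T) (state_of_vec f)) = of_real (\<integral>t. t \<partial>\<mu>)"
      by (elim exE conjE)
    have "cinner f (R B f) = of_real (measure \<mu> B)" if B: "B \<in> sets borel" for B
      using bspec[OF \<mu>(3) B] unfolding R(2)[OF B] l2_inner_opr_of[OF R(1)[OF B] state_of_vec_l2] by simp
    moreover have "cinner f (T f) = of_real (\<integral>t. t \<partial>\<mu>)"
      using \<mu>(5) unfolding l2_inner_opr_of[OF T state_of_vec_l2] by simp
    ultimately show ?thesis using \<mu>(1,2,4) by blast
  qed
  \<comment> \<open>Multiplicativity of \<open>E\<close> identifies the scalar measure of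
    \<open>R B f\<close> as the restriction to \<open>B\<close> of the scalar measure of
    \<open>f\<close>.\<close>
  have part: "cinner (R B f) (T (R B f)) = of_real (\<integral>t. indicator B t * t \<partial>\<mu>)"
    if B: "B \<in> sets borel" and \<mu>: "finite_measure \<mu>" "sets \<mu> = sets borel"
      "\<forall>B\<in>sets borel. cinner f (R B f) = of_real (measure \<mu> B)" for B f \<mu>
  proof -
    interpret finite_measure \<mu> by fact
    obtain \<nu> where \<nu>: "finite_measure \<nu>" "sets \<nu> = sets borel"
      "\<forall>C\<in>sets borel. cinner (R B f) (R C (R B f)) = of_real (measure \<nu> C)"
      "cinner (R B f) (T (R B f)) = of_real (\<integral>t. t \<partial>\<nu>)"
      using meas[of "R B f"] by blast
    have "\<nu> = density \<mu> (indicator B)"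
    proof (rule measure_eqI)
      show "sets \<nu> = sets (density \<mu> (indicator B))" using \<mu>(2) \<nu>(2) by simp
      fix C assume "C \<in> sets \<nu>"
      then have C: "C \<in> sets borel" using \<nu>(2) by simp
      have BC: "B \<inter> C \<in> sets borel" using B C by blast
      have "of_real (measure \<nu> C) = cinner (R B f) (R C (R B f))" using \<nu>(3) C by simp
      also have "\<dots> = cinner f (R B (R C (R B f)))" by (rule symmetric_opD[OF R(1)[OF B], symmetric])
      also have "R B (R C (R B f)) = R (B \<inter> C) f"
        using R_Int[OF BC B, of f] by (simp add: R_Int[OF B C] inf_absorb1)
      also have "cinner f (R (B \<inter> C) f) = of_real (measure \<mu> (B \<inter> C))" using \<mu>(3) BC by simp
      finally have "measure \<nu> C = measure \<mu> (B \<inter> C)" by (simp only: of_real_eq_iff)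
      moreover have "emeasure (density \<mu> (indicator B)) C = emeasure \<mu> (B \<inter> C)"
        using B C \<mu>(2) by (subst emeasure_density) (simp_all add: indicator_inter_arith[symmetric])
      ultimately show "emeasure \<nu> C = emeasure (density \<mu> (indicator B)) C"
        by (simp add: finite_measure.emeasure_eq_measure[OF \<nu>(1)] emeasure_eq_measure)
    qed
    then have "(\<integral>t. t \<partial>\<nu>) = (\<integral>t. t \<partial>density \<mu> (\<lambda>t. ennreal (indicator B t)))"
      by (simp add: ennreal_indicator)
    also have "\<dots> = (\<integral>t. indicator B t *\<^sub>R t \<partial>\<mu>)"
      by (rule integral_density) (use B \<mu>(2) in \<open>auto simp: measurable_cong_sets[OF \<mu>(2) refl]\<close>)
    finally show ?thesis using \<nu>(4) by simp
  qed
  have B: "{c<..} \<in> sets borel" and B': "{..c} \<in> sets borel" by auto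
  have "R {c<..} f = (if l > c then f else 0)" if eig: "T f = l *\<^sub>R f" for f l
  proof -
    obtain \<mu> where \<mu>: "finite_measure \<mu>" "sets \<mu> = sets borel"
      "\<forall>B\<in>sets borel. cinner f (R B f) = of_real (measure \<mu> B)"
      "integrable \<mu> (\<lambda>t. t)" "cinner f (T f) = of_real (\<integral>t. t \<partial>\<mu>)"
      using meas[of f] by blast
    interpret finite_measure \<mu> by fact
    let ?a = "R {c<..} f" and ?b = "R {..c} f"
    have norm_R: "inner (R C f) (R C f) = measure \<mu> C" "inner f (R C f) = measure \<mu> C"
      if "C \<in> sets borel" for C
    proof -
      have "cinner (R C f) (R C f) = cinner f (R C f)"
        using symmetric_opD[OF R(1)[OF that], of f "R C f"] R(3)[OF that] by simp
      then show "inner (R C f) (R C f) = measure \<mu> C" "inner f (R C f) = measure \<mu> C"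
        unfolding Re_cinner[symmetric] using \<mu>(3) that by simp_all
    qed
    have R0: "R {} g = 0" for g
    proof -
      obtain \<nu> where "\<forall>B\<in>sets borel. cinner g (R B g) = of_real (measure \<nu> B)" using meas[of g] by blast
      then have "cinner g (R {} g) = 0" by (metis sets.empty_sets measure_empty of_real_0)
      then have "cinner (R {} g) (R {} g) = 0"
        using symmetric_opD[OF R(1), of "{}" g "R {} g"] R(3)[of "{}" g] by simp
      then show ?thesis by (simp add: cinner_self)
    qed
    have ab: "inner ?a ?b = 0"
    proof -
      have "{c<..} \<inter> {..c} = {}" by auto
      then have "R {c<..} ?b = 0" using R_Int[OF B B', of f] R0[of f] by simp
      then show ?thesis using symmetric_op_inner[OF R(1)[OF B], of f ?b] by simp
    qed
    have fab: "f = ?a + ?b"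
    proof -
      have "measure \<mu> UNIV = measure \<mu> {c<..} + measure \<mu> {..c}"
      proof -
        have "UNIV = {c<..} \<union> {..c}" "{c<..} \<inter> {..c} = {}" by auto
        then show ?thesis using finite_measure_Union[of "{c<..}" "{..c}"] \<mu>(2) by simp
      qed
      moreover have "R UNIV f = f"
      proof -
        have "opr_of (R UNIV) = opr_of (\<lambda>f. f)"
          using E R(2)[of UNIV] unfolding is_spectral_measure_def opr_of_id by simp
        then show ?thesis using opr_of_inject[OF R(1) symmetric_op_id] by (metis sets.top space_borel)
      qed
      moreover have "inner (f - ?a - ?b) (f - ?a - ?b) = inner f f + inner ?a ?a + inner ?b ?b
          - 2 * inner f ?a - 2 * inner f ?b + 2 * inner ?a ?b"
        using inner_commute[of ?a f] inner_commute[of ?b f] inner_commute[of ?b ?a]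
        by (simp add: inner_diff_left inner_diff_right)
      ultimately have "inner (f - ?a - ?b) (f - ?a - ?b) = 0"
        using norm_R[OF B] norm_R[OF B'] norm_R(2)[of UNIV] ab by simp
      then have "f - ?a - ?b = 0" by (simp only: inner_eq_zero_iff)
      then show ?thesis by (simp add: algebra_simps)
    qed
    have Ta: "inner ?a (T ?a) = (\<integral>t. indicator {c<..} t * t \<partial>\<mu>)"
      and Tb: "inner ?b (T ?b) = (\<integral>t. indicator {..c} t * t \<partial>\<mu>)"
      unfolding Re_cinner[symmetric] part[OF B \<mu>(1-3)] part[OF B' \<mu>(1-3)] by simp_all
    \<comment> \<open>The definition of a spectral measure prescribes quadratic forms only, so
      commutation of \<open>T\<close> with the projections is not at hand. Comparing this splitting
      of the integral with the bilinear expansion below shows that the cross term vanishes.\<close>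
    have "inner f (T f) = inner ?a (T ?a) + inner ?b (T ?b)"
    proof -
      have "inner f (T f) = (\<integral>t. t \<partial>\<mu>)" unfolding Re_cinner[symmetric] \<mu>(5) by simp
      also have "\<dots> = (\<integral>t. indicator {c<..} t * t + indicator {..c} t * t \<partial>\<mu>)"
        by (rule Bochner_Integration.integral_cong) (auto simp: indicator_def)
      also have "\<dots> = (\<integral>t. indicator {c<..} t * t \<partial>\<mu>) + (\<integral>t. indicator {..c} t * t \<partial>\<mu>)"
        using integrable_mult_indicator[OF _ \<mu>(4), of "{c<..}"] integrable_mult_indicator[OF _ \<mu>(4), of "{..c}"] \<mu>(2)
        by (intro Bochner_Integration.integral_add) auto
      finally show ?thesis unfolding Ta Tb .
    qed
    moreover have Tf: "T f = T ?a + T ?b" by (subst fab) (rule symmetric_op_add[OF T])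
    moreover have "inner f (T f) = inner ?a (T ?a) + inner ?b (T ?b) + 2 * inner ?a (T ?b)"
    proof -
      have "inner f (T f) = inner (?a + ?b) (T ?a + T ?b)" using fab Tf by metis
      then show ?thesis
        using symmetric_op_inner[OF T, of ?a ?b] inner_commute[of "T ?a" ?b]
        by (simp add: inner_add_left inner_add_right)
    qed
    ultimately have Tab: "inner ?a (T ?b) = 0" by linarith
    have "l *\<^sub>R f = T ?a + T ?b" using eig Tf by simp
    then have lf: "T ?a + T ?b = l *\<^sub>R (?a + ?b)" using fab by metis
    have "inner ?a (T ?a + T ?b) = l * inner ?a ?a"
      unfolding lf by (simp add: inner_add_right ab)
    then have la: "inner ?a (T ?a) = l * inner ?a ?a" using Tab by (simp add: inner_add_right)
    have "inner ?b (T ?a + T ?b) = l * inner ?b ?b"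
      unfolding lf using inner_commute[of ?b ?a] by (simp add: inner_add_right ab)
    then have lb: "inner ?b (T ?b) = l * inner ?b ?b"
      using Tab symmetric_op_inner[OF T, of ?b ?a] inner_commute[of "T ?b" ?a] by (simp add: inner_add_right)
    show ?thesis
    proof (cases "l > c")
      case True
      have "l * measure \<mu> {..c} \<le> c * measure \<mu> {..c}"
        using integral_indicator_le[OF \<mu>(1,2,4), of c] lb Tb norm_R(1)[OF B'] by simp
      then have "(l - c) * measure \<mu> {..c} \<le> 0" by (simp add: algebra_simps)
      then have "measure \<mu> {..c} \<le> 0" using True by (simp add: mult_le_0_iff)
      then have "inner ?b ?b = 0" using norm_R(1)[OF B'] measure_nonneg[of \<mu> "{..c}"] by linarith
      then have "?b = 0" by simp
      then show ?thesis using True fab by simp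
    next
      case False
      have "\<not> measure \<mu> {c<..} > 0"
      proof
        assume pos: "measure \<mu> {c<..} > 0"
        have "c * measure \<mu> {c<..} < l * measure \<mu> {c<..}"
          using integral_indicator_pos[OF \<mu>(1,2,4) pos] la Ta norm_R(1)[OF B] by simp
        then show False using pos False by simp
      qed
      then have "inner ?a ?a = 0" using norm_R(1)[OF B] measure_nonneg[of \<mu> "{c<..}"] by linarith
      then show ?thesis using False by simp
    qed
  qed
  then show thesis using that[of "R {c<..}"] R(1,2)[OF B] by blast
qed

subsection \<open>Traces against an orthonormal family\<close>

lemma has_sum_nth_squares_family:
  assumes "orthonormal_family S e"
  shows "(\<lambda>a. (cmod (nth_ell2 (e a) x))\<^sup>2) summable_on S"
    and "(\<Sum>\<^sub>\<infinity>a\<in>S. (cmod (nth_ell2 (e a) x))\<^sup>2) \<le> 1"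
proof -
  have eq: "cmod (cinner (e a) (delta x)) = cmod (nth_ell2 (e a) x)" for a by simp
  show s: "(\<lambda>a. (cmod (nth_ell2 (e a) x))\<^sup>2) summable_on S"
    using bessel_summable[OF assms, of "delta x"] unfolding eq .
  show "(\<Sum>\<^sub>\<infinity>a\<in>S. (cmod (nth_ell2 (e a) x))\<^sup>2) \<le> 1"
    by (rule infsum_le_finite_sums[OF s])
      (use bessel[OF assms, where f = "delta x"] in \<open>simp add: eq\<close>)
qed

text \<open>A product is at most the sum of the two squares, and each sum of squares is at most 1 by
  Bessel's inequality for a unit vector; hence the constant 2.\<close>

lemma summable_nth_products_family:
  assumes "orthonormal_family S e"
  shows "(\<lambda>a. cmod (cnj (nth_ell2 (e a) x) * nth_ell2 (e a) y)) summable_on S"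
    and "(\<Sum>\<^sub>\<infinity>a\<in>S. cmod (cnj (nth_ell2 (e a) x) * nth_ell2 (e a) y)) \<le> 2"
proof -
  note sq = has_sum_nth_squares_family[OF assms]
  have le: "cmod (cnj (nth_ell2 (e a) x) * nth_ell2 (e a) y)
      \<le> (cmod (nth_ell2 (e a) x))\<^sup>2 + (cmod (nth_ell2 (e a) y))\<^sup>2" for a
    using cmod_mult_le_squares[of "cnj (nth_ell2 (e a) x)" "nth_ell2 (e a) y"] by simp
  have s: "(\<lambda>a. (cmod (nth_ell2 (e a) x))\<^sup>2 + (cmod (nth_ell2 (e a) y))\<^sup>2) summable_on S"
    by (intro summable_on_add sq)
  show 1: "(\<lambda>a. cmod (cnj (nth_ell2 (e a) x) * nth_ell2 (e a) y)) summable_on S"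
    by (rule summable_on_comparison_test[OF s le]) simp
  have "(\<Sum>\<^sub>\<infinity>a\<in>S. cmod (cnj (nth_ell2 (e a) x) * nth_ell2 (e a) y))
      \<le> (\<Sum>\<^sub>\<infinity>a\<in>S. (cmod (nth_ell2 (e a) x))\<^sup>2 + (cmod (nth_ell2 (e a) y))\<^sup>2)"
    by (rule infsum_mono[OF 1 s le])
  also have "\<dots> = (\<Sum>\<^sub>\<infinity>a\<in>S. (cmod (nth_ell2 (e a) x))\<^sup>2) + (\<Sum>\<^sub>\<infinity>a\<in>S. (cmod (nth_ell2 (e a) y))\<^sup>2)"
    by (intro infsum_add sq)
  also have "\<dots> \<le> 1 + 1" by (intro add_mono sq)
  finally show "(\<Sum>\<^sub>\<infinity>a\<in>S. cmod (cnj (nth_ell2 (e a) x) * nth_ell2 (e a) y)) \<le> 2" by simp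
qed

definition kernel_form :: "('i \<Rightarrow> 'i \<Rightarrow> complex) \<Rightarrow> 'i ell2 \<Rightarrow> complex" where
  "kernel_form K f = (\<Sum>\<^sub>\<infinity>(x, y). K x y * (cnj (nth_ell2 f x) * nth_ell2 f y))"

lemma kernel_form_entry:
  assumes "symmetric_op A" "summable_kernel (entry A)"
  shows "kernel_form (entry A) f = cinner f (A f)"
  unfolding kernel_form_def by (rule infsumI[OF has_sum_cinner_kernel[OF assms]])

text \<open>A trace computed in two bases. \<open>X\<close> is the transposed matrix of the operator
  with eigenvectors \<open>e a\<close> and eigenvalues \<open>c a\<close>. The interchange is
  Fubini's theorem, absolute convergence coming from the summable kernel and the uniform bound on
  products of coordinates. \<open>X\<close> is prescribed on the support of \<open>K\<close> only,
  because the basis of a truncated system resolves just the unit vectors of the disk.\<close>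

lemma kernel_trace:
  assumes on: "orthonormal_family S e" and K: "summable_kernel K" and c: "\<And>a. a \<in> S \<Longrightarrow> cmod (c a) \<le> B"
    and X: "\<And>x y. K x y \<noteq> 0 \<Longrightarrow> ((\<lambda>a. c a * (cnj (nth_ell2 (e a) x) * nth_ell2 (e a) y)) has_sum X x y) S"
  shows "((\<lambda>a. c a * kernel_form K (e a)) has_sum (\<Sum>\<^sub>\<infinity>(x, y). K x y * X x y)) S"
    and "(\<lambda>a. cmod (c a * kernel_form K (e a))) summable_on S"
proof -
  define t where "t z a = K (fst z) (snd z) * (c a * (cnj (nth_ell2 (e a) (fst z)) * nth_ell2 (e a) (snd z)))" for z a
  have B: "B \<ge> 0" if "a \<in> S" for a using c[OF that] norm_ge_zero order_trans by blast
  let ?p = "\<lambda>z a. cmod (cnj (nth_ell2 (e a) (fst z)) * nth_ell2 (e a) (snd z))"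
  note prod = summable_nth_products_family[OF on]
  have le: "cmod (t z a) \<le> (cmod (K (fst z) (snd z)) * \<bar>B\<bar>) * ?p z a" if "a \<in> S" for z a
  proof -
    have "cmod (t z a) = cmod (K (fst z) (snd z)) * (cmod (c a) * ?p z a)"
      unfolding t_def norm_mult by simp
    also have "\<dots> \<le> cmod (K (fst z) (snd z)) * (\<bar>B\<bar> * ?p z a)"
      using c[OF that] B[OF that] by (intro mult_left_mono mult_right_mono) auto
    finally show ?thesis by (simp only: mult.assoc)
  qed
  have sum1: "(\<lambda>(z, a). t z a) summable_on UNIV \<times> S"
  proof (rule summable_on_Sigma_normI)
    fix z
    have s: "(\<lambda>a. (cmod (K (fst z) (snd z)) * \<bar>B\<bar>) * ?p z a) summable_on S"
      by (intro summable_on_cmult_right prod)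
    show 1: "(\<lambda>a. cmod (t z a)) summable_on S"
      by (rule summable_on_comparison_test[OF s le]) auto
    have "(\<Sum>\<^sub>\<infinity>a\<in>S. cmod (t z a)) \<le> (\<Sum>\<^sub>\<infinity>a\<in>S. (cmod (K (fst z) (snd z)) * \<bar>B\<bar>) * ?p z a)"
      by (rule infsum_mono[OF 1 s le])
    also have "\<dots> = (cmod (K (fst z) (snd z)) * \<bar>B\<bar>) * (\<Sum>\<^sub>\<infinity>a\<in>S. ?p z a)"
      by (rule infsum_cmult_right) (rule prod)
    also have "\<dots> \<le> (cmod (K (fst z) (snd z)) * \<bar>B\<bar>) * 2"
      by (intro mult_left_mono prod) simp
    finally show "(\<Sum>\<^sub>\<infinity>a\<in>S. cmod (t z a)) \<le> (\<bar>B\<bar> * 2) * (case z of (x, y) \<Rightarrow> cmod (K x y))"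
      by (simp add: case_prod_unfold mult_ac)
    show "(\<lambda>z. (\<bar>B\<bar> * 2) * (case z of (x, y) \<Rightarrow> cmod (K x y))) summable_on UNIV"
      using K unfolding summable_kernel_def by (rule summable_on_cmult_right)
  qed
  have sum2: "(\<lambda>(a, z). t z a) summable_on S \<times> UNIV"
    using sum1 summable_on_swap[of "\<lambda>(z, a). t z a" UNIV S] by (simp add: case_prod_unfold)
  have row: "(\<Sum>\<^sub>\<infinity>z. t z a) = c a * kernel_form K (e a)" for a
  proof -
    have "(\<Sum>\<^sub>\<infinity>z. t z a) = (\<Sum>\<^sub>\<infinity>z. c a * (case z of (x, y) \<Rightarrow> K x y * (cnj (nth_ell2 (e a) x) * nth_ell2 (e a) y)))"
      by (rule infsum_cong) (simp add: t_def case_prod_unfold mult_ac)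
    then show ?thesis unfolding kernel_form_def infsum_cmult_right' .
  qed
  have col: "(\<Sum>\<^sub>\<infinity>a\<in>S. t z a) = (case z of (x, y) \<Rightarrow> K x y * X x y)" for z
  proof (cases "K (fst z) (snd z) = 0")
    case False
    from has_sum_cmult_right[OF X[OF False], of "K (fst z) (snd z)"]
    show ?thesis unfolding t_def by (intro infsumI) (simp add: case_prod_unfold)
  qed (simp add: t_def case_prod_unfold)
  have "(\<Sum>\<^sub>\<infinity>a\<in>S. \<Sum>\<^sub>\<infinity>z. t z a) = (\<Sum>\<^sub>\<infinity>z. \<Sum>\<^sub>\<infinity>a\<in>S. t z a)"
    by (rule infsum_swap_banach[OF sum2])
  then have eq: "(\<Sum>\<^sub>\<infinity>a\<in>S. c a * kernel_form K (e a)) = (\<Sum>\<^sub>\<infinity>(x, y). K x y * X x y)"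
    unfolding row col .
  have s: "(\<lambda>a. c a * kernel_form K (e a)) summable_on S"
    using summable_on_Sigma_banach[OF sum2] unfolding row .
  show "((\<lambda>a. c a * kernel_form K (e a)) has_sum (\<Sum>\<^sub>\<infinity>(x, y). K x y * X x y)) S"
    unfolding eq[symmetric] by (rule has_sum_infsum[OF s])
  show "(\<lambda>a. cmod (c a * kernel_form K (e a))) summable_on S"
    using s by (simp only: summable_on_iff_abs_summable_on_complex)
qed

lemma bounded_linear_funpow:
  fixes T :: "'a :: real_normed_vector \<Rightarrow> 'a"
  assumes "bounded_linear T"
  shows "bounded_linear (T ^^ m)"
proof (induction m)
  case 0
  show ?case using bounded_linear_ident by (simp add: id_def)
next
  case (Suc m)
  show ?case using bounded_linear_compose[OF assms Suc] by (simp add: comp_def)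
qed

lemma funpow_eigenvector:
  assumes T: "symmetric_op T" and "T f = q *\<^sub>R f"
  shows "(T ^^ m) (c *\<^sub>c f) = (of_real (q ^ m) * c) *\<^sub>c f"
  by (induction m)
    (simp_all add: symmetric_op_scaleC[OF T] assms(2) scaleR_scaleC mult_ac)

text \<open>Expand \<open>delta x\<close> in the family and apply the power termwise. Completeness
  is asked at \<open>x\<close> alone, so that the full space and a disk are both covered.\<close>

lemma has_sum_funpow_entry:
  assumes T: "symmetric_op T" and on: "orthonormal_family S e"
    and q: "\<And>a. a \<in> S \<Longrightarrow> T (e a) = q a *\<^sub>R e a" and x: "span_proj S e (delta x) = delta x"
  shows "((\<lambda>a. of_real (q a ^ m) * (cnj (nth_ell2 (e a) x) * nth_ell2 (e a) y))
    has_sum nth_ell2 ((T ^^ m) (delta x)) y) S"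
proof -
  have bl: "bounded_linear (\<lambda>f. nth_ell2 ((T ^^ m) f) y)"
    by (rule bounded_linear_compose[OF bounded_linear_nth
        bounded_linear_funpow[OF bounded_linear_symmetric_op[OF T]]])
  have "((\<lambda>a. nth_ell2 ((T ^^ m) (cinner (e a) (delta x) *\<^sub>c e a)) y)
      has_sum nth_ell2 ((T ^^ m) (delta x)) y) S"
    by (rule has_sum_bounded_linear[OF bl]) (use has_sum_span_proj[OF on, of "delta x"] x in simp)
  moreover have "nth_ell2 ((T ^^ m) (cinner (e a) (delta x) *\<^sub>c e a)) y =
      of_real (q a ^ m) * (cnj (nth_ell2 (e a) x) * nth_ell2 (e a) y)" if "a \<in> S" for a
    by (simp add: funpow_eigenvector[where T = T and q = "q a", OF T q[OF that]] mult_ac)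
  ultimately show ?thesis by (simp cong: has_sum_cong)
qed

text \<open>The difference between the operator and its flattening is diagonal in the eigenbasis,
  with summable eigenvalues, so the diagonal sum over lattice unit vectors may be exchanged with the
  sum over eigenvectors.\<close>

lemma vertex_trace_opr_of:
  fixes T :: "(site \<times> 'n::finite) ell2 \<Rightarrow> (site \<times> 'n) ell2"
  assumes T: "symmetric_op T" and S: "orthonormal_basis S e"
    and q: "\<And>a. a \<in> S \<Longrightarrow> T (e a) = q a *\<^sub>R e a"
    and sum: "(\<lambda>a. \<bar>(q a)\<^sup>2 - q a\<bar>) summable_on S"
  shows "((\<lambda>a. q a - (if q a > 1/2 then 1 else 0)) has_sum vertex_trace (opr_of T)) S"
proof -
  have on: "orthonormal_family S e" by (rule orthonormal_basis_family[OF S])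
  define g where "g t = t - (if t > 1/2 then 1 else 0)" for t :: real
  \<comment> \<open>\<open>g t\<close> is one of the factors of
    \<open>t^2 - t = t * (t - 1)\<close>, and on the respective side of 1/2 the other factor has
    modulus at least 1/2.\<close>
  have g_le: "\<bar>g t\<bar> \<le> 2 * \<bar>t\<^sup>2 - t\<bar>" for t
  proof (cases "t > 1/2")
    case True
    have "\<bar>t\<^sup>2 - t\<bar> = t * \<bar>t - 1\<bar>"
      using True abs_mult[of t "t - 1"] by (simp add: power2_eq_square right_diff_distrib)
    moreover have "1 * \<bar>t - 1\<bar> \<le> (2 * t) * \<bar>t - 1\<bar>" using True by (intro mult_right_mono) auto
    ultimately show ?thesis using True by (simp add: g_def)
  next
    case False
    have "\<bar>t\<^sup>2 - t\<bar> = \<bar>t\<bar> * (1 - t)" using False abs_mult[of t "1 - t"]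
      by (simp add: power2_eq_square algebra_simps abs_minus_commute)
    moreover have "\<bar>t\<bar> * 1 \<le> \<bar>t\<bar> * (2 * (1 - t))" using False by (intro mult_left_mono) auto
    ultimately have "\<bar>t\<bar> \<le> 2 * \<bar>t\<^sup>2 - t\<bar>" by (simp only: mult_1_right mult.left_commute[of 2])
    then show ?thesis using False by (simp add: g_def)
  qed
  have g_sum: "(\<lambda>a. \<bar>g (q a)\<bar>) summable_on S"
    by (rule summable_on_comparison_test[OF summable_on_cmult_right[OF sum, of 2] g_le]) simp
  have "is_spectral_measure (opr_of T) (\<lambda>B. opr_of (span_proj {a\<in>S. q a \<in> B} e))"
    by (rule is_spectral_measure_eigenbasis[OF T S q])
  then have "is_spectral_measure (opr_of T) (spectral_measure (opr_of T))"
    unfolding spectral_measure_def by (rule someI[of "is_spectral_measure (opr_of T)"])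
  then obtain R where R: "symmetric_op R" "spectral_measure (opr_of T) {1/2<..} = opr_of R"
    "\<And>f l. T f = l *\<^sub>R f \<Longrightarrow> R f = (if l > 1/2 then f else 0)"
    using spectral_projection_eigenvector[OF T, where c = "1/2"] by (metis (no_types, lifting))
  define G where "G f = T f - R f" for f
  have G: "symmetric_op G" unfolding G_def by (rule symmetric_op_minus[OF T R(1)])
  have Ge: "G (e a) = g (q a) *\<^sub>R e a" if "a \<in> S" for a
    unfolding G_def using q[OF that] R(3)[OF q[OF that]] by (simp add: g_def algebra_simps)
  have eq: "opr_of T - spectral_flattening (opr_of T) = opr_of G"
    unfolding spectral_flattening_def R(2) by (simp add: opr_eq_iff entry_def G_def)
  let ?t = "\<lambda>a z. g (q a) * (cmod (nth_ell2 (e a) z))\<^sup>2"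
  have diag: "((\<lambda>a. complex_of_real (?t a z)) has_sum entry G z z) S" for z
  proof -
    have "((\<lambda>a. nth_ell2 ((of_real (g (q a)) * cinner (e a) (delta z)) *\<^sub>c e a) z) has_sum nth_ell2 (G (delta z)) z) S"
      by (rule has_sum_bounded_linear[OF bounded_linear_nth has_sum_eigen_expansion[OF S G Ge]])
    moreover have "nth_ell2 ((of_real (g (q a)) * cinner (e a) (delta z)) *\<^sub>c e a) z = complex_of_real (?t a z)" for a
      unfolding of_real_mult complex_norm_square by (simp add: mult_ac)
    ultimately show ?thesis unfolding entry_def by (simp only:)
  qed
  have sum_az: "(\<lambda>(a, z). ?t a z) summable_on S \<times> UNIV"
  proof (rule summable_on_Sigma_normI)
    fix a assume a: "a \<in> S"
    have hs: "((\<lambda>z. norm (?t a z)) has_sum \<bar>g (q a)\<bar> * 1) UNIV"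
      using has_sum_cmult_right[OF has_sum_norm_square[of "e a"], of "\<bar>g (q a)\<bar>"] norm_orthonormal[OF on a]
      by (simp add: abs_mult)
    then show "(\<lambda>z. norm (?t a z)) summable_on UNIV" unfolding summable_on_def by blast
    show "(\<Sum>\<^sub>\<infinity>z. norm (?t a z)) \<le> \<bar>g (q a)\<bar>" using infsumI[OF hs] by simp
  qed (rule g_sum)
  then have sum_za: "(\<lambda>(z, a). ?t a z) summable_on UNIV \<times> S"
    using summable_on_swap[of "\<lambda>(a, z). ?t a z" S UNIV] by (simp add: case_prod_unfold)
  have row: "((\<lambda>z. ?t a z) has_sum g (q a)) UNIV" if "a \<in> S" for a
    using has_sum_cmult_right[OF has_sum_norm_square[of "e a"], of "g (q a)"] norm_orthonormal[OF on that] by simp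
  have Re_diag: "((\<lambda>a. ?t a z) has_sum Re (entry G z z)) S" for z
    using has_sum_Re[OF diag[of z]] by simp
  have Im0: "entry G z z = of_real (Re (entry G z z))" for z
    using has_sum_unique[OF diag has_sum_of_real[OF Re_diag]] .
  have "((\<lambda>z. Re (entry G z z)) has_sum (\<Sum>\<^sub>\<infinity>(z, a)\<in>UNIV \<times> S. ?t a z)) UNIV"
    by (rule has_sum_SigmaD[OF has_sum_infsum[OF sum_za]]) (simp add: Re_diag)
  moreover have "(\<Sum>\<^sub>\<infinity>(z, a)\<in>UNIV \<times> S. ?t a z) = (\<Sum>\<^sub>\<infinity>(a, z)\<in>S \<times> UNIV. ?t a z)"
    using has_sum_infsum[OF sum_az] has_sum_swap[where f = "\<lambda>(a, z). ?t a z" and A = S and B = UNIV]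
    by (intro infsumI) (simp add: case_prod_unfold)
  moreover have hs: "((\<lambda>a. g (q a)) has_sum (\<Sum>\<^sub>\<infinity>(a, z)\<in>S \<times> UNIV. ?t a z)) S"
    by (rule has_sum_SigmaD[OF has_sum_infsum[OF sum_az]]) (simp add: row)
  ultimately have "((\<lambda>z. Re (entry G z z)) has_sum (\<Sum>\<^sub>\<infinity>a\<in>S. g (q a))) UNIV"
    using infsumI[OF hs] by simp
  then have "((\<lambda>z. complex_of_real (Re (entry G z z))) has_sum complex_of_real (\<Sum>\<^sub>\<infinity>a\<in>S. g (q a))) UNIV"
    by (rule has_sum_of_real)
  then have "((\<lambda>z. entry G z z) has_sum complex_of_real (\<Sum>\<^sub>\<infinity>a\<in>S. g (q a))) UNIV"
    unfolding Im0[symmetric] .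
  from infsumI[OF has_sum_blocks[OF this]] have "op_trace (opr_of G) = complex_of_real (\<Sum>\<^sub>\<infinity>a\<in>S. g (q a))"
    by (simp add: op_trace_def trace_def)
  then have "vertex_trace (opr_of T) = (\<Sum>\<^sub>\<infinity>a\<in>S. g (q a))" by (simp add: vertex_trace_def eq)
  then show ?thesis using hs infsumI[OF hs] by (simp add: g_def)
qed

subsection \<open>Kramers degeneracy\<close>

text \<open>Eliminating a pair of indices by a Schur complement keeps the matrix antisymmetric and nonsingular.\<close>

lemma even_card_antisymmetric_nonsingular:
  fixes m :: "'k \<Rightarrow> 'k \<Rightarrow> complex"
  assumes "finite A" "\<And>i j. i \<in> A \<Longrightarrow> j \<in> A \<Longrightarrow> m j i = - m i j"
    and "\<And>x. (\<And>i. i \<in> A \<Longrightarrow> (\<Sum>j\<in>A. m i j * x j) = 0) \<Longrightarrow> \<forall>i\<in>A. x i = 0"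
  shows "even (card A)"
  using assms
proof (induction "card A" arbitrary: A m rule: less_induct)
  case less
  note anti = less.prems(2) and nonsing = less.prems(3)
  have diag: "m i i = 0" if "i \<in> A" for i using anti[OF that that] by simp
  show ?case
  proof (cases "A = {}")
    case False
    then obtain a where a: "a \<in> A" by blast
    \<comment> \<open>A zero row is also a zero column by antisymmetry, and then the unit vector at
      \<open>a\<close> lies in the kernel.\<close>
    have "\<exists>b\<in>A. m a b \<noteq> 0"
    proof (rule ccontr)
      assume "\<not> (\<exists>b\<in>A. m a b \<noteq> 0)"
      then have z: "m i a = 0" if "i \<in> A" for i using that anti[OF a that] by simp
      have "(\<Sum>j\<in>A. m i j * (if j = a then 1 else 0)) = 0" if "i \<in> A" for i
        using z[OF that] by (simp add: if_distrib[of "(*) _"] sum.delta' less.prems(1) a cong: if_cong)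
      then have "\<forall>i\<in>A. (if i = a then 1 else 0 :: complex) = 0" by (rule nonsing)
      then show False using a by auto
    qed
    then obtain b where b: "b \<in> A" "m a b \<noteq> 0" by blast
    have "a \<noteq> b" using b diag[OF a] by auto
    define c where "c = m a b"
    define A' where "A' = A - {a, b}"
    define m' where "m' i j = m i j + (m i a * m b j - m i b * m a j) / c" for i j
    have sum_A: "sum f A = f a + f b + sum f A'" for f :: "'k \<Rightarrow> complex"
    proof -
      have "sum f A = f a + sum f (A - {a})" by (rule sum.remove[OF less.prems(1) a])
      also have "sum f (A - {a}) = f b + sum f (A - {a} - {b})"
        by (rule sum.remove) (use less.prems(1) b \<open>a \<noteq> b\<close> in auto)
      also have "A - {a} - {b} = A'" by (auto simp: A'_def)
      finally show ?thesis by (simp add: add.assoc)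
    qed
    have card_A: "card A = card A' + 2"
    proof -
      have "card {a, b} = 2" using \<open>a \<noteq> b\<close> by simp
      moreover have "card A' = card A - card {a, b}" unfolding A'_def by (rule card_Diff_subset) (use a b in auto)
      moreover have "card {a, b} \<le> card A" by (rule card_mono) (use a b less.prems(1) in auto)
      ultimately show ?thesis by simp
    qed
    have "even (card A')"
    proof (rule less.hyps[of A' m'])
      show "card A' < card A" using card_A by simp
      show "finite A'" using less.prems(1) by (simp add: A'_def)
      fix i j assume "i \<in> A'" "j \<in> A'"
      then have "i \<in> A" "j \<in> A" by (simp_all add: A'_def)
      then have "m j i = - m i j" "m j a = - m a j" "m b i = - m i b" "m j b = - m b j" "m a i = - m i a"
        using anti a b(1) by blast+
      then show "m' j i = - m' i j" using b(2) by (simp add: m'_def c_def field_simps)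
    next
      fix x assume x: "\<And>i. i \<in> A' \<Longrightarrow> (\<Sum>j\<in>A'. m' i j * x j) = 0"
      define r s where rs: "r = (\<Sum>j\<in>A'. m a j * x j)" "s = (\<Sum>j\<in>A'. m b j * x j)"
      \<comment> \<open>The values at \<open>a\<close> and \<open>b\<close> are chosen to solve the
        rows \<open>a\<close> and \<open>b\<close> of the full system; what is left of the other
        rows is the Schur complement applied to \<open>x\<close>.\<close>
      define y where "y j = (if j = a then s / c else if j = b then - r / c else x j)" for j
      have y: "y a = s / c" "y b = - r / c" "\<And>j. j \<in> A' \<Longrightarrow> y j = x j"
        using \<open>a \<noteq> b\<close> by (auto simp: y_def A'_def)
      have row: "(\<Sum>j\<in>A. m i j * y j) = m i a * s / c - m i b * r / c + (\<Sum>j\<in>A'. m i j * x j)" for i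
        unfolding sum_A by (simp add: y cong: sum.cong)
      have c: "c \<noteq> 0" "m b a = - c" using b anti[OF a b(1)] by (simp_all add: c_def)
      have "(\<Sum>j\<in>A. m i j * y j) = 0" if i: "i \<in> A" for i
      proof -
        consider "i = a" | "i = b" | "i \<in> A'" using i by (auto simp: A'_def)
        then show ?thesis
        proof cases
          case 1
          then show ?thesis unfolding row using c diag[OF a] by (simp add: c_def[symmetric] rs)
        next
          case 2
          then show ?thesis unfolding row using c diag[OF b(1)] by (simp add: rs)
        next
          case 3
          have "(\<Sum>j\<in>A'. m' i j * x j) = (\<Sum>j\<in>A'. m i j * x j)
              + (m i a / c * (\<Sum>j\<in>A'. m b j * x j) - m i b / c * (\<Sum>j\<in>A'. m a j * x j))"
            unfolding sum_distrib_left sum_subtractf[symmetric] sum.distrib[symmetric]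
            by (rule sum.cong[OF refl]) (use c in \<open>simp add: m'_def field_simps\<close>)
          then show ?thesis unfolding row using x[OF 3] by (simp add: rs add.commute)
        qed
      qed
      then have "\<forall>i\<in>A. y i = 0" by (rule nonsing)
      then show "\<forall>i\<in>A'. x i = 0" using y(3) by (auto simp: A'_def)
    qed
    then show ?thesis using card_A by simp
  qed simp
qed

text \<open>The matrix of \<open>J\<close> in the basis \<open>e\<close> is antisymmetric, the mark
  of an antiunitary map with square -1, and has orthonormal columns because \<open>J\<close>
  preserves inner products up to conjugation and maps the span into itself. An antisymmetric
  nonsingular matrix has even size.\<close>

lemma even_card_kramers:
  fixes e :: "'k \<Rightarrow> 'i ell2"
  assumes A: "finite A" "orthonormal_family A e"
    and J: "\<And>a b. a \<in> A \<Longrightarrow> b \<in> A \<Longrightarrow> cinner (J (e a)) (J (e b)) = cnj (cinner (e a) (e b))"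
      "\<And>a b. a \<in> A \<Longrightarrow> b \<in> A \<Longrightarrow> cinner (e b) (J (e a)) = - cinner (e a) (J (e b))"
      "\<And>a. a \<in> A \<Longrightarrow> J (e a) = (\<Sum>b\<in>A. cinner (e b) (J (e a)) *\<^sub>c e b)"
  shows "even (card A)"
proof -
  define m where "m a b = cinner (e a) (J (e b))" for a b
  have unitary: "(\<Sum>k\<in>A. cnj (m k i) * m k j) = (if i = j then 1 else 0)" if ij: "i \<in> A" "j \<in> A" for i j
  proof -
    have "cinner (J (e i)) (J (e j)) = (\<Sum>k\<in>A. m k j * cinner (J (e i)) (e k))"
      by (subst J(3)[OF ij(2)]) (simp add: cinner_sum_right m_def)
    also have "\<dots> = (\<Sum>k\<in>A. cnj (m k i) * m k j)"
      by (rule sum.cong[OF refl]) (simp add: m_def cinner_commute[symmetric] mult.commute)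
    finally show ?thesis using J(1)[OF ij] orthonormal_familyD[OF A(2) ij]
      by (cases "i = j") simp_all
  qed
  show ?thesis
  proof (rule even_card_antisymmetric_nonsingular[OF A(1), of m])
    show "m j i = - m i j" if "i \<in> A" "j \<in> A" for i j unfolding m_def by (rule J(2)[OF that])
    fix x assume x: "\<And>i. i \<in> A \<Longrightarrow> (\<Sum>j\<in>A. m i j * x j) = 0"
    show "\<forall>i\<in>A. x i = 0"
    proof
      fix i assume i: "i \<in> A"
      have "0 = (\<Sum>k\<in>A. cnj (m k i) * (\<Sum>j\<in>A. m k j * x j))" using x by simp
      also have "\<dots> = (\<Sum>k\<in>A. \<Sum>j\<in>A. cnj (m k i) * m k j * x j)" by (simp add: sum_distrib_left mult.assoc)
      also have "\<dots> = (\<Sum>j\<in>A. \<Sum>k\<in>A. cnj (m k i) * m k j * x j)" by (rule sum.swap)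
      also have "\<dots> = (\<Sum>j\<in>A. (\<Sum>k\<in>A. cnj (m k i) * m k j) * x j)" by (simp add: sum_distrib_right)
      also have "\<dots> = (\<Sum>j\<in>A. (if i = j then x j else 0))"
        by (rule sum.cong[OF refl]) (simp add: unitary[OF i])
      also have "\<dots> = x i" using A(1) i by simp
      finally show "x i = 0" by simp
    qed
  qed
qed

subsection \<open>Decay of the half-flux operator\<close>

lemma summable_exp_int:
  assumes "c > 0"
  shows "(\<lambda>n :: int. exp (- c * \<bar>of_int n\<bar>) :: real) summable_on UNIV"
proof -
  let ?f = "\<lambda>n :: int. exp (- c * \<bar>of_int n\<bar>) :: real"
  have "summable (\<lambda>n. exp (- c) ^ n :: real)" by (rule summable_geometric) (use assms in simp)
  then have "(\<lambda>n. exp (- c) ^ n :: real) summable_on UNIV"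
    by (rule summable_nonneg_imp_summable_on) simp
  then have nat: "(\<lambda>n :: nat. exp (- c * real n)) summable_on UNIV"
    by (simp add: exp_of_nat_mult[symmetric] mult.commute)
  have "?f summable_on range int"
    by (subst summable_on_reindex) (use nat in \<open>simp_all add: o_def\<close>)
  moreover have "?f summable_on range (\<lambda>n. - int n)"
    by (subst summable_on_reindex) (use nat in \<open>simp_all add: o_def inj_def\<close>)
  moreover have "UNIV = range int \<union> range (\<lambda>n. - int n)"
  proof -
    have "k \<in> range int \<union> range (\<lambda>n. - int n)" for k :: int
      by (cases k rule: int_cases2) auto
    then show ?thesis by blast
  qed
  ultimately show ?thesis using summable_on_union by metis
qed

lemma dist_pos_ge: "dist (pos x) v \<ge> (\<bar>of_int (fst x) - fst v\<bar> + \<bar>of_int (snd x) - snd v\<bar>) / 2"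
proof -
  have "\<bar>of_int (fst x) - fst v\<bar> \<le> dist (pos x) v" "\<bar>of_int (snd x) - snd v\<bar> \<le> dist (pos x) v"
    using dist_fst_le[of "pos x" v] dist_snd_le[of "pos x" v] by (simp_all add: pos_def dist_real_def)
  then show ?thesis by simp
qed

lemma summable_exp_site:
  assumes "c > 0"
  shows "(\<lambda>x. exp (- c * dist (pos x) v)) summable_on UNIV"
proof -
  let ?f = "\<lambda>n :: int. exp (- (c / 2) * \<bar>of_int n\<bar>) :: real"
  have f: "?f summable_on UNIV" by (rule summable_exp_int) (use assms in simp)
  have "(\<lambda>(a, b). ?f a * ?f b) summable_on UNIV \<times> UNIV"
  proof (rule summable_on_SigmaI)
    show "((\<lambda>b. case (a, b) of (a, b) \<Rightarrow> ?f a * ?f b) has_sum ?f a * infsum ?f UNIV) UNIV" for a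
      by (simp only: prod.case) (rule has_sum_cmult_right[OF has_sum_infsum[OF f]])
    show "(\<lambda>a. ?f a * infsum ?f UNIV) summable_on UNIV" by (rule summable_on_cmult_left[OF f])
  qed auto
  then have "(\<lambda>x. exp (c * (\<bar>fst v\<bar> + \<bar>snd v\<bar>) / 2) * (case x of (a, b) \<Rightarrow> ?f a * ?f b)) summable_on UNIV"
    by (intro summable_on_cmult_right) simp
  then show ?thesis
  proof (rule summable_on_comparison_test)
    fix x :: site
    have "(\<bar>real_of_int (fst x)\<bar> + \<bar>of_int (snd x)\<bar> - \<bar>fst v\<bar> - \<bar>snd v\<bar>) / 2 \<le> dist (pos x) v"
      using dist_pos_ge[of x v] by simp
    from mult_left_mono[OF this, of c] have "- c * dist (pos x) v \<le>
        c * (\<bar>fst v\<bar> + \<bar>snd v\<bar>) / 2 + (- (c / 2) * \<bar>of_int (fst x)\<bar> + - (c / 2) * \<bar>of_int (snd x)\<bar>)"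
      using assms by (simp add: algebra_simps diff_divide_distrib add_divide_distrib)
    then show "exp (- c * dist (pos x) v) \<le>
        exp (c * (\<bar>fst v\<bar> + \<bar>snd v\<bar>) / 2) * (case x of (a, b) \<Rightarrow> ?f a * ?f b)"
      by (simp add: case_prod_unfold exp_add[symmetric])
  qed simp
qed

text \<open>Translation invariance of the lattice makes the row sums independent of
  \<open>x\<close>, which yields the uniform bound for the Schur test.\<close>

lemma exp_site_translate:
  assumes "c > 0"
  shows "(\<lambda>y. exp (- c * dist (pos x) (pos y))) summable_on UNIV"
    and "(\<Sum>\<^sub>\<infinity>y. exp (- c * dist (pos x) (pos y))) = (\<Sum>\<^sub>\<infinity>y. exp (- c * dist (pos y) 0))"
proof -
  have bij: "bij_betw (\<lambda>y. y - x) UNIV (UNIV :: site set)"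
    by (rule bij_betwI[of _ _ _ "\<lambda>y. y + x"]) auto
  have eq: "dist (pos x) (pos y) = dist (pos (y - x)) 0" for y
    by (simp add: dist_norm pos_def norm_minus_commute[of "pos x"] minus_prod_def zero_prod_def norm_Pair power2_commute)
  show "(\<lambda>y. exp (- c * dist (pos x) (pos y))) summable_on UNIV"
    unfolding eq using summable_on_reindex_bij_betw[OF bij, of "\<lambda>y. exp (- c * dist (pos y) 0)"]
      summable_exp_site[OF assms, of 0] by simp
  show "(\<Sum>\<^sub>\<infinity>y. exp (- c * dist (pos x) (pos y))) = (\<Sum>\<^sub>\<infinity>y. exp (- c * dist (pos y) 0))"
    unfolding eq by (rule infsum_reindex_bij_betw[OF bij])
qed

lemma summable_on_fst:
  fixes f :: "'a \<Rightarrow> real"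
  assumes "f summable_on UNIV" "\<And>x. f x \<ge> 0"
  shows "(\<lambda>z :: 'a \<times> 'n::finite. f (fst z)) summable_on UNIV"
    and "(\<Sum>\<^sub>\<infinity>z :: 'a \<times> 'n. f (fst z)) = real CARD('n) * infsum f UNIV"
proof -
  show s: "(\<lambda>z :: 'a \<times> 'n::finite. f (fst z)) summable_on UNIV"
    by (subst summable_on_blocks) (use assms in \<open>auto intro!: summable_on_cmult_right\<close>)
  show "(\<Sum>\<^sub>\<infinity>z :: 'a \<times> 'n. f (fst z)) = real CARD('n) * infsum f UNIV"
    using infsumI[OF has_sum_blocks[OF has_sum_infsum[OF s]]] by (simp add: infsum_cmult_right')
qed

lemma finite_disk: "finite (disk v r)"
  and card_disk_le: "r > 0 \<Longrightarrow> real (card (disk v r)) \<le> (2 * (r + \<bar>fst v\<bar> + \<bar>snd v\<bar>) + 3)\<^sup>2"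
proof -
  define n where "n = \<lceil>r + \<bar>fst v\<bar> + \<bar>snd v\<bar>\<rceil>"
  have sub: "disk v r \<subseteq> {-n..n} \<times> {-n..n}"
  proof
    fix x assume "x \<in> disk v r"
    then have "dist (pos x) v < r" by (simp add: disk_def)
    then have "\<bar>real_of_int (fst x) - fst v\<bar> < r" "\<bar>real_of_int (snd x) - snd v\<bar> < r"
      using dist_fst_le[of "pos x" v] dist_snd_le[of "pos x" v] by (simp_all add: pos_def dist_real_def)
    then have "\<bar>real_of_int (fst x)\<bar> \<le> of_int n" "\<bar>real_of_int (snd x)\<bar> \<le> of_int n"
      using le_of_int_ceiling[of "r + \<bar>fst v\<bar> + \<bar>snd v\<bar>"] unfolding n_def by linarith+
    then have "\<bar>fst x\<bar> \<le> n" "\<bar>snd x\<bar> \<le> n" by (simp_all only: of_int_abs[symmetric] of_int_le_iff)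
    then show "x \<in> {-n..n} \<times> {-n..n}" by (cases x) auto
  qed
  then show "finite (disk v r)" by (rule finite_subset) simp
  assume r: "r > 0"
  have "card (disk v r) \<le> card ({-n..n} \<times> {-n..n})" by (rule card_mono[OF _ sub]) simp
  also have "\<dots> = (nat (2 * n + 1))\<^sup>2" by (simp add: card_cartesian_product power2_eq_square)
  finally have "real (card (disk v r)) \<le> real ((nat (2 * n + 1))\<^sup>2)" by (simp only: of_nat_le_iff)
  also have "\<dots> = (of_int (2 * n + 1))\<^sup>2"
  proof -
    have "n \<ge> 0" unfolding n_def using r by simp
    then show ?thesis by simp
  qed
  also have "\<dots> \<le> (2 * (r + \<bar>fst v\<bar> + \<bar>snd v\<bar>) + 3)\<^sup>2"
  proof (rule power_mono)
    have "n \<ge> 0" unfolding n_def using r by simp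
    then show "0 \<le> real_of_int (2 * n + 1)" by simp
    have "of_int n \<le> r + \<bar>fst v\<bar> + \<bar>snd v\<bar> + 1"
      unfolding n_def using of_int_ceiling_le_add_one[of "r + \<bar>fst v\<bar> + \<bar>snd v\<bar>"] by simp
    then show "real_of_int (2 * n + 1) \<le> 2 * (r + \<bar>fst v\<bar> + \<bar>snd v\<bar>) + 3" by simp
  qed
  finally show "real (card (disk v r)) \<le> (2 * (r + \<bar>fst v\<bar> + \<bar>snd v\<bar>) + 3)\<^sup>2" .
qed

text \<open>Disks exhaust the lattice, so unordered sums may be evaluated as limits along growing
  disks.\<close>

lemma filterlim_disk_blocks:
  "filterlim (\<lambda>r. disk v r \<times> (UNIV :: 'n::finite set)) (finite_subsets_at_top UNIV) at_top"
  unfolding filterlim_iff eventually_finite_subsets_at_top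
proof (intro allI impI, elim exE conjE)
  fix P and X :: "(site \<times> 'n) set"
  assume X: "finite X" "\<forall>Y. finite Y \<and> X \<subseteq> Y \<and> Y \<subseteq> UNIV \<longrightarrow> P Y"
  define B where "B = Max (insert 0 ((\<lambda>z. dist (pos (fst z)) v) ` X))"
  have "X \<subseteq> disk v r \<times> UNIV" if "r > B" for r
  proof
    fix z assume "z \<in> X"
    then have "dist (pos (fst z)) v \<le> B" unfolding B_def using X(1) by (intro Max_ge) auto
    then show "z \<in> disk v r \<times> UNIV" using that by (cases z) (simp add: disk_def)
  qed
  moreover have "finite (disk v r \<times> (UNIV :: 'n set))" for r using finite_disk by (rule finite_cartesian_product) simp
  ultimately have *: "P (disk v r \<times> UNIV)" if "r > B" for r
    using X(2)[rule_format, of "disk v r \<times> UNIV"] that by simp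
  show "\<forall>\<^sub>F r in at_top. P (disk v r \<times> UNIV)"
    by (rule eventually_mono[OF eventually_gt_at_top[of B]]) (rule *)
qed

section \<open>Signs, triangles and the kernel of \<open>Q^2 - Q\<close>\<close>

lemma flux_sign_square [simp]: "flux_sign l x y * flux_sign l x y = 1"
  by (simp add: flux_sign_def flip: power_add)

lemma abs_flux_sign [simp]: "\<bar>flux_sign l x y\<bar> = 1"
  by (simp add: flux_sign_def power_abs)

lemma flux_sign3_cases: "flux_sign3 l x y z = 1 \<or> flux_sign3 l x y z = - 1"
proof -
  have "\<bar>flux_sign3 l x y z\<bar> = 1" by (simp add: flux_sign3_def abs_mult)
  then show ?thesis by linarith
qed

text \<open>From any corner, the triangle lies in the ball whose radius is the longest side, hence
  within \<open>dist a c + dist c b\<close>. Adding the three corners produces the factor 3, and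
  with it the rate \<open>C2 / 3\<close> of \<open>weight\<close>.\<close>

lemma triangle_sides_ge:
  fixes v :: "real \<times> real"
  assumes "v \<in> convex hull {a, b, c}"
  shows "dist a v + dist b v + dist c v \<le> 3 * (dist a c + dist c b)"
proof -
  have far: "dist p v \<le> R" if "dist p a \<le> R" "dist p b \<le> R" "dist p c \<le> R" for p R
  proof -
    have "convex hull {a, b, c} \<subseteq> cball p R" by (rule hull_minimal) (use that in auto)
    then show ?thesis using assms by auto
  qed
  have ab: "dist a b \<le> dist a c + dist c b" by (rule dist_triangle)
  have nonneg: "dist a c \<ge> 0" "dist c b \<ge> 0" by simp_all
  have "dist a v \<le> dist a c + dist c b" by (rule far) (use ab nonneg in simp_all)
  moreover have "dist b v \<le> dist a c + dist c b"
    by (rule far) (use ab nonneg in \<open>simp_all add: dist_commute\<close>)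
  moreover have "dist c v \<le> dist a c + dist c b"
    by (rule far) (use nonneg in \<open>simp_all add: dist_commute\<close>)
  ultimately show ?thesis by simp
qed

locale half_flux_model =
  fixes P :: "'n::finite opr" and vert :: "real \<times> real" and l :: "nat \<Rightarrow> real \<Rightarrow> real \<times> real"
    and C1 C2 :: real
  assumes proj: "orthogonal_projection P" and C2_pos: "C2 > 0"
    and decay: "\<And>x y. norm (P x y) < C1 * exp (- C2 * dist (pos x) (pos y))"
    and curves: "boundary_curves vert l" and generic: "generic_position vert l"
begin

definition P_entry :: "site \<times> 'n \<Rightarrow> site \<times> 'n \<Rightarrow> complex" where
  "P_entry z w = P (fst z) (fst w) $ snd z $ snd w"

definition weight :: "site \<times> 'n \<Rightarrow> real" where
  "weight z = exp (- (C2 / 3) * dist (pos (fst z)) vert)"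

text \<open>The contribution of the intermediate state \<open>u\<close> to the entry
  \<open>(z, w)\<close> of \<open>Q^2 - Q\<close>. By \<open>P^2 = P\<close> and the identity that
  the signs of \<open>zu\<close> and \<open>uw\<close> multiply to the sign of \<open>zw\<close>
  times that of the triangle, it is the sign of \<open>zw\<close> times (triangle sign minus 1)
  times the product of \<open>P\<close> entries: zero or a factor -2.\<close>

definition V_term :: "site \<times> 'n \<Rightarrow> site \<times> 'n \<Rightarrow> site \<times> 'n \<Rightarrow> complex" where
  "V_term z w u = (if flux_sign3 l (fst z) (fst w) (fst u) = - 1
     then of_real (- 2 * flux_sign l (fst z) (fst w)) * (P_entry z u * P_entry u w) else 0)"

definition V_limit :: "site \<times> 'n \<Rightarrow> site \<times> 'n \<Rightarrow> complex" where
  "V_limit z w = (\<Sum>\<^sub>\<infinity>u. V_term z w u)"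

definition V_trunc :: "real \<Rightarrow> site \<times> 'n \<Rightarrow> site \<times> 'n \<Rightarrow> complex" where
  "V_trunc r z w = truncV vert l P r (fst z) (fst w) $ snd z $ snd w"

text \<open>A single majorant, of product form, for the limiting kernel and for the truncated
  kernels at all radii; this is what dominated convergence in \<open>r\<close> calls for.\<close>

definition V_bound :: "site \<times> 'n \<Rightarrow> site \<times> 'n \<Rightarrow> real" where
  "V_bound z w = (2 * C1\<^sup>2 * infsum weight UNIV) * (weight z * weight w)"

lemma C1_pos: "C1 > 0"
proof -
  have "0 < C1 * exp (- C2 * dist (pos (0, 0)) (pos (0, 0)))" using decay norm_ge_zero le_less_trans by blast
  then show ?thesis by simp
qed

lemma P_entry_le: "cmod (P_entry z w) \<le> C1 * exp (- C2 * dist (pos (fst z)) (pos (fst w)))"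
proof -
  have "cmod (P_entry z w) \<le> norm (P (fst z) (fst w) $ snd z)"
    unfolding P_entry_def by (rule Finite_Cartesian_Product.norm_nth_le)
  also have "\<dots> \<le> norm (P (fst z) (fst w))" by (rule Finite_Cartesian_Product.norm_nth_le)
  also have "\<dots> \<le> C1 * exp (- C2 * dist (pos (fst z)) (pos (fst w)))" using decay less_imp_le by blast
  finally show ?thesis .
qed

lemma weight_pos: "weight z > 0"
  by (simp add: weight_def)

lemma summable_weight: "weight summable_on UNIV"
proof -
  have "(\<lambda>x. exp (- (C2 / 3) * dist (pos x) vert)) summable_on UNIV"
    by (rule summable_exp_site) (use C2_pos in simp)
  from summable_on_fst(1)[OF this] show ?thesis by (simp add: weight_def[abs_def])
qed

lemma V_term_le: "cmod (V_term z w u) \<le> (2 * C1\<^sup>2 * (weight z * weight w)) * weight u"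
proof (cases "flux_sign3 l (fst z) (fst w) (fst u) = - 1")
  case True
  let ?d = "\<lambda>a b. dist (pos (fst a)) (pos (fst b))"
  have "vert \<in> convex hull {pos (fst z), pos (fst w), pos (fst u)}"
    using flux_sign3_outside[OF curves generic] True by fastforce
  from triangle_sides_ge[OF this]
  have "dist (pos (fst z)) vert + dist (pos (fst w)) vert + dist (pos (fst u)) vert \<le> 3 * (?d z u + ?d u w)" .
  from mult_left_mono[OF this, of "C2 / 3"]
  have le: "- C2 * ?d z u + - C2 * ?d u w \<le> - (C2 / 3) * dist (pos (fst z)) vert
      + - (C2 / 3) * dist (pos (fst w)) vert + - (C2 / 3) * dist (pos (fst u)) vert"
    using C2_pos by (simp add: algebra_simps)
  have "cmod (P_entry z u) * cmod (P_entry u w) \<le> (C1 * exp (- C2 * ?d z u)) * (C1 * exp (- C2 * ?d u w))"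
    by (intro mult_mono P_entry_le) (use C1_pos in auto)
  also have "\<dots> = C1\<^sup>2 * exp (- C2 * ?d z u + - C2 * ?d u w)"
    unfolding exp_add power2_eq_square by (simp only: mult_ac)
  also have "\<dots> \<le> C1\<^sup>2 * (weight z * weight w * weight u)"
    unfolding weight_def exp_add[symmetric] by (intro mult_left_mono) (use le in simp_all)
  finally have "2 * (cmod (P_entry z u) * cmod (P_entry u w)) \<le> 2 * (C1\<^sup>2 * (weight z * weight w * weight u))"
    by simp
  moreover have "cmod (V_term z w u) = 2 * (cmod (P_entry z u) * cmod (P_entry u w))"
    unfolding V_term_def if_P[OF True] norm_mult norm_of_real by (simp add: abs_mult)
  ultimately show ?thesis by (simp only: mult_ac)
next
  case False
  then show ?thesis using weight_pos[of z] weight_pos[of w] weight_pos[of u] by (simp add: V_term_def)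
qed

lemma V_term_summable:
  "(\<lambda>u. cmod (V_term z w u)) summable_on UNIV" "(\<Sum>\<^sub>\<infinity>u. cmod (V_term z w u)) \<le> V_bound z w"
proof -
  have s: "(\<lambda>u. (2 * C1\<^sup>2 * (weight z * weight w)) * weight u) summable_on UNIV"
    by (rule summable_on_cmult_right[OF summable_weight])
  show 1: "(\<lambda>u. cmod (V_term z w u)) summable_on UNIV"
    by (rule summable_on_comparison_test[OF s V_term_le]) simp
  have "(\<Sum>\<^sub>\<infinity>u. cmod (V_term z w u)) \<le> (\<Sum>\<^sub>\<infinity>u. (2 * C1\<^sup>2 * (weight z * weight w)) * weight u)"
    by (rule infsum_mono[OF 1 s V_term_le])
  also have "\<dots> = V_bound z w" unfolding V_bound_def by (subst infsum_cmult_right') (simp add: mult_ac)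
  finally show "(\<Sum>\<^sub>\<infinity>u. cmod (V_term z w u)) \<le> V_bound z w" .
qed

lemma V_trunc_eq:
  "V_trunc r z w = (if fst z \<in> disk vert r \<and> fst w \<in> disk vert r
     then \<Sum>u\<in>disk vert r \<times> UNIV. V_term z w u else 0)"
proof (cases "fst z \<in> disk vert r \<and> fst w \<in> disk vert r")
  case True
  let ?D = "disk vert r" and ?c = "complex_of_real (- 2 * flux_sign l (fst z) (fst w))"
  let ?t = "\<lambda>x. \<Sum>k\<in>UNIV. P_entry z (x, k) * P_entry (x, k) w"
  have "V_trunc r z w = ?c * (\<Sum>x\<in>{x \<in> ?D. flux_sign3 l (fst z) (fst w) x = - 1}. ?t x)"
    using True by (simp add: V_trunc_def truncV_def matrix_matrix_mult_def sum_component P_entry_def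
        scaleR_conv_of_real[where ?'a = complex])
  also have "(\<Sum>x\<in>{x \<in> ?D. flux_sign3 l (fst z) (fst w) x = - 1}. ?t x) =
      (\<Sum>x\<in>?D. if flux_sign3 l (fst z) (fst w) x = - 1 then ?t x else 0)"
    by (rule sum.inter_filter[OF finite_disk])
  also have "?c * \<dots> = (\<Sum>x\<in>?D. \<Sum>k\<in>UNIV. V_term z w (x, k))"
    unfolding sum_distrib_left
  proof (rule sum.cong[OF refl])
    fix x
    show "?c * (if flux_sign3 l (fst z) (fst w) x = - 1 then ?t x else 0) = (\<Sum>k\<in>UNIV. V_term z w (x, k))"
      by (cases "flux_sign3 l (fst z) (fst w) x = - 1") (simp_all add: V_term_def sum_distrib_left)
  qed
  also have "\<dots> = (\<Sum>u\<in>?D \<times> UNIV. V_term z w u)" by (simp add: sum.cartesian_product case_prod_unfold)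
  finally show ?thesis using True by simp
qed (auto simp: V_trunc_def truncV_def)

lemma V_trunc_le: "cmod (V_trunc r z w) \<le> V_bound z w"
proof (cases "fst z \<in> disk vert r \<and> fst w \<in> disk vert r")
  case True
  then have "cmod (V_trunc r z w) \<le> (\<Sum>u\<in>disk vert r \<times> UNIV. cmod (V_term z w u))"
    unfolding V_trunc_eq by (simp add: norm_sum)
  also have "\<dots> \<le> (\<Sum>\<^sub>\<infinity>u. cmod (V_term z w u))"
    by (rule finite_sum_le_infsum[OF V_term_summable(1)]) (use finite_disk in auto)
  finally show ?thesis using V_term_summable(2) by (rule order_trans)
next
  case False
  have "0 \<le> V_bound z w" using V_term_summable(2)[of z w] infsum_nonneg[of UNIV "\<lambda>u. cmod (V_term z w u)"] by simp
  then show ?thesis unfolding V_trunc_eq if_not_P[OF False] by simp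
qed

lemma V_limit_le: "cmod (V_limit z w) \<le> V_bound z w"
  unfolding V_limit_def by (rule order_trans[OF norm_infsum_bound[OF V_term_summable(1)] V_term_summable(2)])

lemma V_trunc_tendsto: "((\<lambda>r. V_trunc r z w) \<longlongrightarrow> V_limit z w) at_top"
proof -
  have "((\<lambda>F. sum (V_term z w) F) \<longlongrightarrow> V_limit z w) (finite_subsets_at_top UNIV)"
    unfolding V_limit_def using has_sum_infsum[OF abs_summable_summable[OF V_term_summable(1)]]
    unfolding has_sum_def .
  then have "((\<lambda>r. sum (V_term z w) (disk vert r \<times> UNIV)) \<longlongrightarrow> V_limit z w) at_top"
    by (rule filterlim_compose[OF _ filterlim_disk_blocks])
  moreover have "\<forall>\<^sub>F r in at_top. sum (V_term z w) (disk vert r \<times> UNIV) = V_trunc r z w"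
  proof (rule eventually_mono[OF eventually_gt_at_top[of "max (dist (pos (fst z)) vert) (dist (pos (fst w)) vert)"]])
    fix r assume "max (dist (pos (fst z)) vert) (dist (pos (fst w)) vert) < r"
    then have "fst z \<in> disk vert r" "fst w \<in> disk vert r" by (auto simp: disk_def)
    then show "sum (V_term z w) (disk vert r \<times> UNIV) = V_trunc r z w" unfolding V_trunc_eq by simp
  qed
  ultimately show ?thesis by (rule Lim_transform_eventually)
qed

lemma summable_V_bound: "(\<lambda>(z, w). V_bound z w) summable_on UNIV"
proof -
  have "(\<lambda>(z, w). V_bound z w) summable_on UNIV \<times> UNIV"
  proof (rule summable_on_SigmaI)
    let ?c = "2 * C1\<^sup>2 * infsum weight UNIV"
    show "((\<lambda>w. case (z, w) of (z, w) \<Rightarrow> V_bound z w) has_sum (?c * infsum weight UNIV) * weight z) UNIV" for z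
      using has_sum_cmult_right[OF has_sum_infsum[OF summable_weight], of "?c * weight z"]
      by (simp add: V_bound_def mult_ac)
    show "(\<lambda>z. (?c * infsum weight UNIV) * weight z) summable_on UNIV"
      by (rule summable_on_cmult_right[OF summable_weight])
    show "0 \<le> (case (z, w) of (z, w) \<Rightarrow> V_bound z w)" for z w
      by simp (rule order_trans[OF norm_ge_zero V_limit_le])
  qed
  then show ?thesis by simp
qed

text \<open>Signs do not change moduli, so exponential decay of \<open>P\<close> gives the Schur
  bound for the half-flux kernel.\<close>

lemma half_flux_operator:
  obtains T where "symmetric_op T" "half_flux l P = opr_of T"
    "\<And>z w. entry (\<lambda>f. T (T f) - T f) z w = V_limit z w"
proof -
  obtain TP where TP: "symmetric_op TP" "P = opr_of TP"
    using symmetric_op_of_opr proj unfolding orthogonal_projection_def by blast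
  have P_entry: "P_entry z w = entry TP z w" for z w
    unfolding P_entry_def by (subst TP(2)) simp
  define K where "K z w = of_real (flux_sign l (fst z) (fst w)) * P_entry z w" for z w
  have K_norm: "cmod (K z w) = cmod (P_entry z w)" for z w by (simp add: K_def norm_mult)
  have herm: "K w z = cnj (K z w)" for z w
    unfolding K_def P_entry using entry_hermitian[OF TP(1), of w z] by (simp add: flux_sign_commute[of l "fst w"])
  let ?e = "\<lambda>x y. exp (- C2 * dist (pos x) (pos y))"
  define M where "M = C1 * (real CARD('n) * (\<Sum>\<^sub>\<infinity>y. exp (- C2 * dist (pos y) 0)))"
  have row: "(\<lambda>w. cmod (K z w)) summable_on UNIV \<and> (\<Sum>\<^sub>\<infinity>w. cmod (K z w)) \<le> M" for z
  proof -
    have se: "(\<lambda>w :: site \<times> 'n. ?e (fst z) (fst w)) summable_on UNIV"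
      and ie: "(\<Sum>\<^sub>\<infinity>w :: site \<times> 'n. ?e (fst z) (fst w)) = real CARD('n) * (\<Sum>\<^sub>\<infinity>y. ?e (fst z) y)"
      by (rule summable_on_fst[OF exp_site_translate(1)[OF C2_pos]], simp)+
    have s: "(\<lambda>w. C1 * ?e (fst z) (fst w)) summable_on (UNIV :: (site \<times> 'n) set)"
      by (rule summable_on_cmult_right[OF se])
    have le: "cmod (K z w) \<le> C1 * ?e (fst z) (fst w)" for w unfolding K_norm by (rule P_entry_le)
    have 1: "(\<lambda>w. cmod (K z w)) summable_on UNIV" by (rule summable_on_comparison_test[OF s le]) simp
    have "(\<Sum>\<^sub>\<infinity>w. cmod (K z w)) \<le> (\<Sum>\<^sub>\<infinity>w :: site \<times> 'n. C1 * ?e (fst z) (fst w))"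
      by (rule infsum_mono[OF 1 s le])
    also have "\<dots> = C1 * (\<Sum>\<^sub>\<infinity>w :: site \<times> 'n. ?e (fst z) (fst w))" by (rule infsum_cmult_right')
    also have "\<dots> = M" unfolding M_def ie exp_site_translate(2)[OF C2_pos] ..
    finally show ?thesis using 1 by blast
  qed
  obtain T where T: "symmetric_op T" "\<And>z w. entry T z w = K z w"
    using symmetric_op_of_kernel[of K M] herm row by metis
  have "half_flux l P = opr_of T"
    by (simp add: opr_eq_iff half_flux_def T(2) K_def P_entry_def
        scaleR_conv_of_real[where ?'a = complex])
  moreover have "entry (\<lambda>f. T (T f) - T f) z w = V_limit z w" for z w
  proof -
    let ?s = "\<lambda>a b. complex_of_real (flux_sign l (fst a) (fst b))"
    have TTP: "TP (TP f) = TP f" for f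
      using proj orthogonal_projection_opr_of[OF TP(1)] unfolding TP(2) by blast
    have 1: "((\<lambda>u. K z u * K u w) has_sum nth_ell2 (T (T (delta w))) z) UNIV"
      using has_sum_entry(1)[OF T(1), of z "T (delta w)"] unfolding entry_def[symmetric] T(2) .
    have "((\<lambda>u. P_entry z u * P_entry u w) has_sum P_entry z w) UNIV"
      using has_sum_entry(1)[OF TP(1), of z "TP (delta w)"] unfolding TTP entry_def[symmetric] P_entry .
    from has_sum_cmult_right[OF this, of "?s z w"]
    have 2: "((\<lambda>u. ?s z w * (P_entry z u * P_entry u w)) has_sum K z w) UNIV" by (simp add: K_def)
    \<comment> \<open>The product of the signs along \<open>z\<close>, \<open>u\<close>,
      \<open>w\<close> is rewritten through the triangle sign, using that the sign of a segment
      squares to 1.\<close>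
    have eq: "K z u * K u w - ?s z w * (P_entry z u * P_entry u w) = V_term z w u" for u
    proof -
      have s3: "?s z w * of_real (flux_sign3 l (fst z) (fst w) (fst u)) = ?s z u * ?s u w"
      proof -
        have "flux_sign l (fst z) (fst w) * flux_sign3 l (fst z) (fst w) (fst u)
            = (flux_sign l (fst z) (fst w) * flux_sign l (fst z) (fst w)) * flux_sign l (fst w) (fst u) * flux_sign l (fst u) (fst z)"
          unfolding flux_sign3_def by (simp only: mult_ac)
        also have "\<dots> = flux_sign l (fst z) (fst u) * flux_sign l (fst u) (fst w)"
          by (simp add: flux_sign_commute[of l "fst w" "fst u"] flux_sign_commute[of l "fst u" "fst z"])
        finally show ?thesis by (simp only: of_real_mult[symmetric])
      qed
      have "K z u * K u w = (?s z u * ?s u w) * (P_entry z u * P_entry u w)"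
        unfolding K_def by (simp only: mult_ac)
      also have "\<dots> = ?s z w * of_real (flux_sign3 l (fst z) (fst w) (fst u)) * (P_entry z u * P_entry u w)"
        unfolding s3 ..
      finally have *: "K z u * K u w = \<dots>" .
      show ?thesis
      proof (cases "flux_sign3 l (fst z) (fst w) (fst u) = - 1")
        case True
        then show ?thesis unfolding * V_term_def by simp
      next
        case False
        then have "flux_sign3 l (fst z) (fst w) (fst u) = 1" using flux_sign3_cases by blast
        then show ?thesis unfolding * V_term_def by simp
      qed
    qed
    have "((\<lambda>u. K z u * K u w - ?s z w * (P_entry z u * P_entry u w)) has_sum
        nth_ell2 (T (T (delta w))) z - K z w) UNIV"
      using has_sum_add[OF 1 has_sum_uminusI[OF 2]] by simp
    then have "V_limit z w = nth_ell2 (T (T (delta w))) z - K z w"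
      unfolding V_limit_def eq by (rule infsumI)
    then show ?thesis by (simp add: entry_def flip: T(2))
  qed
  ultimately show thesis using that T(1) by blast
qed

lemma summable_kernel_V_limit: "summable_kernel V_limit"
  unfolding summable_kernel_def
  by (rule summable_on_comparison_test[OF summable_V_bound]) (auto simp: V_limit_le)

end

subsection \<open>Finite systems\<close>

lemma symmetric_op_of_finite_opr:
  fixes A :: "'n::finite opr"
  assumes D: "finite D" and A: "supported_on D A" "hermitian A"
  obtains T where "symmetric_op T" "A = opr_of T"
proof -
  define K where "K z w = A (fst z) (fst w) $ snd z $ snd w" for z w
  have K0: "K z w = 0" if "z \<notin> D \<times> UNIV \<or> w \<notin> D \<times> UNIV" for z w
    using A(1) that unfolding supported_on_def K_def by (cases z; cases w) auto
  have herm: "K w z = cnj (K z w)" for z w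
    unfolding K_def by (rule A(2)[unfolded hermitian_def, rule_format])
  have fin: "finite (D \<times> (UNIV :: 'n set))" using D by simp
  define M where "M = (\<Sum>z\<in>D \<times> UNIV. \<Sum>w\<in>D \<times> UNIV. cmod (K z w))"
  have hs: "((\<lambda>w. cmod (K z w)) has_sum (\<Sum>w\<in>D \<times> UNIV. cmod (K z w))) UNIV" for z
    by (rule has_sum_finite_neutralI[OF fin]) (use K0 in auto)
  have le: "(\<Sum>w\<in>D \<times> UNIV. cmod (K z w)) \<le> M" for z
  proof (cases "z \<in> D \<times> UNIV")
    case True
    then show ?thesis unfolding M_def
      by (intro member_le_sum[of z _ "\<lambda>z. \<Sum>w\<in>D \<times> UNIV. cmod (K z w)"]) (use fin in \<open>auto intro: sum_nonneg\<close>)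
  next
    case False
    then have "(\<Sum>w\<in>D \<times> UNIV. cmod (K z w)) = 0" using K0 by simp
    then show ?thesis unfolding M_def by (simp add: sum_nonneg)
  qed
  have s: "(\<lambda>w. cmod (K z w)) summable_on UNIV" for z using hs summable_on_def by blast
  have i: "(\<Sum>\<^sub>\<infinity>w. cmod (K z w)) \<le> M" for z using infsumI[OF hs] le by simp
  obtain T where T: "symmetric_op T" "\<And>z w. entry T z w = K z w"
    by (rule symmetric_op_of_kernel[OF herm s i]) blast
  have "A = opr_of T" by (simp add: opr_eq_iff T(2) K_def)
  then show thesis using that T(1) by blast
qed

text \<open>A supremum of reals says something only once the set is known to be bounded above, which
  is drawn from boundedness of \<open>T\<close>.\<close>

lemma norm_le_op_norm:
  fixes T :: "(site \<times> 'n::finite) ell2 \<Rightarrow> (site \<times> 'n) ell2"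
  assumes T: "symmetric_op T"
  shows "norm (T f) \<le> op_norm (opr_of T) * norm f"
proof (cases "f = 0")
  case True
  then show ?thesis by (simp add: symmetric_op_zero_arg[OF T])
next
  case False
  obtain M where M: "M \<ge> 0" "\<And>f. norm (T f) \<le> M * norm f" using symmetric_op_bounded[OF T] by blast
  let ?S = "{l2_norm (op_apply (opr_of T) \<psi>) | \<psi>. \<psi> \<in> l2 \<and> l2_norm \<psi> \<le> 1}"
  have on_state: "l2_norm (op_apply (opr_of T) \<psi>) = norm (T (vec_of_state \<psi>))" if "\<psi> \<in> l2" for \<psi>
    by (simp add: op_apply_opr_of(2)[OF T that] l2_norm_vec)
  have bdd: "bdd_above ?S"
  proof (rule bdd_aboveI)
    fix t assume "t \<in> ?S"
    then obtain \<psi> where \<psi>: "\<psi> \<in> l2" "l2_norm \<psi> \<le> 1" "t = l2_norm (op_apply (opr_of T) \<psi>)" by blast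
    then have "t \<le> M * norm (vec_of_state \<psi>)" using M(2) by (simp add: on_state)
    also have "\<dots> \<le> M * 1" using \<psi> M(1) by (intro mult_left_mono) (simp_all add: l2_norm_vec)
    finally show "t \<le> M" by simp
  qed
  define u where "u = (1 / norm f) *\<^sub>R f"
  have "norm u = 1" using False by (simp add: u_def)
  then have "norm (T u) \<in> ?S"
    by (intro CollectI exI[of _ "state_of_vec u"]) (simp add: on_state l2_norm_vec)
  then have "norm (T u) \<le> op_norm (opr_of T)" unfolding op_norm_def using bdd by (rule cSup_upper)
  moreover have "norm (T u) = norm (T f) / norm f"
    using False by (simp add: u_def symmetric_op_scaleR[OF T])
  ultimately show ?thesis using False by (simp add: divide_le_eq)
qed

text \<open>Matrices on the disk act on the full Hilbert space through extension by zero, so systems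
  of all sizes live in one space and can be compared with the limit.\<close>

locale finite_eigensystem =
  fixes D :: "site set" and Q V :: "(site \<times> 'n::finite) ell2 \<Rightarrow> (site \<times> 'n) ell2"
    and e :: "site \<times> 'n \<Rightarrow> (site \<times> 'n) ell2" and q v :: "site \<times> 'n \<Rightarrow> real"
  assumes finite_D: "finite D" and Q: "symmetric_op Q" and V: "symmetric_op V"
    and on: "orthonormal_family (D \<times> UNIV) e"
    and support: "\<And>a z. a \<in> D \<times> UNIV \<Longrightarrow> fst z \<notin> D \<Longrightarrow> nth_ell2 (e a) z = 0"
    and eigen: "\<And>a. a \<in> D \<times> UNIV \<Longrightarrow> Q (e a) = q a *\<^sub>R e a" "\<And>a. a \<in> D \<times> UNIV \<Longrightarrow> V (e a) = v a *\<^sub>R e a"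
    and V_support: "\<And>z w. entry V z w \<noteq> 0 \<Longrightarrow> fst z \<in> D \<and> fst w \<in> D"
begin

abbreviation I :: "(site \<times> 'n) set" where "I \<equiv> D \<times> UNIV"

lemma finite_I: "finite I"
  using finite_D by simp

text \<open>As many orthonormal vectors as there are indices: the defects of Bessel's inequality for the
  vectors \<^term>\<open>delta z\<close> add up to zero.\<close>

lemma span_proj_delta:
  assumes "z \<in> I"
  shows "span_proj I e (delta z) = delta z"
proof -
  have nsq: "(norm (span_proj I e (delta z)))\<^sup>2 = (\<Sum>a\<in>I. (cmod (nth_ell2 (e a) z))\<^sup>2)" for z
    using infsumI[OF has_sum_norm_span_proj[OF on, of "delta z"]] finite_I by simp
  have defect: "(norm (delta z - span_proj I e (delta z)))\<^sup>2 = 1 - (norm (span_proj I e (delta z)))\<^sup>2" for z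
  proof -
    let ?p = "span_proj I e (delta z)"
    have "cinner (delta z) ?p = cinner ?p ?p"
      unfolding span_proj_symmetric[OF on, symmetric]
      using span_proj_span_proj[OF on order_refl order_refl, of "delta z"] by simp
    then have "inner (delta z) ?p = inner ?p ?p" by (simp add: Re_cinner[symmetric])
    then have "inner (delta z - ?p) (delta z - ?p) = inner (delta z) (delta z) - inner ?p ?p"
      using inner_commute[of ?p "delta z"] by (simp add: inner_diff_left inner_diff_right)
    then show ?thesis unfolding power2_norm_eq_inner[symmetric] by simp
  qed
  have "(\<Sum>z\<in>I. (norm (span_proj I e (delta z)))\<^sup>2) = (\<Sum>a\<in>I. \<Sum>z\<in>I. (cmod (nth_ell2 (e a) z))\<^sup>2)"
    unfolding nsq by (rule sum.swap)
  also have "\<dots> = (\<Sum>a\<in>I. 1)"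
  proof (rule sum.cong[OF refl])
    fix a assume a: "a \<in> I"
    have "((\<lambda>z. (cmod (nth_ell2 (e a) z))\<^sup>2) has_sum (\<Sum>z\<in>I. (cmod (nth_ell2 (e a) z))\<^sup>2)) UNIV"
    proof (rule has_sum_finite_neutralI[OF finite_I])
      fix z assume "z \<in> UNIV - I"
      then have "fst z \<notin> D" by (cases z) simp
      then show "(cmod (nth_ell2 (e a) z))\<^sup>2 = 0" using support[OF a] by simp
    qed auto
    then have "(\<Sum>z\<in>I. (cmod (nth_ell2 (e a) z))\<^sup>2) = (norm (e a))\<^sup>2"
      using has_sum_norm_square has_sum_unique by blast
    then show "(\<Sum>z\<in>I. (cmod (nth_ell2 (e a) z))\<^sup>2) = 1" using norm_orthonormal[OF on a] by simp
  qed
  finally have "(\<Sum>z\<in>I. (norm (delta z - span_proj I e (delta z)))\<^sup>2) = 0"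
    unfolding defect sum_subtractf by simp
  then have "\<forall>z\<in>I. (norm (delta z - span_proj I e (delta z)))\<^sup>2 = 0"
    by (subst (asm) sum_nonneg_eq_0_iff[OF finite_I]) simp_all
  from bspec[OF this assms] show ?thesis by simp
qed

lemma span_proj_supported:
  assumes "\<And>z. fst z \<notin> D \<Longrightarrow> nth_ell2 f z = 0"
  shows "(\<Sum>a\<in>I. cinner (e a) f *\<^sub>c e a) = f"
proof -
  have bl: "bounded_linear (span_proj I e)"
    by (rule bounded_linear_symmetric_op[OF symmetric_op_span_proj[OF on]])
  have "((\<lambda>z. span_proj I e (nth_ell2 f z *\<^sub>c delta z)) has_sum span_proj I e f) UNIV"
    by (rule has_sum_bounded_linear[OF bl has_sum_delta])
  moreover have "span_proj I e (nth_ell2 f z *\<^sub>c delta z) = nth_ell2 f z *\<^sub>c delta z" for z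
  proof (cases "z \<in> I")
    case True
    then show ?thesis
      by (simp add: symmetric_op_scaleC[OF symmetric_op_span_proj[OF on]] span_proj_delta)
  next
    case False
    then have "fst z \<notin> D" by (cases z) simp
    then show ?thesis using assms by (simp add: symmetric_op_zero_arg[OF symmetric_op_span_proj[OF on]])
  qed
  ultimately have "((\<lambda>z. nth_ell2 f z *\<^sub>c delta z) has_sum span_proj I e f) UNIV" by simp
  then have "span_proj I e f = f" using has_sum_delta[of f] by (rule has_sum_unique)
  then show ?thesis unfolding span_proj_def using finite_I by simp
qed

lemma summable_kernel_V: "summable_kernel (entry V)"
  unfolding summable_kernel_def
proof (rule finite_nonzero_values_imp_summable_on)
  have "{x \<in> UNIV. (case x of (x, y) \<Rightarrow> cmod (entry V x y)) \<noteq> 0} \<subseteq> I \<times> I"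
  proof
    fix x assume "x \<in> {x \<in> UNIV. (case x of (x, y) \<Rightarrow> cmod (entry V x y)) \<noteq> 0}"
    then have "fst (fst x) \<in> D \<and> fst (snd x) \<in> D" using V_support[of "fst x" "snd x"] by (simp add: case_prod_unfold)
    then show "x \<in> I \<times> I" by (cases x; cases "fst x"; cases "snd x") simp
  qed
  then show "finite {x \<in> UNIV. (case x of (x, y) \<Rightarrow> cmod (entry V x y)) \<noteq> 0}"
    using finite_I finite_subset by blast
qed

lemma kernel_form_V: "a \<in> I \<Longrightarrow> kernel_form (entry V) (e a) = of_real (v a)"
  unfolding kernel_form_entry[OF V summable_kernel_V]
  using orthonormal_familyD[OF on, of a a] by (simp add: eigen(2))

text \<open>The coefficients are arbitrary rather than functions of the eigenvalues of
  \<open>Q\<close>; with the signs of \<open>v\<close> the left side becomes the trace norm of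
  \<open>V\<close>.\<close>

lemma weighted_trace:
  assumes "\<And>a. a \<in> I \<Longrightarrow> cmod (c a) \<le> B"
  shows "(\<Sum>a\<in>I. c a * of_real (v a)) =
    (\<Sum>\<^sub>\<infinity>(x, y). entry V x y * (\<Sum>a\<in>I. c a * (cnj (nth_ell2 (e a) x) * nth_ell2 (e a) y)))"
proof -
  have "((\<lambda>a. c a * kernel_form (entry V) (e a)) has_sum
      (\<Sum>\<^sub>\<infinity>(x, y). entry V x y * (\<Sum>a\<in>I. c a * (cnj (nth_ell2 (e a) x) * nth_ell2 (e a) y)))) I"
    by (rule kernel_trace(1)[OF on summable_kernel_V assms]) (use finite_I in \<open>auto intro: has_sum_finite\<close>)
  from infsumI[OF this] show ?thesis using finite_I by (simp add: kernel_form_V)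
qed

text \<open>The trace of \<open>V Q^m\<close> in two bases: the eigenbasis on the left, the lattice
  basis on the right, where limits can be taken entry by entry.\<close>

lemma moment_trace:
  "(\<Sum>a\<in>I. of_real (q a ^ m) * of_real (v a)) = (\<Sum>\<^sub>\<infinity>(x, y). entry V x y * nth_ell2 ((Q ^^ m) (delta x)) y)"
proof -
  obtain M where M: "M \<ge> 0" "\<And>f. norm (Q f) \<le> M * norm f" using symmetric_op_bounded[OF Q] by blast
  have "\<bar>q a\<bar> \<le> M" if "a \<in> I" for a
    by (rule eigenvalue_bound[where T = Q and e = e and q = q, OF on that eigen(1)[OF that]]) (rule M)
  then have c: "cmod (of_real (q a ^ m)) \<le> M ^ m" if "a \<in> I" for a
    using that by (simp add: norm_power power_mono)
  have "((\<lambda>a. of_real (q a ^ m) * kernel_form (entry V) (e a)) has_sum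
      (\<Sum>\<^sub>\<infinity>(x, y). entry V x y * nth_ell2 ((Q ^^ m) (delta x)) y)) I"
  proof (rule kernel_trace(1)[OF on summable_kernel_V c])
    fix x y assume "entry V x y \<noteq> 0"
    then have "x \<in> I" using V_support[of x y] by (cases x) simp
    then show "((\<lambda>a. of_real (q a ^ m) * (cnj (nth_ell2 (e a) x) * nth_ell2 (e a) y))
        has_sum nth_ell2 ((Q ^^ m) (delta x)) y) I"
      by (intro has_sum_funpow_entry[OF Q on eigen(1) span_proj_delta])
  qed
  from infsumI[OF this] show ?thesis using finite_I by (simp add: kernel_form_V)
qed

end

subsection \<open>Time reversal\<close>

definition time_reverse :: "(site \<Rightarrow> complex ^ 'n \<Rightarrow> complex ^ 'n) \<Rightarrow> (site \<times> 'n::finite) ell2 \<Rightarrow> (site \<times> 'n) ell2" where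
  "time_reverse K f = vec_of_state (\<lambda>x. K x (state_of_vec f x))"

lemma cdot_self: "cdot a a = of_real ((norm a)\<^sup>2)"
  unfolding cdot_def norm_square_complex_vec of_real_sum complex_norm_square by (simp add: mult.commute)

context
  fixes K :: "site \<Rightarrow> complex ^ 'n \<Rightarrow> complex ^ 'n::finite"
  assumes K: "time_reversal K"
begin

lemma antiunitary_K: "antiunitary (K x)"
  using K unfolding time_reversal_def by blast

lemma norm_K: "norm (K x a) = norm a"
proof -
  have "cdot (K x a) (K x a) = cnj (cdot a a)" using antiunitary_K unfolding antiunitary_def by blast
  then have "(norm (K x a))\<^sup>2 = (norm a)\<^sup>2" unfolding cdot_self by (simp only: complex_cnj_complex_of_real of_real_eq_iff)
  then show ?thesis by (simp add: power2_eq_iff_nonneg)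
qed

lemma K_state_l2: "\<psi> \<in> l2 \<Longrightarrow> (\<lambda>x. K x (\<psi> x)) \<in> l2"
  by (simp add: l2_def norm_K)

lemma state_of_time_reverse: "state_of_vec (time_reverse K f) = (\<lambda>x. K x (state_of_vec f x))"
  unfolding time_reverse_def by (rule state_of_vec_of_state[OF K_state_l2]) simp

lemma cinner_time_reverse: "cinner (time_reverse K f) (time_reverse K g) = cnj (cinner f g)"
proof -
  have "l2_inner (\<lambda>x. K x (state_of_vec f x)) (\<lambda>x. K x (state_of_vec g x)) = cnj (l2_inner (state_of_vec f) (state_of_vec g))"
    using antiunitary_K unfolding l2_inner_def infsum_cnj[symmetric] antiunitary_def by simp
  then show ?thesis unfolding time_reverse_def by (simp add: l2_inner_vec K_state_l2)
qed

lemma time_reverse_twice: "time_reverse K (time_reverse K f) = - f"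
proof -
  have "K x (K x a) = - a" for x a using K unfolding time_reversal_def by blast
  then have "time_reverse K (time_reverse K f) = vec_of_state (\<lambda>x. - state_of_vec f x)"
    unfolding time_reverse_def[of K "time_reverse K f"] state_of_time_reverse by simp
  also have "(\<lambda>x. - state_of_vec f x) = state_of_vec (- f)" by (rule ext) (simp add: vec_eq_iff)
  finally show ?thesis by simp
qed

text \<open>Antiunitarity combined with square -1; for \<open>f = g\<close> it says that a vector is
  orthogonal to its Kramers partner.\<close>

lemma cinner_time_reverse_swap: "cinner g (time_reverse K f) = - cinner f (time_reverse K g)"
proof -
  have "cnj (cinner g (time_reverse K f)) = cinner (time_reverse K g) (time_reverse K (time_reverse K f))"
    by (rule cinner_time_reverse[symmetric])
  also have "\<dots> = - cnj (cinner f (time_reverse K g))"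
    unfolding time_reverse_twice cinner_minus_right by (simp only: cinner_commute[of f "time_reverse K g"] complex_cnj_cnj)
  finally show ?thesis by (simp only: complex_cnj_minus[symmetric] complex_cnj_cancel_iff)
qed

lemma time_reverse_scaleR: "time_reverse K (r *\<^sub>R f) = r *\<^sub>R time_reverse K f"
proof -
  have "K x (r *\<^sub>R a) = r *\<^sub>R K x a" for x a
  proof -
    have "K x (complex_of_real r *s a) = cnj (complex_of_real r) *s K x a"
      using antiunitary_K unfolding antiunitary_def by blast
    moreover have "complex_of_real r *s b = r *\<^sub>R b" for b :: "complex ^ 'n"
      by (simp add: vec_eq_iff scaleR_conv_of_real[where ?'a = complex])
    ultimately show ?thesis by simp
  qed
  moreover have "state_of_vec (r *\<^sub>R f) x = r *\<^sub>R state_of_vec f x" for f :: "(site \<times> 'n) ell2" and x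
    by (simp add: vec_eq_iff scaleR_conv_of_real[where ?'a = complex])
  ultimately have "state_of_vec (time_reverse K (r *\<^sub>R f)) = state_of_vec (r *\<^sub>R time_reverse K f)"
    by (simp add: fun_eq_iff state_of_time_reverse)
  from arg_cong[OF this, of vec_of_state] show ?thesis by simp
qed

lemma time_reverse_support:
  assumes "\<And>i. nth_ell2 f (x, i) = 0"
  shows "nth_ell2 (time_reverse K f) (x, i) = 0"
proof -
  have "state_of_vec f x = 0" using assms by (simp add: vec_eq_iff)
  then have "norm (K x (state_of_vec f x)) = 0" by (simp add: norm_K)
  then have "state_of_vec (time_reverse K f) x = 0" unfolding state_of_time_reverse by simp
  then have "state_of_vec (time_reverse K f) x $ i = 0" by simp
  then show ?thesis by simp
qed

lemma time_reverse_commute: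
  assumes T: "symmetric_op T" "time_reversal_symmetric K (opr_of T)"
  shows "T (time_reverse K f) = time_reverse K (T f)"
proof -
  have "op_apply (opr_of T) (\<lambda>x. K x (state_of_vec f x)) = (\<lambda>x. K x (op_apply (opr_of T) (state_of_vec f) x))"
    using T(2) state_of_vec_l2[of f] unfolding time_reversal_symmetric_def by blast
  then have "state_of_vec (T (time_reverse K f)) = (\<lambda>x. K x (state_of_vec (T f) x))"
    by (simp add: op_apply_opr_of(2)[OF T(1)] K_state_l2 time_reverse_def)
  from arg_cong[OF this, of vec_of_state] show ?thesis by (simp add: time_reverse_def)
qed

end

context finite_eigensystem
begin

text \<open>Eigenvalues are real, so time reversal preserves each joint eigenspace of
  \<open>Q\<close> and \<open>V\<close>. A selection that depends only on the pair of eigenvalues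
  therefore spans an invariant space, whatever the predicate \<open>p\<close>; the cut in
  \<open>p\<close> can be placed at will.\<close>

lemma even_card_eigenstates:
  assumes K: "time_reversal K" "time_reversal_symmetric K (opr_of Q)" "time_reversal_symmetric K (opr_of V)"
  shows "even (card {a \<in> I. p (q a) (v a)})"
proof (rule even_card_kramers)
  let ?A = "{a \<in> I. p (q a) (v a)}"
  show "finite ?A" using finite_I by simp
  show "orthonormal_family ?A e" by (rule orthonormal_family_subset[OF on]) auto
  fix a assume a: "a \<in> ?A"
  let ?J = "time_reverse K (e a)"
  show "cinner (time_reverse K (e a)) (time_reverse K (e b)) = cnj (cinner (e a) (e b))" for b
    by (rule cinner_time_reverse[OF K(1)])
  show "cinner (e b) (time_reverse K (e a)) = - cinner (e a) (time_reverse K (e b))" for b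
    by (rule cinner_time_reverse_swap[OF K(1)])
  have supp: "nth_ell2 ?J z = 0" if "fst z \<notin> D" for z
    using time_reverse_support[OF K(1), of "e a" "fst z" "snd z"] support[of a "(fst z, _)"] a that by simp
  \<comment> \<open>Eigenvectors for different pairs of eigenvalues are orthogonal, so the partner
    of \<open>e a\<close> has components only along states with the same pair.\<close>
  have eig: "cinner (e b) ?J = 0" if b: "b \<in> I" and "q b \<noteq> q a \<or> v b \<noteq> v a" for b
  proof -
    have "cinner (e b) (Q ?J) = of_real (q b) * cinner (e b) ?J"
      by (simp add: symmetric_opD[OF Q] eigen(1)[OF b])
    moreover have "Q ?J = q a *\<^sub>R ?J"
      using a by (simp add: time_reverse_commute[OF K(1) Q K(2)] eigen(1) time_reverse_scaleR[OF K(1)])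
    moreover have "cinner (e b) (V ?J) = of_real (v b) * cinner (e b) ?J"
      by (simp add: symmetric_opD[OF V] eigen(2)[OF b])
    moreover have "V ?J = v a *\<^sub>R ?J"
      using a by (simp add: time_reverse_commute[OF K(1) V K(3)] eigen(2) time_reverse_scaleR[OF K(1)])
    ultimately show ?thesis using that(2) by auto
  qed
  have "?J = (\<Sum>b\<in>I. cinner (e b) ?J *\<^sub>c e b)" by (rule span_proj_supported[OF supp, symmetric])
  also have "\<dots> = (\<Sum>b\<in>?A. cinner (e b) ?J *\<^sub>c e b)"
  proof (rule sum.mono_neutral_right[OF finite_I])
    show "\<forall>b\<in>I - ?A. cinner (e b) ?J *\<^sub>c e b = 0"
    proof
      fix b assume "b \<in> I - ?A"
      then have "b \<in> I" "q b \<noteq> q a \<or> v b \<noteq> v a" using a by auto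
      then show "cinner (e b) ?J *\<^sub>c e b = 0" using eig by simp
    qed
  qed auto
  finally show "?J = (\<Sum>b\<in>?A. cinner (e b) ?J *\<^sub>c e b)" .
qed

end

subsection \<open>Limits of spectral sums\<close>

lemma norm_infsum_tail_le:
  fixes k :: "'a \<Rightarrow> 'b :: banach"
  assumes h: "h summable_on UNIV" and k: "\<And>x. norm (k x) \<le> h x" and F0: "finite F0"
  shows "norm (infsum k UNIV - sum k F0) \<le> infsum h UNIV - sum h F0"
proof -
  have ks: "(\<lambda>x. norm (k x)) summable_on UNIV" by (rule summable_on_comparison_test[OF h k]) simp
  have split: "infsum f UNIV = sum f F0 + infsum f (- F0)" if "f summable_on UNIV" for f :: "'a \<Rightarrow> 'c :: banach"
  proof -
    have "infsum f (F0 \<union> - F0) = infsum f F0 + infsum f (- F0)"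
      by (rule infsum_Un_disjoint) (use F0 summable_on_subset_banach[OF that] in auto)
    then show ?thesis using F0 by simp
  qed
  have "norm (infsum k UNIV - sum k F0) = norm (infsum k (- F0))"
    using split[OF abs_summable_summable[OF ks]] by simp
  also have "\<dots> \<le> infsum h (- F0)"
    by (rule norm_infsum_le[OF has_sum_infsum has_sum_infsum])
      (use k abs_summable_summable[OF ks] h in \<open>auto intro: summable_on_subset_banach\<close>)
  also have "\<dots> = infsum h UNIV - sum h F0" using split[OF h] by simp
  finally show ?thesis .
qed

text \<open>Outside a finite set the majorant leaves at most \<open>e/4\<close> for both sums, and
  on the finite set pointwise convergence suffices.\<close>

lemma infsum_dominated_tendsto:
  fixes f :: "'r \<Rightarrow> 'a \<Rightarrow> 'b :: banach"
  assumes h: "h summable_on UNIV" and dom: "\<forall>\<^sub>F r in G. \<forall>x. norm (f r x) \<le> h x"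
    and lim: "\<And>x. ((\<lambda>r. f r x) \<longlongrightarrow> g x) G" and G: "G \<noteq> bot"
  shows "((\<lambda>r. infsum (f r) UNIV) \<longlongrightarrow> infsum g UNIV) G"
proof (rule tendstoI)
  fix e :: real assume e: "e > 0"
  have g: "norm (g x) \<le> h x" for x
    by (rule tendsto_upperbound[OF tendsto_norm[OF lim] _ G])
      (use dom in \<open>auto elim: eventually_mono\<close>)
  obtain F0 where F0: "finite F0" "dist (sum h F0) (infsum h UNIV) \<le> e/4"
    using infsum_finite_approximation[OF h, of "e/4"] e by auto
  have "((\<lambda>r. sum (f r) F0) \<longlongrightarrow> sum g F0) G" by (intro tendsto_sum lim)
  then have "\<forall>\<^sub>F r in G. dist (sum (f r) F0) (sum g F0) < e/4" using e by (intro tendstoD) auto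
  then show "\<forall>\<^sub>F r in G. dist (infsum (f r) UNIV) (infsum g UNIV) < e"
    using dom
  proof eventually_elim
    case (elim r)
    have fr: "norm (f r x) \<le> h x" for x using elim(2) by blast
    have "infsum h UNIV - sum h F0 \<le> e/4" using F0(2) unfolding dist_real_def by linarith
    then have "norm (infsum (f r) UNIV - sum (f r) F0) \<le> e/4" "norm (infsum g UNIV - sum g F0) \<le> e/4"
      using norm_infsum_tail_le[OF h fr F0(1)] norm_infsum_tail_le[OF h g F0(1)] by linarith+
    then have "dist (infsum (f r) UNIV) (sum (f r) F0) \<le> e/4" "dist (sum g F0) (infsum g UNIV) \<le> e/4"
      by (simp_all add: dist_norm norm_minus_commute)
    then show ?case
      using elim(1) dist_triangle[of "infsum (f r) UNIV" "infsum g UNIV" "sum (f r) F0"]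
        dist_triangle[of "sum (f r) F0" "infsum g UNIV" "sum g F0"] e by linarith
  qed
qed

lemma summable_on_mult_bounded:
  fixes v f :: "'a \<Rightarrow> real"
  assumes "(\<lambda>a. \<bar>v a\<bar>) summable_on S" "\<And>a. a \<in> S \<Longrightarrow> \<bar>f a\<bar> \<le> C"
  shows "(\<lambda>a. \<bar>v a * f a\<bar>) summable_on S" "(\<lambda>a. v a * f a) summable_on S"
    "\<bar>\<Sum>\<^sub>\<infinity>a\<in>S. v a * f a\<bar> \<le> (\<Sum>\<^sub>\<infinity>a\<in>S. \<bar>v a\<bar>) * C"
proof -
  have s: "(\<lambda>a. \<bar>v a\<bar> * C) summable_on S" by (rule summable_on_cmult_left[OF assms(1)])
  have le: "\<bar>v a * f a\<bar> \<le> \<bar>v a\<bar> * C" if "a \<in> S" for a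
    unfolding abs_mult by (rule mult_left_mono[OF assms(2)[OF that]]) simp
  show 1: "(\<lambda>a. \<bar>v a * f a\<bar>) summable_on S" by (rule summable_on_comparison_test[OF s le]) auto
  then show 2: "(\<lambda>a. v a * f a) summable_on S" using abs_summable_summable[of "\<lambda>a. v a * f a" S] by simp
  have "\<bar>\<Sum>\<^sub>\<infinity>a\<in>S. v a * f a\<bar> \<le> (\<Sum>\<^sub>\<infinity>a\<in>S. \<bar>v a\<bar> * C)"
    using norm_infsum_le[OF has_sum_infsum[OF 2] has_sum_infsum[OF s]] le by simp
  then show "\<bar>\<Sum>\<^sub>\<infinity>a\<in>S. v a * f a\<bar> \<le> (\<Sum>\<^sub>\<infinity>a\<in>S. \<bar>v a\<bar>) * C"
    by (simp add: infsum_cmult_left')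
qed

text \<open>Moments determine the limit for polynomials. The total masses are bounded uniformly in
  \<open>r\<close>, so uniform approximation on the interval containing all eigenvalues carries over
  to the weighted sums.\<close>

lemma moments_imp_continuous:
  fixes v' q' :: "'r \<Rightarrow> 'a \<Rightarrow> real" and v q :: "'e \<Rightarrow> real"
  assumes fin: "\<And>r. finite (I r)"
    and q': "\<forall>\<^sub>F r in G. \<forall>a\<in>I r. \<bar>q' r a\<bar> \<le> M" and v': "\<forall>\<^sub>F r in G. (\<Sum>a\<in>I r. \<bar>v' r a\<bar>) \<le> B"
    and q: "\<And>e. e \<in> S \<Longrightarrow> \<bar>q e\<bar> \<le> M" and v: "(\<lambda>e. \<bar>v e\<bar>) summable_on S"
    and moments: "\<And>m. ((\<lambda>r. \<Sum>a\<in>I r. v' r a * q' r a ^ m) \<longlongrightarrow> (\<Sum>\<^sub>\<infinity>e\<in>S. v e * q e ^ m)) G"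
    and f: "continuous_on {-M..M} f"
  shows "((\<lambda>r. \<Sum>a\<in>I r. v' r a * f (q' r a)) \<longlongrightarrow> (\<Sum>\<^sub>\<infinity>e\<in>S. v e * f (q e))) G"
proof (rule tendstoI)
  fix e :: real assume e: "e > 0"
  \<comment> \<open>The summand 1 keeps \<open>C\<close> positive, so that \<open>d\<close> makes
    sense; each of the three errors is then at most \<open>e/4\<close>.\<close>
  define C where "C = \<bar>B\<bar> + (\<Sum>\<^sub>\<infinity>e\<in>S. \<bar>v e\<bar>) + 1"
  have C: "C > 0" "B \<le> C" "(\<Sum>\<^sub>\<infinity>e\<in>S. \<bar>v e\<bar>) \<le> C"
    unfolding C_def using infsum_nonneg[of S "\<lambda>e. \<bar>v e\<bar>"] by auto
  define d where "d = e / (4 * C)"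
  have "d > 0" using e C by (simp add: d_def)
  obtain p where p: "real_polynomial_function p" "\<And>t. t \<in> {-M..M} \<Longrightarrow> \<bar>f t - p t\<bar> < d"
    using Stone_Weierstrass_real_polynomial_function[OF _ f \<open>d > 0\<close>] by auto
  then obtain c n where p_sum: "p = (\<lambda>t. \<Sum>i\<le>n. c i * t ^ i)"
    unfolding real_polynomial_function_iff_sum by blast
  have f_bdd: "\<exists>N. \<forall>t\<in>{-M..M}. \<bar>f t\<bar> \<le> N"
    using compact_imp_bounded[OF compact_continuous_image[OF f]] by (auto simp: bounded_iff)
  then obtain N where N: "\<And>t. t \<in> {-M..M} \<Longrightarrow> \<bar>f t\<bar> \<le> N" by blast
  have qM: "q e \<in> {-M..M}" if "e \<in> S" for e using q[OF that] by auto
  have pow: "(\<lambda>e. v e * q e ^ i) summable_on S" for i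
    by (rule summable_on_mult_bounded(2)[OF v, where C = "M ^ i"])
      (use q in \<open>auto simp: power_abs intro: power_mono\<close>)
  have lim_p: "((\<lambda>r. \<Sum>a\<in>I r. v' r a * p (q' r a)) \<longlongrightarrow> (\<Sum>\<^sub>\<infinity>e\<in>S. v e * p (q e))) G"
  proof -
    have "((\<lambda>e. \<Sum>i\<le>n. c i * (v e * q e ^ i)) has_sum (\<Sum>i\<le>n. c i * (\<Sum>\<^sub>\<infinity>e\<in>S. v e * q e ^ i))) S"
    proof (induction n)
      case 0
      show ?case by simp (rule has_sum_cmult_right[OF has_sum_infsum], use pow[of 0] in simp)
    next
      case (Suc n)
      show ?case unfolding sum.atMost_Suc by (intro has_sum_add Suc has_sum_cmult_right has_sum_infsum pow)
    qed
    moreover have "(\<Sum>i\<le>n. c i * (v e * q e ^ i)) = v e * p (q e)" for e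
      by (simp add: p_sum sum_distrib_left mult.left_commute)
    ultimately have "(\<Sum>\<^sub>\<infinity>e\<in>S. v e * p (q e)) = (\<Sum>i\<le>n. c i * (\<Sum>\<^sub>\<infinity>e\<in>S. v e * q e ^ i))"
      by (intro infsumI) simp
    moreover have "(\<Sum>a\<in>I r. v' r a * p (q' r a)) = (\<Sum>i\<le>n. c i * (\<Sum>a\<in>I r. v' r a * q' r a ^ i))" for r
      unfolding p_sum sum_distrib_left by (subst sum.swap) (simp add: mult.left_commute)
    ultimately show ?thesis by (simp only:) (intro tendsto_intros moments)
  qed
  have S_diff: "\<bar>(\<Sum>\<^sub>\<infinity>e\<in>S. v e * f (q e)) - (\<Sum>\<^sub>\<infinity>e\<in>S. v e * p (q e))\<bar> \<le> e/4"
  proof -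
    have 1: "(\<lambda>e. v e * f (q e)) summable_on S"
      by (rule summable_on_mult_bounded(2)[OF v]) (use N qM in blast)
    have 2: "(\<lambda>e. v e * (f (q e) - p (q e))) summable_on S"
      by (rule summable_on_mult_bounded(2)[OF v]) (use p(2) qM less_imp_le in blast)
    have "(\<Sum>\<^sub>\<infinity>e\<in>S. v e * p (q e)) = (\<Sum>\<^sub>\<infinity>e\<in>S. v e * f (q e)) - (\<Sum>\<^sub>\<infinity>e\<in>S. v e * (f (q e) - p (q e)))"
      by (rule infsumI) (use has_sum_add[OF has_sum_infsum[OF 1] has_sum_uminusI[OF has_sum_infsum[OF 2]]]
        in \<open>simp add: right_diff_distrib\<close>)
    moreover have "\<bar>\<Sum>\<^sub>\<infinity>e\<in>S. v e * (f (q e) - p (q e))\<bar> \<le> (\<Sum>\<^sub>\<infinity>e\<in>S. \<bar>v e\<bar>) * d"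
      by (rule summable_on_mult_bounded(3)[OF v]) (use p(2) qM less_imp_le in blast)
    moreover have "(\<Sum>\<^sub>\<infinity>e\<in>S. \<bar>v e\<bar>) * d \<le> C * d" using C \<open>d > 0\<close> by (intro mult_right_mono) auto
    moreover have "C * d = e/4" using C by (simp add: d_def)
    ultimately show ?thesis by linarith
  qed
  have "\<forall>\<^sub>F r in G. dist (\<Sum>a\<in>I r. v' r a * p (q' r a)) (\<Sum>\<^sub>\<infinity>e\<in>S. v e * p (q e)) < e/4"
    using lim_p e by (intro tendstoD) auto
  then show "\<forall>\<^sub>F r in G. dist (\<Sum>a\<in>I r. v' r a * f (q' r a)) (\<Sum>\<^sub>\<infinity>e\<in>S. v e * f (q e)) < e"
    using q' v'
  proof eventually_elim
    case (elim r)
    have "\<bar>(\<Sum>a\<in>I r. v' r a * f (q' r a)) - (\<Sum>a\<in>I r. v' r a * p (q' r a))\<bar>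
        = \<bar>\<Sum>a\<in>I r. v' r a * (f (q' r a) - p (q' r a))\<bar>"
      by (simp add: sum_subtractf right_diff_distrib)
    also have "\<dots> \<le> (\<Sum>a\<in>I r. \<bar>v' r a * (f (q' r a) - p (q' r a))\<bar>)" by (rule sum_abs)
    also have "\<dots> \<le> (\<Sum>a\<in>I r. \<bar>v' r a\<bar> * d)"
    proof (rule sum_mono)
      fix a assume "a \<in> I r"
      then have "q' r a \<in> {-M..M}" using elim(2) by (auto simp: abs_le_iff)
      from p(2)[OF this] show "\<bar>v' r a * (f (q' r a) - p (q' r a))\<bar> \<le> \<bar>v' r a\<bar> * d"
        unfolding abs_mult by (intro mult_left_mono) auto
    qed
    also have "\<dots> = (\<Sum>a\<in>I r. \<bar>v' r a\<bar>) * d" by (simp add: sum_distrib_right)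
    also have "\<dots> \<le> C * d" using elim(3) C \<open>d > 0\<close> by (intro mult_right_mono) auto
    also have "C * d = e/4" using C by (simp add: d_def)
    finally show ?case using elim(1) S_diff unfolding dist_real_def by linarith
  qed
qed

text \<open>
  The function \<open>fs\<close> below jumps at \<open>s\<close>, inside a gap of the limiting spectrum. With the tent \<open>h\<close> over the gap,
  \<open>(1 - h) fs\<close> is continuous, and the error is dominated by the sum of \<open>v' h(q')\<close>, which tends to \<open>0\<close>, because
  \<open>t\<^sup>2 - t\<close> has constant sign on the gap.
\<close>

lemma vertex_sum_tendsto:
  fixes v' q' :: "'r \<Rightarrow> 'a \<Rightarrow> real" and q :: "'e \<Rightarrow> real"
  assumes fin: "\<And>r. finite (I r)"
    and q': "\<forall>\<^sub>F r in G. \<forall>a\<in>I r. \<bar>q' r a\<bar> \<le> M" and v': "\<forall>\<^sub>F r in G. (\<Sum>a\<in>I r. \<bar>v' r a\<bar>) \<le> B"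
    and q: "\<And>e. e \<in> S \<Longrightarrow> \<bar>q e\<bar> \<le> M" and v: "(\<lambda>e. \<bar>(q e)\<^sup>2 - q e\<bar>) summable_on S"
    and moments: "\<And>m. ((\<lambda>r. \<Sum>a\<in>I r. v' r a * q' r a ^ m) \<longlongrightarrow> (\<Sum>\<^sub>\<infinity>e\<in>S. ((q e)\<^sup>2 - q e) * q e ^ m)) G"
    and rel: "\<forall>\<^sub>F r in G. \<forall>a\<in>I r. v' r a \<noteq> 0 \<longrightarrow> v' r a = (q' r a)\<^sup>2 - q' r a"
  obtains s where "((\<lambda>r. (\<Sum>a\<in>{a\<in>I r. v' r a \<noteq> 0}. q' r a) - real (card {a\<in>I r. v' r a \<noteq> 0 \<and> q' r a > s}))
      \<longlongrightarrow> (\<Sum>\<^sub>\<infinity>e\<in>S. q e - (if q e > 1/2 then 1 else 0))) G"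
proof -
  \<comment> \<open>Any bound strictly between 1/2 and 1 could replace 3/4: up to 3/4 the modulus of
    \<open>t^2 - t\<close> stays above 3/16, and a summable family exceeds that only finitely
    often.\<close>
  define Z where "Z = {e\<in>S. 1/2 < q e \<and> q e < 3/4}"
  have "finite Z"
  proof -
    have "\<exists>F0. finite F0 \<and> F0 \<subseteq> S \<and>
        (\<forall>F. finite F \<longrightarrow> F \<subseteq> S - F0 \<longrightarrow> (\<Sum>e\<in>F. \<bar>(q e)\<^sup>2 - q e\<bar>) < 3/16)"
      by (rule summable_on_tail[OF v]) simp_all
    then obtain F0 where F0: "finite F0" "F0 \<subseteq> S"
      "\<And>F. finite F \<Longrightarrow> F \<subseteq> S - F0 \<Longrightarrow> (\<Sum>e\<in>F. \<bar>(q e)\<^sup>2 - q e\<bar>) < 3/16"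
      by blast
    have "e \<in> F0" if "e \<in> Z" for e
    proof (rule ccontr)
      assume "e \<notin> F0"
      then have "{e} \<subseteq> S - F0" using that by (simp add: Z_def)
      from F0(3)[OF _ this] have "\<bar>(q e)\<^sup>2 - q e\<bar> < 3/16" by simp
      \<comment> \<open>The convex function \<open>t^2 - t\<close> lies below its chord
        \<open>t/4 - 3/8\<close> over the interval from 1/2 to 3/4, and the chord is below -3/16
        there.\<close>
      have "0 < (q e - 1/2) * (3/4 - q e)" using that by (intro mult_pos_pos) (auto simp: Z_def)
      moreover have "(q e - 1/2) * (3/4 - q e) = q e / 4 - 3/8 - ((q e)\<^sup>2 - q e)"
        unfolding power2_eq_square left_diff_distrib right_diff_distrib by linarith
      ultimately have "(q e)\<^sup>2 - q e < q e / 4 - 3/8" by linarith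
      then have "(q e)\<^sup>2 - q e < - 3/16" using that by (simp add: Z_def)
      then show False using \<open>\<bar>(q e)\<^sup>2 - q e\<bar> < 3/16\<close> by linarith
    qed
    then have "Z \<subseteq> F0" by (rule subsetI)
    then show ?thesis using F0(1) by (rule finite_subset)
  qed
  define m where "m = Min (insert (3/4) (q ` Z))"
  have finZ: "finite (insert (3/4) (q ` Z))" using \<open>finite Z\<close> by simp
  have m: "1/2 < m" "m \<le> 3/4"
    unfolding m_def by (subst Min_gr_iff[OF finZ], simp, simp add: Z_def) (rule Min_le[OF finZ], simp)
  have gap: "q e \<le> 1/2 \<or> m \<le> q e" if "e \<in> S" for e
  proof (cases "e \<in> Z")
    case True
    then have "m \<le> q e" unfolding m_def by (intro Min_le[OF finZ]) simp
    then show ?thesis ..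
  next
    case False
    then show ?thesis using that m by (auto simp: Z_def)
  qed
  \<comment> \<open>Midpoint and half-width of the open gap from 1/2 to \<open>m\<close>. An
    eigenvalue exactly 1/2 is allowed; it lies at or below both cuts 1/2 and \<open>s\<close>, so
    both count it alike.\<close>
  define s d where sd: "s = (1/2 + m) / 2" "d = (m - 1/2) / 2"
  have s: "1/2 < s" "s < 3/4" "s - d = 1/2" "s + d = m" "d > 0"
    using m by (simp_all add: sd field_simps)
  define h where "h t = max 0 (1 - \<bar>t - s\<bar> / d)" for t :: real
  have h0: "h t = 0" if "t \<le> 1/2 \<or> m \<le> t" for t
  proof -
    have "\<bar>t - s\<bar> \<ge> d" using that s by linarith
    then show ?thesis using s(5) by (simp add: h_def le_divide_eq)
  qed
  have h_nonneg: "h t \<ge> 0" for t by (simp add: h_def)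
  have hs: "h s = 1" by (simp add: h_def)
  have cont_h: "continuous_on X h" for X unfolding h_def using s(5) by (intro continuous_intros) auto
  define fs where "fs t = (if t \<le> s then 1 / (t - 1) else 1 / t)" for t
  \<comment> \<open>The factor \<open>1 - h t\<close> vanishes at \<open>s\<close>, so both branches
    take the value 0 at the jump of \<open>fs\<close>.\<close>
  define f where "f t = (if t \<le> s then (1 - h t) / (t - 1) else (1 - h t) / t)" for t
  have f_eq: "f t = (1 - h t) * fs t" for t by (simp add: f_def fs_def)
  have "continuous_on ({..s} \<union> {s..}) f"
    unfolding f_def
  proof (rule continuous_on_If)
    show "continuous_on {..s} (\<lambda>t. (1 - h t) / (t - 1))"
      by (intro continuous_intros cont_h) (use s in auto)
    show "continuous_on {s..} (\<lambda>t. (1 - h t) / t)"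
      by (intro continuous_intros cont_h) (use s in auto)
    show "(1 - h t) / (t - 1) = (1 - h t) / t" if "t \<in> {s..}" "t \<le> s" for t
      using that hs by simp
    show "(1 - h t) / (t - 1) = (1 - h t) / t" if "t \<in> {..s}" "\<not> t \<le> s" for t using that by simp
  qed auto
  then have cont_f: "continuous_on {-M..M} f" by (rule continuous_on_subset) auto
  have vfs: "(t\<^sup>2 - t) * fs t = t - (if t > s then 1 else 0)" for t
  proof (cases "t \<le> s")
    case True
    have "t\<^sup>2 - t = t * (t - 1)" by (simp add: power2_eq_square right_diff_distrib)
    then show ?thesis using True s by (simp add: fs_def)
  next
    case False
    have "t\<^sup>2 - t = (t - 1) * t" by (simp add: power2_eq_square left_diff_distrib)
    then show ?thesis using False s by (simp add: fs_def)
  qed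
  have lim_f: "((\<lambda>r. \<Sum>a\<in>I r. v' r a * f (q' r a)) \<longlongrightarrow> (\<Sum>\<^sub>\<infinity>e\<in>S. ((q e)\<^sup>2 - q e) * f (q e))) G"
    by (rule moments_imp_continuous[OF fin q' v' q v moments cont_f])
  have lim_h: "((\<lambda>r. \<Sum>a\<in>I r. v' r a * h (q' r a)) \<longlongrightarrow> (\<Sum>\<^sub>\<infinity>e\<in>S. ((q e)\<^sup>2 - q e) * h (q e))) G"
    by (rule moments_imp_continuous[OF fin q' v' q v moments cont_h])
  have h_q: "h (q e) = 0" if "e \<in> S" for e by (rule h0[OF gap[OF that]])
  have "(\<Sum>\<^sub>\<infinity>e\<in>S. ((q e)\<^sup>2 - q e) * f (q e)) = (\<Sum>\<^sub>\<infinity>e\<in>S. q e - (if q e > 1/2 then 1 else 0))"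
  proof (rule infsum_cong)
    fix e assume e: "e \<in> S"
    have "(q e > s) = (q e > 1/2)" using gap[OF e] s by auto
    then show "((q e)\<^sup>2 - q e) * f (q e) = q e - (if q e > 1/2 then 1 else 0)"
      by (simp add: f_eq h_q[OF e] vfs)
  qed
  note lim_f = lim_f[unfolded this]
  have "(\<Sum>\<^sub>\<infinity>e\<in>S. ((q e)\<^sup>2 - q e) * h (q e)) = 0" by (rule infsum_0) (simp add: h_q)
  note lim_h = lim_h[unfolded this]
  define X where "X r = (\<Sum>a\<in>{a\<in>I r. v' r a \<noteq> 0}. q' r a) - real (card {a\<in>I r. v' r a \<noteq> 0 \<and> q' r a > s})" for r
  have "((\<lambda>r. X r - (\<Sum>a\<in>I r. v' r a * f (q' r a))) \<longlongrightarrow> 0) G"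
  proof (rule tendsto_0_le)
    show "((\<lambda>r. \<Sum>a\<in>I r. v' r a * h (q' r a)) \<longlongrightarrow> 0) G" by (rule lim_h)
    show "\<forall>\<^sub>F r in G. norm (X r - (\<Sum>a\<in>I r. v' r a * f (q' r a))) \<le> norm (\<Sum>a\<in>I r. v' r a * h (q' r a)) * 4"
      using rel
    proof eventually_elim
      case (elim r)
      have vf: "v' r a * fs (q' r a) = (if v' r a \<noteq> 0 then q' r a - (if q' r a > s then 1 else 0) else 0)"
        if "a \<in> I r" for a
      proof (cases "v' r a = 0")
        case False
        then have "v' r a = (q' r a)\<^sup>2 - q' r a" using elim that by blast
        then show ?thesis using vfs[of "q' r a"] False by simp
      qed simp
      have X: "X r = (\<Sum>a\<in>I r. v' r a * fs (q' r a))"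
      proof -
        have "(\<Sum>a\<in>I r. v' r a * fs (q' r a)) = (\<Sum>a\<in>{a\<in>I r. v' r a \<noteq> 0}. q' r a - (if q' r a > s then 1 else 0))"
          unfolding sum.inter_filter[OF fin] by (rule sum.cong[OF refl vf])
        also have "\<dots> = (\<Sum>a\<in>{a\<in>I r. v' r a \<noteq> 0}. q' r a) - (\<Sum>a\<in>{a\<in>I r. v' r a \<noteq> 0}. if q' r a > s then 1 else 0)"
          by (rule sum_subtractf)
        also have "(\<Sum>a\<in>{a\<in>I r. v' r a \<noteq> 0}. if q' r a > s then 1 else 0 :: real)
            = real (card {a \<in> {a\<in>I r. v' r a \<noteq> 0}. q' r a > s})"
          using fin by (subst sum.inter_filter[symmetric]) auto
        also have "{a \<in> {a\<in>I r. v' r a \<noteq> 0}. q' r a > s} = {a\<in>I r. v' r a \<noteq> 0 \<and> q' r a > s}" by auto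
        finally show ?thesis unfolding X_def ..
      qed
      have dom: "\<bar>v' r a * (h (q' r a) * fs (q' r a))\<bar> \<le> - (v' r a * h (q' r a)) * 4" if a: "a \<in> I r" for a
      proof (cases "h (q' r a) = 0 \<or> v' r a = 0")
        case False
        then have "\<not> (q' r a \<le> 1/2 \<or> m \<le> q' r a)" using h0 by blast
        then have t: "1/2 < q' r a" "q' r a < 3/4" using m by linarith+
        have "v' r a = q' r a * (q' r a - 1)" using elim a False by (simp add: power2_eq_square algebra_simps)
        then have "v' r a \<le> 0" using t by (simp add: mult_le_0_iff)
        have "\<bar>fs (q' r a)\<bar> \<le> 4"
        proof (cases "q' r a \<le> s")
          case True
          have "\<bar>fs (q' r a)\<bar> = 1 / (1 - q' r a)"
            using True t by (simp add: fs_def abs_divide abs_minus_commute[of "q' r a" 1])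
          also have "\<dots> \<le> 4" using t by (subst pos_divide_le_eq) simp_all
          finally show ?thesis .
        next
          case False
          have "\<bar>fs (q' r a)\<bar> = 1 / q' r a" using False t by (simp add: fs_def)
          also have "\<dots> \<le> 4" using t by (subst pos_divide_le_eq) simp_all
          finally show ?thesis .
        qed
        have "\<bar>v' r a * (h (q' r a) * fs (q' r a))\<bar> = (- (v' r a) * h (q' r a)) * \<bar>fs (q' r a)\<bar>"
          using \<open>v' r a \<le> 0\<close> h_nonneg by (simp add: abs_mult)
        also have "\<dots> \<le> (- (v' r a) * h (q' r a)) * 4"
          using \<open>v' r a \<le> 0\<close> h_nonneg \<open>\<bar>fs (q' r a)\<bar> \<le> 4\<close> by (intro mult_left_mono mult_nonneg_nonneg) auto
        finally show ?thesis by simp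
      qed auto
      have "X r - (\<Sum>a\<in>I r. v' r a * f (q' r a)) = (\<Sum>a\<in>I r. v' r a * (h (q' r a) * fs (q' r a)))"
        unfolding X f_eq sum_subtractf[symmetric] by (rule sum.cong) (auto simp: algebra_simps)
      then have "\<bar>X r - (\<Sum>a\<in>I r. v' r a * f (q' r a))\<bar> \<le> (\<Sum>a\<in>I r. \<bar>v' r a * (h (q' r a) * fs (q' r a))\<bar>)"
        by simp
      also have "\<dots> \<le> (\<Sum>a\<in>I r. - (v' r a * h (q' r a)) * 4)" by (rule sum_mono[OF dom])
      also have "\<dots> = - (\<Sum>a\<in>I r. v' r a * h (q' r a)) * 4" by (simp add: sum_negf sum_distrib_right)
      also have "\<dots> \<le> \<bar>\<Sum>a\<in>I r. v' r a * h (q' r a)\<bar> * 4" by (rule mult_right_mono) auto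
      finally show ?case by simp
    qed
  qed
  from tendsto_add[OF this lim_f] have "(X \<longlongrightarrow> (\<Sum>\<^sub>\<infinity>e\<in>S. q e - (if q e > 1/2 then 1 else 0))) G" by simp
  then show thesis by (intro that[of s]) (simp add: X_def[abs_def])
qed

text \<open>One factor \<open>r\<close> of the polynomial is paid for with half of the exponent, the
  remaining polynomial with the other half; hence the induction with \<open>c\<close>
  arbitrary.\<close>

lemma poly_exp_tendsto_0:
  fixes p :: "real poly"
  assumes "c > 0"
  shows "((\<lambda>r. poly p r * exp (- c * r)) \<longlongrightarrow> 0) at_top"
  using assms
proof (induction p arbitrary: c)
  case 0
  then show ?case by simp
next
  case (pCons a p)
  have lin: "filterlim (\<lambda>r. (c / 2) * r) at_top at_top"
    by (rule filterlim_tendsto_pos_mult_at_top[OF tendsto_const _ filterlim_ident]) (use pCons.prems in simp)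
  have half: "c / 2 > 0" using pCons.prems by simp
  have neg: "exp (- (c / 2) * r) = 1 / exp ((c / 2) * r)" for r :: real
  proof -
    have "exp (- (c / 2) * r) = inverse (exp ((c / 2) * r))"
      unfolding exp_minus[symmetric] mult_minus_left ..
    then show ?thesis by (simp only: inverse_eq_divide)
  qed
  have "((\<lambda>r. ((c / 2) * r) ^ 1 / exp ((c / 2) * r)) \<longlongrightarrow> 0) at_top"
    by (rule filterlim_compose[OF tendsto_power_div_exp_0 lin])
  from tendsto_mult_left[OF this, of "2 / c"]
  have "((\<lambda>r. 2 / c * (((c / 2) * r) ^ 1 / exp ((c / 2) * r))) \<longlongrightarrow> 0) at_top" by (simp only: mult_zero_right)
  moreover have "2 / c * (((c / 2) * r) ^ 1 / exp ((c / 2) * r)) = r * exp (- (c / 2) * r)" for r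
    using pCons.prems unfolding neg by simp
  ultimately have 1: "((\<lambda>r. r * exp (- (c / 2) * r)) \<longlongrightarrow> 0) at_top" by (simp only:)
  have "((\<lambda>r. ((c / 2) * r) ^ 0 / exp ((c / 2) * r)) \<longlongrightarrow> 0) at_top"
    by (rule filterlim_compose[OF tendsto_power_div_exp_0 lin])
  then have 0: "((\<lambda>r. exp (- (c / 2) * r)) \<longlongrightarrow> 0) at_top" unfolding neg by simp
  have lim: "((\<lambda>r. a * (exp (- (c / 2) * r) * exp (- (c / 2) * r))
      + (r * exp (- (c / 2) * r)) * (poly p r * exp (- (c / 2) * r))) \<longlongrightarrow> a * (0 * 0) + 0 * 0) at_top"
    by (rule tendsto_add[OF tendsto_mult[OF tendsto_const tendsto_mult[OF 0 0]]
        tendsto_mult[OF 1 pCons.IH[OF half]]])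
  have "a * (exp (- (c / 2) * r) * exp (- (c / 2) * r)) + (r * exp (- (c / 2) * r)) * (poly p r * exp (- (c / 2) * r))
      = poly (pCons a p) r * exp (- c * r)" for r
  proof -
    have "exp (- c * r) = exp (- (c / 2) * r) * exp (- (c / 2) * r)"
      unfolding exp_add[symmetric] by simp
    moreover have "a * (E * E) + (r * E) * (P * E) = (a + r * P) * (E * E)" for E P :: real
      by (simp add: algebra_simps)
    ultimately show ?thesis unfolding poly_pCons by (simp only:)
  qed
  with lim show ?case unfolding mult_zero_right add_0_right by (simp only:)
qed

subsection \<open>Convergence of the truncated systems\<close>

text \<open>Split \<open>\<epsilon> powr (1/10)\<close> into two factors
  \<open>\<epsilon> powr (1/20)\<close>: one absorbs the growth of \<open>F\<close>, the other is
  exponentially small and beats the polynomial.\<close>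

lemma rho_poly_tendsto_0:
  fixes \<epsilon> \<rho> F :: "real \<Rightarrow> real" and p pp :: "real poly"
  assumes eps_pos: "\<And>r. r > 0 \<Longrightarrow> \<epsilon> r > 0"
    and eps_decay: "c > 0" "\<And>r. r > 0 \<Longrightarrow> \<epsilon> r \<le> poly p r * exp (- c * r)"
    and F_growth: "\<And>a. a > 0 \<Longrightarrow> ((\<lambda>t. F t / t powr a) \<longlongrightarrow> 0) at_top"
    and rho: "\<And>r. r > 0 \<Longrightarrow> \<rho> r = F (1 / \<epsilon> r) * \<epsilon> r powr (1 / 10)"
  shows "((\<lambda>r. poly pp r * \<rho> r) \<longlongrightarrow> 0) at_top"
proof -
  have pos: "\<forall>\<^sub>F r in at_top. (r :: real) > 0" by (rule eventually_gt_at_top)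
  have eps0: "(\<epsilon> \<longlongrightarrow> 0) at_top"
  proof (rule tendsto_sandwich[OF _ _ tendsto_const poly_exp_tendsto_0[OF eps_decay(1)]])
    show "\<forall>\<^sub>F r in at_top. 0 \<le> \<epsilon> r" by (rule eventually_mono[OF pos]) (use eps_pos less_imp_le in blast)
    show "\<forall>\<^sub>F r in at_top. \<epsilon> r \<le> poly p r * exp (- c * r)" by (rule eventually_mono[OF pos]) (rule eps_decay(2))
  qed
  have "filterlim (\<lambda>r. inverse (\<epsilon> r)) at_top at_top"
    by (rule filterlim_inverse_at_top[OF eps0]) (rule eventually_mono[OF pos], rule eps_pos)
  then have inv: "filterlim (\<lambda>r. 1 / \<epsilon> r) at_top at_top" by (simp only: inverse_eq_divide)
  define G where "G r = F (1 / \<epsilon> r) / (1 / \<epsilon> r) powr (1 / 20)" for r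
  have G: "(G \<longlongrightarrow> 0) at_top"
    unfolding G_def by (rule filterlim_compose[OF F_growth inv]) simp
  \<comment> \<open>Half of the decay rate cancels \<open>p\<close>, leaving
    \<open>\<epsilon> \<le> exp (- (c/2) * r)\<close>; the power 1/20 turns the rate into
    \<open>c/40\<close>.\<close>
  have small: "\<epsilon> r powr (1 / 20) \<le> exp (- (c / 40) * r)"
    if r: "r > 0" and p: "poly p r * exp (- (c / 2) * r) < 1" for r
  proof -
    have "poly p r * exp (- c * r) = (poly p r * exp (- (c / 2) * r)) * exp (- (c / 2) * r)"
      unfolding mult.assoc exp_add[symmetric] by simp
    also have "\<dots> \<le> 1 * exp (- (c / 2) * r)" using p by (intro mult_right_mono) auto
    finally have "\<epsilon> r \<le> exp (- (c / 2) * r)" using eps_decay(2)[OF r] by linarith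
    then have "\<epsilon> r powr (1 / 20) \<le> exp (- (c / 2) * r) powr (1 / 20)"
      using eps_pos[OF r] by (intro powr_mono2) auto
    then show ?thesis by (simp add: powr_def)
  qed
  have c': "c / 2 > 0" "c / 40 > 0" using eps_decay(1) by simp_all
  have lt1: "\<forall>\<^sub>F r in at_top. poly p r * exp (- (c / 2) * r) < 1"
    by (rule order_tendstoD(2)[OF poly_exp_tendsto_0[OF c'(1)]]) simp
  have "((\<lambda>r. poly pp r * \<epsilon> r powr (1 / 20)) \<longlongrightarrow> 0) at_top"
  proof (rule Lim_null_comparison)
    show "((\<lambda>r. \<bar>poly pp r * exp (- (c / 40) * r)\<bar>) \<longlongrightarrow> 0) at_top"
      using tendsto_rabs[OF poly_exp_tendsto_0[OF c'(2)]] by (simp only: abs_zero)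
    show "\<forall>\<^sub>F r in at_top. norm (poly pp r * \<epsilon> r powr (1 / 20)) \<le> \<bar>poly pp r * exp (- (c / 40) * r)\<bar>"
      using pos lt1
    proof eventually_elim
      case (elim r)
      show ?case using mult_left_mono[OF small[OF elim], of "\<bar>poly pp r\<bar>"] by (simp add: abs_mult)
    qed
  qed
  from tendsto_mult[OF G this] have "((\<lambda>r. G r * (poly pp r * \<epsilon> r powr (1 / 20))) \<longlongrightarrow> 0) at_top" by simp
  moreover have "\<forall>\<^sub>F r in at_top. G r * (poly pp r * \<epsilon> r powr (1 / 20)) = poly pp r * \<rho> r"
    using pos
  proof eventually_elim
    case (elim r)
    have e: "\<epsilon> r > 0" using eps_pos elim by blast
    have "(1 / \<epsilon> r) powr (1 / 20) = 1 / \<epsilon> r powr (1 / 20)" using e by (simp add: powr_divide)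
    moreover have "\<epsilon> r powr (1 / 20) * \<epsilon> r powr (1 / 20) = \<epsilon> r powr (1 / 10)"
      using e by (simp add: powr_add[symmetric])
    ultimately show ?case unfolding G_def rho[OF elim] by (simp add: mult_ac)
  qed
  ultimately show ?thesis by (rule Lim_transform_eventually)
qed

text \<open>Deliberately crude: the number of entries times the entrywise error. It suffices because
  the dimension grows polynomially and \<open>\<rho>\<close> beats every polynomial.\<close>

lemma kernel_difference_sum:
  fixes K L X :: "'i \<Rightarrow> 'i \<Rightarrow> complex"
  assumes I: "finite I" and K: "\<And>x y. K x y \<noteq> 0 \<Longrightarrow> x \<in> I \<and> y \<in> I" and L: "\<And>x y. L x y \<noteq> 0 \<Longrightarrow> x \<in> I \<and> y \<in> I"
    and diff: "\<And>x y. cmod (K x y - L x y) \<le> d" and X: "\<And>x y. cmod (X x y) \<le> b"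
  shows "cmod ((\<Sum>\<^sub>\<infinity>(x, y). K x y * X x y) - (\<Sum>\<^sub>\<infinity>(x, y). L x y * X x y)) \<le> (real (card I))\<^sup>2 * d * b"
proof -
  have fin: "(\<Sum>\<^sub>\<infinity>(x, y). N x y * X x y) = (\<Sum>z\<in>I \<times> I. N (fst z) (snd z) * X (fst z) (snd z))"
    if N: "\<And>x y. N x y \<noteq> 0 \<Longrightarrow> x \<in> I \<and> y \<in> I" for N
  proof (rule infsumI, rule has_sum_finite_neutralI)
    show "finite (I \<times> I)" using I by simp
    fix z assume "z \<in> UNIV - I \<times> I"
    then have "N (fst z) (snd z) = 0" using N by (cases z) auto
    then show "(case z of (x, y) \<Rightarrow> N x y * X x y) = 0" by (simp add: case_prod_unfold)
  qed (auto simp: case_prod_unfold)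
  have finK: "(\<Sum>\<^sub>\<infinity>(x, y). K x y * X x y) = (\<Sum>z\<in>I \<times> I. K (fst z) (snd z) * X (fst z) (snd z))"
    by (rule fin) (rule K)
  have finL: "(\<Sum>\<^sub>\<infinity>(x, y). L x y * X x y) = (\<Sum>z\<in>I \<times> I. L (fst z) (snd z) * X (fst z) (snd z))"
    by (rule fin) (rule L)
  have d: "0 \<le> d" by (rule order_trans[OF norm_ge_zero diff])
  have "cmod ((\<Sum>\<^sub>\<infinity>(x, y). K x y * X x y) - (\<Sum>\<^sub>\<infinity>(x, y). L x y * X x y))
      = cmod (\<Sum>z\<in>I \<times> I. (K (fst z) (snd z) - L (fst z) (snd z)) * X (fst z) (snd z))"
    unfolding finK finL by (simp add: sum_subtractf left_diff_distrib)
  also have "\<dots> \<le> (\<Sum>z\<in>I \<times> I. d * b)"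
    by (rule sum_norm_le) (unfold norm_mult, intro mult_mono diff X d norm_ge_zero)
  also have "\<dots> = (real (card I))\<^sup>2 * d * b" by (simp add: card_cartesian_product power2_eq_square)
  finally show ?thesis .
qed

lemma nth_span_proj_delta: "nth_ell2 (span_proj A delta f) z = (if z \<in> A then nth_ell2 f z else 0)"
proof -
  have "orthonormal_family UNIV (delta :: 'a \<Rightarrow> 'a ell2)"
    by (rule orthonormal_basis_family[OF orthonormal_basis_delta])
  from cinner_basis_span_proj[OF this subset_UNIV UNIV_I] show ?thesis by simp
qed

lemma orthonormal_family_delta: "orthonormal_family A delta"
  by (rule orthonormal_family_subset[OF orthonormal_basis_family[OF orthonormal_basis_delta]]) simp

lemma span_proj_disk_tendsto:
  fixes f :: "(site \<times> 'n::finite) ell2"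
  shows "((\<lambda>r. span_proj (disk v r \<times> UNIV) delta f) \<longlongrightarrow> f) at_top"
proof -
  have "((\<lambda>F. \<Sum>x\<in>F. nth_ell2 f x *\<^sub>c delta x) \<longlongrightarrow> f) (finite_subsets_at_top UNIV)"
    using has_sum_delta[of f] unfolding has_sum_def .
  from filterlim_compose[OF this filterlim_disk_blocks]
  show ?thesis by (simp add: span_proj_def finite_disk)
qed

lemma norm_funpow_le:
  fixes U :: "'a :: real_normed_vector \<Rightarrow> 'a"
  assumes "\<And>f. norm (U f) \<le> B * norm f" "B \<ge> 0"
  shows "norm ((U ^^ m) f) \<le> B ^ m * norm f"
proof (induction m)
  case (Suc m)
  have "norm ((U ^^ Suc m) f) \<le> B * norm ((U ^^ m) f)" using assms(1) by simp
  also have "\<dots> \<le> B * (B ^ m * norm f)" by (rule mult_left_mono[OF Suc assms(2)])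
  finally show ?case by (simp add: mult.assoc)
qed simp

text \<open>\<open>T\<close> stands for \<open>Q\<close>, and \<open>TQ r\<close>,
  \<open>TV r\<close> for the commuting approximants. The rates of decay enter only through
  \<open>rho\<close>, smallness of \<open>\<rho>\<close> against every polynomial.\<close>

locale half_flux_limit = half_flux_model P vert l C1 C2
  for P :: "'n::finite opr" and vert l C1 C2 +
  fixes T :: "(site \<times> 'n) ell2 \<Rightarrow> (site \<times> 'n) ell2" and TQ TV :: "real \<Rightarrow> (site \<times> 'n) ell2 \<Rightarrow> (site \<times> 'n) ell2"
    and e :: "real \<Rightarrow> site \<times> 'n \<Rightarrow> (site \<times> 'n) ell2" and q v :: "real \<Rightarrow> site \<times> 'n \<Rightarrow> real"
    and \<rho> :: "real \<Rightarrow> real"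
  assumes T: "symmetric_op T" "half_flux l P = opr_of T"
    and T_V: "\<And>z w. entry (\<lambda>f. T (T f) - T f) z w = V_limit z w"
    and system: "\<And>r. r > 0 \<Longrightarrow> finite_eigensystem (disk vert r) (TQ r) (TV r) (e r) (q r) (v r)"
    and Q_close: "\<And>r. r > 0 \<Longrightarrow> op_norm (truncQ vert l P r - opr_of (TQ r)) \<le> (\<rho> r)\<^sup>2"
    and V_close: "\<And>r. r > 0 \<Longrightarrow> op_norm (truncV vert l P r - opr_of (TV r)) \<le> \<rho> r"
    and rho: "\<And>p. ((\<lambda>r. poly p r * \<rho> r) \<longlongrightarrow> 0) at_top"
    and rel: "\<And>r a. r > 0 \<Longrightarrow> a \<in> disk vert r \<times> UNIV \<Longrightarrow> v r a \<noteq> 0 \<Longrightarrow> v r a = (q r a)\<^sup>2 - q r a"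
begin

abbreviation I :: "real \<Rightarrow> (site \<times> 'n) set" where "I r \<equiv> disk vert r \<times> UNIV"

lemma rho_tendsto: "(\<rho> \<longlongrightarrow> 0) at_top"
  using rho[of 1] by simp

lemma card_rho_tendsto: "((\<lambda>r. (real (card (I r)))\<^sup>2 * \<rho> r) \<longlongrightarrow> 0) at_top"
proof (rule Lim_null_comparison)
  let ?b = "2 * (\<bar>fst vert\<bar> + \<bar>snd vert\<bar>) + 3"
  \<comment> \<open>The disk has at most a squared linear function of \<open>r\<close> many sites,
    and the dimension is squared again; this explains the fourth power.\<close>
  let ?p = "smult ((real CARD('n))\<^sup>2) ([:?b, 2:] ^ 4)"
  show "((\<lambda>r. \<bar>poly ?p r * \<rho> r\<bar>) \<longlongrightarrow> 0) at_top" using tendsto_rabs[OF rho[of ?p]] by (simp only: abs_zero)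
  show "\<forall>\<^sub>F r in at_top. norm ((real (card (I r)))\<^sup>2 * \<rho> r) \<le> \<bar>poly ?p r * \<rho> r\<bar>"
    using eventually_gt_at_top[of 0]
  proof eventually_elim
    case (elim r)
    have "real (card (disk vert r)) \<le> (poly [:?b, 2:] r)\<^sup>2" using card_disk_le[OF elim, of vert] by (simp add: algebra_simps)
    then have "(real (card (disk vert r)))\<^sup>2 \<le> ((poly [:?b, 2:] r)\<^sup>2)\<^sup>2" by (rule power_mono) simp
    then have "(real (card (I r)))\<^sup>2 \<le> poly ?p r"
      by (simp add: card_cartesian_product power_mult_distrib poly_power mult.commute mult_left_mono power_mult[symmetric]
          del: poly_pCons)
    then show ?case by (simp add: abs_mult mult_right_mono)
  qed
qed

text \<open>Compression of \<open>Q\<close> to the disk, whose matrix is \<open>truncQ\<close>; it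
  links the full operator with the approximant \<open>TQ r\<close>.\<close>

definition TN :: "real \<Rightarrow> (site \<times> 'n) ell2 \<Rightarrow> (site \<times> 'n) ell2" where
  "TN r f = span_proj (I r) delta (T (span_proj (I r) delta f))"

lemma symmetric_op_TN: "symmetric_op (TN r)"
proof -
  let ?p = "span_proj (I r) delta"
  have p: "symmetric_op ?p" by (rule symmetric_op_span_proj[OF orthonormal_family_delta])
  obtain M where M: "M \<ge> 0" "\<And>f. norm (T f) \<le> M * norm f" using symmetric_op_bounded[OF T(1)] by blast
  have np: "norm (?p f) \<le> norm f" for f by (rule norm_span_proj_le[OF orthonormal_family_delta])
  have "norm (TN r f) \<le> M * norm f" for f
    unfolding TN_def using np[of "T (?p f)"] M(2)[of "?p f"] mult_left_mono[OF np M(1), of f] by linarith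
  moreover have "cinner f (TN r g) = cinner (TN r f) g" for f g
    unfolding TN_def by (simp only: symmetric_opD[OF p] symmetric_opD[OF T(1)])
  ultimately show ?thesis unfolding symmetric_op_def by blast
qed

lemma opr_of_TN: "opr_of (TN r) = truncQ vert l P r"
proof -
  have sd: "span_proj (I r) delta (delta w) = (if w \<in> I r then delta w else 0)" for w
    by (rule ell2_eqI) (simp add: nth_span_proj_delta nth_delta)
  have "entry (TN r) z w = (if z \<in> I r \<and> w \<in> I r then entry T z w else 0)" for z w
    by (simp add: entry_def TN_def nth_span_proj_delta sd symmetric_op_zero_arg[OF T(1)])
  then show ?thesis by (auto simp: opr_eq_iff truncQ_def T(2))
qed

lemma TQ: "r > 0 \<Longrightarrow> symmetric_op (TQ r)" and TV: "r > 0 \<Longrightarrow> symmetric_op (TV r)"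
  using system unfolding finite_eigensystem_def by blast+

lemma TQ_close:
  assumes "r > 0"
  shows "norm (TN r f - TQ r f) \<le> (\<rho> r)\<^sup>2 * norm f"
proof -
  have s: "symmetric_op (\<lambda>f. TN r f - TQ r f)" by (rule symmetric_op_minus[OF symmetric_op_TN TQ[OF assms]])
  have "opr_of (\<lambda>f. TN r f - TQ r f) = truncQ vert l P r - opr_of (TQ r)"
    unfolding opr_of_TN[symmetric] by (simp add: opr_eq_iff entry_def)
  then have "norm (TN r f - TQ r f) \<le> op_norm (truncQ vert l P r - opr_of (TQ r)) * norm f"
    using norm_le_op_norm[OF s, of f] by simp
  also have "\<dots> \<le> (\<rho> r)\<^sup>2 * norm f" by (rule mult_right_mono[OF Q_close[OF assms]]) simp
  finally show ?thesis .
qed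

lemma V_term_swap: "V_term w z u = cnj (V_term z w u)"
proof -
  obtain TP where TP: "symmetric_op TP" "P = opr_of TP"
    using symmetric_op_of_opr proj unfolding orthogonal_projection_def by blast
  have h: "P_entry w z = cnj (P_entry z w)" for z w
    using hermitian_opr_of[OF TP(1), folded TP(2)] unfolding P_entry_def hermitian_def by blast
  have "flux_sign3 l (fst w) (fst z) (fst u) = flux_sign3 l (fst z) (fst w) (fst u)"
    unfolding flux_sign3_def flux_sign_commute[of l "fst w" "fst z"] flux_sign_commute[of l "fst z" "fst u"]
      flux_sign_commute[of l "fst u" "fst w"] by simp
  then show ?thesis
    unfolding V_term_def by (simp add: flux_sign_commute[of l "fst w" "fst z"] h[of w u] h[of u z] mult.commute)
qed

text \<open>Makes the difference between the truncated \<open>V\<close> and \<open>TV r\<close>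
  Hermitian, so that its operator norm bounds its entries.\<close>

lemma V_trunc_swap: "V_trunc r w z = cnj (V_trunc r z w)"
  by (simp add: V_trunc_eq V_term_swap[of w z] conj_commute)

lemma V_trunc_support: "V_trunc r z w \<noteq> 0 \<Longrightarrow> z \<in> I r \<and> w \<in> I r"
  unfolding V_trunc_eq by (cases z; cases w) (simp split: if_splits)

lemma TV_support: "r > 0 \<Longrightarrow> entry (TV r) z w \<noteq> 0 \<Longrightarrow> z \<in> I r \<and> w \<in> I r"
  using finite_eigensystem.V_support[OF system, of r z w] by (cases z; cases w) simp

lemma TV_close:
  assumes r: "r > 0"
  shows "cmod (entry (TV r) z w - V_trunc r z w) \<le> \<rho> r"
proof -
  let ?A = "truncV vert l P r - opr_of (TV r)"
  have A: "?A x y $ i $ j = V_trunc r (x, i) (y, j) - entry (TV r) (x, i) (y, j)" for x y i j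
    by (simp add: V_trunc_def)
  have "supported_on (disk vert r) ?A"
    unfolding supported_on_def
  proof (intro allI impI)
    fix x y assume xy: "x \<notin> disk vert r \<or> y \<notin> disk vert r"
    have "?A x y $ i $ j = 0" for i j
    proof -
      have "V_trunc r (x, i) (y, j) = 0" using xy V_trunc_support[of r "(x, i)" "(y, j)"] by auto
      moreover have "entry (TV r) (x, i) (y, j) = 0" using xy TV_support[OF r, of "(x, i)" "(y, j)"] by auto
      ultimately show ?thesis unfolding A by simp
    qed
    then show "?A x y = 0" by (simp only: vec_eq_iff zero_index simp_thms)
  qed
  moreover have "hermitian ?A"
    unfolding hermitian_def A using V_trunc_swap entry_hermitian[OF TV[OF r]] by (metis complex_cnj_diff)
  ultimately obtain U where U: "symmetric_op U" "?A = opr_of U"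
    by (rule symmetric_op_of_finite_opr[OF finite_disk])
  have "cmod (entry (TV r) z w - V_trunc r z w) = cmod (entry U z w)"
    using A[of "fst z" "fst w" "snd z" "snd w"] unfolding U(2) by (simp add: norm_minus_commute)
  also have "\<dots> \<le> norm (U (delta w))" unfolding entry_def by (rule norm_nth_ell2_le)
  also have "\<dots> \<le> op_norm ?A" using norm_le_op_norm[OF U(1), of "delta w"] by (simp add: U(2))
  also have "\<dots> \<le> \<rho> r" by (rule V_close[OF r])
  finally show ?thesis .
qed

lemma TQ_bounded: "\<exists>B\<ge>0. (\<forall>f. norm (T f) \<le> B * norm f) \<and> (\<forall>\<^sub>F r in at_top. \<forall>f. norm (TQ r f) \<le> B * norm f)"
proof -
  obtain M where M: "M \<ge> 0" "\<And>f. norm (T f) \<le> M * norm f" using symmetric_op_bounded[OF T(1)] by blast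
  have np: "norm (span_proj (I r) delta f) \<le> norm f" for r f by (rule norm_span_proj_le[OF orthonormal_family_delta])
  have TN: "norm (TN r f) \<le> M * norm f" for r f
    unfolding TN_def using np[of r "T (span_proj (I r) delta f)"] M(2)[of "span_proj (I r) delta f"]
      mult_left_mono[OF np M(1), of r f] by linarith
  have "\<forall>\<^sub>F r in at_top. (\<rho> r)\<^sup>2 < 1"
    by (rule order_tendstoD(2)[where y = "0\<^sup>2", OF tendsto_power[OF rho_tendsto]]) simp
  then have "\<forall>\<^sub>F r in at_top. \<forall>f. norm (TQ r f) \<le> (M + 1) * norm f"
    using eventually_gt_at_top[of 0]
  proof eventually_elim
    case (elim r)
    show ?case
    proof
      fix f
      have "norm (TQ r f) \<le> norm (TN r f) + norm (TN r f - TQ r f)"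
        using norm_triangle_ineq4[of "TN r f" "TN r f - TQ r f"] by simp
      also have "\<dots> \<le> M * norm f + (\<rho> r)\<^sup>2 * norm f" by (intro add_mono TN TQ_close elim)
      also have "\<dots> \<le> M * norm f + 1 * norm f" using elim by (intro add_left_mono mult_right_mono) auto
      finally show "norm (TQ r f) \<le> (M + 1) * norm f" by (simp add: distrib_right)
    qed
  qed
  moreover have "norm (T f) \<le> (M + 1) * norm f" for f
    using M(2)[of f] by (simp add: distrib_right) (use norm_ge_zero[of f] in linarith)
  ultimately show ?thesis using M(1) by (intro exI[of _ "M + 1"]) auto
qed

text \<open>Convergence holds on each fixed vector: projections onto disks tend strongly to the
  identity, and the distance of \<open>TQ r\<close> from the compression is at most the square of
  \<open>\<rho>\<close>. Fixed lattice vectors are all that the entrywise limit below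
  requires.\<close>

lemma TQ_tendsto: "((\<lambda>r. TQ r f) \<longlongrightarrow> T f) at_top"
proof -
  obtain M where M: "M \<ge> 0" "\<And>f. norm (T f) \<le> M * norm f" using symmetric_op_bounded[OF T(1)] by blast
  let ?p = "\<lambda>r. span_proj (I r) delta"
  have np: "norm (?p r f) \<le> norm f" for r f by (rule norm_span_proj_le[OF orthonormal_family_delta])
  have TN: "((\<lambda>r. TN r f) \<longlongrightarrow> T f) at_top"
  proof -
    have "((\<lambda>r. T (?p r f)) \<longlongrightarrow> T f) at_top"
      by (rule bounded_linear.tendsto[OF bounded_linear_symmetric_op[OF T(1)] span_proj_disk_tendsto])
    then have "((\<lambda>r. T (?p r f) - T f) \<longlongrightarrow> 0) at_top" by (simp add: LIM_zero_iff)
    then have "((\<lambda>r. ?p r (T (?p r f) - T f)) \<longlongrightarrow> 0) at_top"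
      by (rule Lim_null_comparison[OF always_eventually tendsto_norm_zero, rotated]) (intro allI np)
    from tendsto_add[OF this span_proj_disk_tendsto[of vert "T f"]]
    show ?thesis
      by (simp add: TN_def symmetric_op_diff_arg[OF symmetric_op_span_proj[OF orthonormal_family_delta]])
  qed
  have "((\<lambda>r. TN r f - TQ r f) \<longlongrightarrow> 0) at_top"
  proof (rule Lim_null_comparison)
    show "((\<lambda>r. (\<rho> r)\<^sup>2 * norm f) \<longlongrightarrow> 0) at_top"
      using tendsto_mult_right[OF tendsto_power[OF rho_tendsto, of 2], of "norm f"] by simp
    show "\<forall>\<^sub>F r in at_top. norm (TN r f - TQ r f) \<le> (\<rho> r)\<^sup>2 * norm f"
      by (rule eventually_mono[OF eventually_gt_at_top[of 0]]) (rule TQ_close)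
  qed
  from tendsto_diff[OF TN this] show ?thesis by simp
qed

text \<open>Strong limits multiply because the norms of \<open>TQ r\<close> are eventually uniformly
  bounded.\<close>

lemma TQ_funpow_tendsto: "((\<lambda>r. (TQ r ^^ m) f) \<longlongrightarrow> (T ^^ m) f) at_top"
proof (induction m)
  case (Suc m)
  obtain B where B: "B \<ge> 0" "\<forall>\<^sub>F r in at_top. \<forall>f. norm (TQ r f) \<le> B * norm f" using TQ_bounded by blast
  have "((\<lambda>r. (TQ r ^^ m) f - (T ^^ m) f) \<longlongrightarrow> 0) at_top" using Suc by (simp add: LIM_zero_iff)
  then have lim: "((\<lambda>r. B * norm ((TQ r ^^ m) f - (T ^^ m) f)) \<longlongrightarrow> 0) at_top"
    using tendsto_mult_left[OF tendsto_norm_zero] by fastforce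
  have "((\<lambda>r. TQ r ((TQ r ^^ m) f - (T ^^ m) f)) \<longlongrightarrow> 0) at_top"
    by (rule Lim_null_comparison[OF eventually_mono[OF B(2)] lim]) blast
  from tendsto_add[OF this TQ_tendsto[of "(T ^^ m) f"]]
  have "((\<lambda>r. TQ r ((TQ r ^^ m) f - (T ^^ m) f) + TQ r ((T ^^ m) f)) \<longlongrightarrow> T ((T ^^ m) f)) at_top" by simp
  moreover have "\<forall>\<^sub>F r in at_top. TQ r ((TQ r ^^ m) f - (T ^^ m) f) + TQ r ((T ^^ m) f) = (TQ r ^^ Suc m) f"
    by (rule eventually_mono[OF eventually_gt_at_top[of 0]]) (simp add: symmetric_op_diff_arg[OF TQ])
  ultimately show ?case by (simp add: Lim_transform_eventually)
qed simp

text \<open>Exchange \<open>TV r\<close> for the truncated kernel at a cost of dimension squared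
  times \<open>\<rho>\<close> times \<open>B ^ m\<close>; the truncated kernel is dominated by
  \<open>V_bound\<close> for every \<open>r\<close>, and all entries converge.\<close>

lemma moment_tendsto:
  "((\<lambda>r. \<Sum>a\<in>I r. of_real (q r a ^ m) * complex_of_real (v r a)) \<longlongrightarrow>
    (\<Sum>\<^sub>\<infinity>(x, y). V_limit x y * nth_ell2 ((T ^^ m) (delta x)) y)) at_top"
proof -
  obtain B where B: "B \<ge> 0" "\<forall>\<^sub>F r in at_top. \<forall>f. norm (TQ r f) \<le> B * norm f" using TQ_bounded by blast
  let ?X = "\<lambda>r x y. nth_ell2 ((TQ r ^^ m) (delta x)) y"
  have X_le: "cmod (?X r x y) \<le> B ^ m" if "\<forall>f. norm (TQ r f) \<le> B * norm f" for r x y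
  proof -
    have "norm ((TQ r ^^ m) (delta x)) \<le> B ^ m * norm (delta x)" by (rule norm_funpow_le) (use that B(1) in auto)
    then show ?thesis using norm_nth_ell2_le[of "(TQ r ^^ m) (delta x)" y] by simp
  qed
  have lim: "((\<lambda>r. \<Sum>\<^sub>\<infinity>z. (case z of (x, y) \<Rightarrow> V_trunc r x y * ?X r x y)) \<longlongrightarrow>
      (\<Sum>\<^sub>\<infinity>z. (case z of (x, y) \<Rightarrow> V_limit x y * nth_ell2 ((T ^^ m) (delta x)) y))) at_top"
  proof (rule infsum_dominated_tendsto)
    show "(\<lambda>z. (case z of (x, y) \<Rightarrow> V_bound x y) * B ^ m) summable_on UNIV"
      by (rule summable_on_cmult_left[OF summable_V_bound])
    show "\<forall>\<^sub>F r in at_top. \<forall>z. norm (case z of (x, y) \<Rightarrow> V_trunc r x y * ?X r x y) \<le> (case z of (x, y) \<Rightarrow> V_bound x y) * B ^ m"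
      using B(2)
    proof eventually_elim
      case (elim r)
      have "cmod (V_trunc r x y) * cmod (?X r x y) \<le> V_bound x y * B ^ m" for x y
        by (intro mult_mono V_trunc_le X_le elim norm_ge_zero order_trans[OF norm_ge_zero V_limit_le])
      then show ?case by (simp add: case_prod_unfold norm_mult)
    qed
    show "((\<lambda>r. case z of (x, y) \<Rightarrow> V_trunc r x y * ?X r x y) \<longlongrightarrow>
        (case z of (x, y) \<Rightarrow> V_limit x y * nth_ell2 ((T ^^ m) (delta x)) y)) at_top" for z
      unfolding case_prod_unfold
      by (intro tendsto_mult V_trunc_tendsto bounded_linear.tendsto[OF bounded_linear_nth] TQ_funpow_tendsto)
  qed simp
  have "((\<lambda>r. (\<Sum>\<^sub>\<infinity>(x, y). entry (TV r) x y * ?X r x y) - (\<Sum>\<^sub>\<infinity>(x, y). V_trunc r x y * ?X r x y)) \<longlongrightarrow> 0) at_top"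
  proof (rule Lim_null_comparison)
    show "((\<lambda>r. (real (card (I r)))\<^sup>2 * \<rho> r * B ^ m) \<longlongrightarrow> 0) at_top"
      using tendsto_mult_right[OF card_rho_tendsto, of "B ^ m"] by simp
    show "\<forall>\<^sub>F r in at_top. norm ((\<Sum>\<^sub>\<infinity>(x, y). entry (TV r) x y * ?X r x y) - (\<Sum>\<^sub>\<infinity>(x, y). V_trunc r x y * ?X r x y))
        \<le> (real (card (I r)))\<^sup>2 * \<rho> r * B ^ m"
      using B(2) eventually_gt_at_top[of 0]
    proof eventually_elim
      case (elim r)
      show ?case
        by (rule kernel_difference_sum[OF _ TV_support[OF elim(2)] V_trunc_support TV_close[OF elim(2)] X_le[OF elim(1)]])
          (use finite_disk in auto)
    qed
  qed
  from tendsto_add[OF this lim] have "((\<lambda>r. \<Sum>\<^sub>\<infinity>(x, y). entry (TV r) x y * ?X r x y) \<longlongrightarrow>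
      (\<Sum>\<^sub>\<infinity>(x, y). V_limit x y * nth_ell2 ((T ^^ m) (delta x)) y)) at_top"
    by (simp only: diff_add_cancel add_0)
  then show ?thesis
  proof (rule Lim_transform_eventually)
    show "\<forall>\<^sub>F r in at_top. (\<Sum>\<^sub>\<infinity>(x, y). entry (TV r) x y * ?X r x y)
        = (\<Sum>a\<in>I r. of_real (q r a ^ m) * complex_of_real (v r a))"
      by (rule eventually_mono[OF eventually_gt_at_top[of 0]])
        (rule finite_eigensystem.moment_trace[OF system, symmetric])
  qed
qed

text \<open>The sum of moduli is the trace of \<open>TV r\<close> against its own sign operator,
  whose entries have modulus at most 2. So the same replacement by the truncated kernel yields a
  bound free of \<open>r\<close>.\<close>

lemma sum_abs_v_bounded: "\<exists>B. \<forall>\<^sub>F r in at_top. (\<Sum>a\<in>I r. \<bar>v r a\<bar>) \<le> B"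
proof -
  let ?C = "\<Sum>\<^sub>\<infinity>(x, y). V_bound x y"
  have "\<forall>\<^sub>F r in at_top. (real (card (I r)))\<^sup>2 * \<rho> r < 1"
    by (rule order_tendstoD(2)[OF card_rho_tendsto]) simp
  then have "\<forall>\<^sub>F r in at_top. (\<Sum>a\<in>I r. \<bar>v r a\<bar>) \<le> 2 * ?C + 2"
    using eventually_gt_at_top[of 0]
  proof eventually_elim
    case (elim r)
    interpret sys: finite_eigensystem "disk vert r" "TQ r" "TV r" "e r" "q r" "v r" by (rule system[OF elim(2)])
    let ?c = "\<lambda>a. complex_of_real (sgn (v r a))"
    let ?X = "\<lambda>x y. \<Sum>a\<in>I r. ?c a * (cnj (nth_ell2 (e r a) x) * nth_ell2 (e r a) y)"
    have X: "cmod (?X x y) \<le> 2" for x y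
    proof -
      have "cmod (?X x y) \<le> (\<Sum>a\<in>I r. cmod (cnj (nth_ell2 (e r a) x) * nth_ell2 (e r a) y))"
        by (rule sum_norm_le) (simp add: norm_mult abs_sgn_eq)
      also have "\<dots> \<le> 2" using summable_nth_products_family(2)[OF sys.on, of x y] sys.finite_I by simp
      finally show ?thesis .
    qed
    have abs: "complex_of_real (\<Sum>a\<in>I r. \<bar>v r a\<bar>) = (\<Sum>\<^sub>\<infinity>(x, y). entry (TV r) x y * ?X x y)"
    proof -
      have "(\<Sum>a\<in>I r. ?c a * complex_of_real (v r a)) = (\<Sum>\<^sub>\<infinity>(x, y). entry (TV r) x y * ?X x y)"
        by (rule sys.weighted_trace[where B = 1]) (simp add: abs_sgn_eq)
      moreover have "?c a * complex_of_real (v r a) = complex_of_real \<bar>v r a\<bar>" for a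
        by (simp only: of_real_mult[symmetric] sgn_mult_self_eq abs_sgn mult.commute)
      ultimately show ?thesis by (simp only: of_real_sum)
    qed
    have diff: "cmod ((\<Sum>\<^sub>\<infinity>(x, y). entry (TV r) x y * ?X x y) - (\<Sum>\<^sub>\<infinity>(x, y). V_trunc r x y * ?X x y))
        \<le> (real (card (I r)))\<^sup>2 * \<rho> r * 2"
      by (rule kernel_difference_sum[OF sys.finite_I TV_support[OF elim(2)] V_trunc_support TV_close[OF elim(2)] X])
    have "cmod (\<Sum>\<^sub>\<infinity>(x, y). V_trunc r x y * ?X x y) \<le> ?C * 2"
    proof -
      have s: "(\<lambda>z. (case z of (x, y) \<Rightarrow> V_bound x y) * 2) summable_on UNIV"
        by (rule summable_on_cmult_left[OF summable_V_bound])
      have le: "cmod (case z of (x, y) \<Rightarrow> V_trunc r x y * ?X x y) \<le> (case z of (x, y) \<Rightarrow> V_bound x y) * 2" for z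
      proof -
        have "cmod (V_trunc r x y) * cmod (?X x y) \<le> V_bound x y * 2" for x y
          by (intro mult_mono V_trunc_le X norm_ge_zero order_trans[OF norm_ge_zero V_limit_le])
        then show ?thesis by (simp add: case_prod_unfold norm_mult)
      qed
      have "cmod (\<Sum>\<^sub>\<infinity>z. (case z of (x, y) \<Rightarrow> V_trunc r x y * ?X x y)) \<le> (\<Sum>\<^sub>\<infinity>z. (case z of (x, y) \<Rightarrow> V_bound x y) * 2)"
      proof (rule norm_infsum_le[OF has_sum_infsum has_sum_infsum[OF s] le])
        show "(\<lambda>z. case z of (x, y) \<Rightarrow> V_trunc r x y * ?X x y) summable_on UNIV"
          by (rule abs_summable_summable, rule summable_on_comparison_test[OF s le]) simp
      qed
      also have "\<dots> = ?C * 2" by (rule infsum_cmult_left')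
      finally show ?thesis .
    qed
    then have "cmod (complex_of_real (\<Sum>a\<in>I r. \<bar>v r a\<bar>)) \<le> ?C * 2 + (real (card (I r)))\<^sup>2 * \<rho> r * 2"
      unfolding abs using diff norm_triangle_sub[of "\<Sum>\<^sub>\<infinity>(x, y). entry (TV r) x y * ?X x y"
        "\<Sum>\<^sub>\<infinity>(x, y). V_trunc r x y * ?X x y"] by linarith
    also have "\<dots> \<le> 2 * ?C + 2" using elim(1) by linarith
    finally show ?case unfolding norm_of_real by linarith
  qed
  then show ?thesis by blast
qed

text \<open>The trace of \<open>V T^m\<close> is evaluated in the eigenbasis of \<open>T\<close> as
  the moment of order \<open>m\<close> of the values \<open>\<mu>\<close> with weights
  \<open>\<mu>^2 - \<mu>\<close>; together with the limits of the finite moments this feeds the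
  analytic lemma on vertex sums. Order 0 also gives summability of the weights.\<close>

theorem vertex_sum_limit:
  obtains s where "((\<lambda>r. (\<Sum>a\<in>{a\<in>I r. v r a \<noteq> 0}. q r a) - real (card {a\<in>I r. v r a \<noteq> 0 \<and> q r a > s}))
      \<longlongrightarrow> vertex_trace (half_flux l P)) at_top"
proof -
  let ?V = "\<lambda>f. T (T f) - T f"
  have V_eq: "entry ?V = V_limit" by (intro ext) (rule T_V)
  have kV: "summable_kernel (entry ?V)" unfolding V_eq by (rule summable_kernel_V_limit)
  have sV: "symmetric_op ?V" by (intro symmetric_op_minus symmetric_op_compose_self T(1))
  obtain S \<mu> where S: "orthonormal_basis S (\<lambda>e. e)" and \<mu>: "\<And>e. e \<in> S \<Longrightarrow> T e = \<mu> e *\<^sub>R e"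
    using eigenbasis_exists[OF T(1) kV] by blast
  have on: "orthonormal_family S (\<lambda>e. e)" by (rule orthonormal_basis_family[OF S])
  obtain B where B: "B \<ge> 0" "\<forall>f. norm (T f) \<le> B * norm f" "\<forall>\<^sub>F r in at_top. \<forall>f. norm (TQ r f) \<le> B * norm f"
    using TQ_bounded by blast
  have \<mu>_le: "\<bar>\<mu> e\<bar> \<le> B" if "e \<in> S" for e
    by (rule eigenvalue_bound[where T = T and e = "\<lambda>e. e" and q = \<mu>, OF on that \<mu>[OF that]]) (use B(2) in blast)
  have form: "kernel_form V_limit e = of_real ((\<mu> e)\<^sup>2 - \<mu> e)" if "e \<in> S" for e
  proof -
    have "kernel_form V_limit e = cinner e (?V e)" unfolding V_eq[symmetric] by (rule kernel_form_entry[OF sV kV])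
    also have "?V e = ((\<mu> e)\<^sup>2 - \<mu> e) *\<^sub>R e"
      using \<mu>[OF that] by (simp add: symmetric_op_scaleR[OF T(1)] power2_eq_square scaleR_diff_left)
    finally show ?thesis using orthonormal_familyD[OF on that that] by simp
  qed
  have moment: "((\<lambda>e. complex_of_real (\<mu> e ^ m) * kernel_form V_limit e) has_sum
      (\<Sum>\<^sub>\<infinity>(x, y). V_limit x y * nth_ell2 ((T ^^ m) (delta x)) y)) S"
    and abs_moment: "(\<lambda>e. cmod (complex_of_real (\<mu> e ^ m) * kernel_form V_limit e)) summable_on S" for m
  proof -
    have c: "cmod (complex_of_real (\<mu> e ^ m)) \<le> B ^ m" if "e \<in> S" for e
      using \<mu>_le[OF that] by (simp add: norm_power power_mono)
    have X: "((\<lambda>e. complex_of_real (\<mu> e ^ m) * (cnj (nth_ell2 e x) * nth_ell2 e y)) has_sum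
        nth_ell2 ((T ^^ m) (delta x)) y) S" for x y
      by (rule has_sum_funpow_entry[OF T(1) on \<mu> span_proj_basis[OF S]])
    show "((\<lambda>e. complex_of_real (\<mu> e ^ m) * kernel_form V_limit e) has_sum
        (\<Sum>\<^sub>\<infinity>(x, y). V_limit x y * nth_ell2 ((T ^^ m) (delta x)) y)) S"
      by (rule kernel_trace(1)[OF on summable_kernel_V_limit c X])
    show "(\<lambda>e. cmod (complex_of_real (\<mu> e ^ m) * kernel_form V_limit e)) summable_on S"
      by (rule kernel_trace(2)[OF on summable_kernel_V_limit c X])
  qed
  have v_sum: "(\<lambda>e. \<bar>(\<mu> e)\<^sup>2 - \<mu> e\<bar>) summable_on S"
  proof -
    have "cmod (complex_of_real (\<mu> e ^ 0) * kernel_form V_limit e) = \<bar>(\<mu> e)\<^sup>2 - \<mu> e\<bar>" if "e \<in> S" for e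
      unfolding form[OF that] power_0 of_real_1 mult_1 by (rule norm_of_real)
    then show ?thesis using abs_moment[of 0] by (simp cong: summable_on_cong)
  qed
  have lim: "((\<lambda>r. \<Sum>a\<in>I r. v r a * q r a ^ m) \<longlongrightarrow> (\<Sum>\<^sub>\<infinity>e\<in>S. ((\<mu> e)\<^sup>2 - \<mu> e) * \<mu> e ^ m)) at_top" for m
  proof -
    have eq: "complex_of_real (\<mu> e ^ m) * kernel_form V_limit e = complex_of_real (((\<mu> e)\<^sup>2 - \<mu> e) * \<mu> e ^ m)"
      if "e \<in> S" for e
      unfolding form[OF that] of_real_mult[symmetric] by (simp only: mult.commute)
    have "((\<lambda>e. complex_of_real (((\<mu> e)\<^sup>2 - \<mu> e) * \<mu> e ^ m)) has_sum
        (\<Sum>\<^sub>\<infinity>(x, y). V_limit x y * nth_ell2 ((T ^^ m) (delta x)) y)) S"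
      by (rule iffD1[OF has_sum_cong, OF eq moment[of m]])
    from has_sum_Re[OF this] have "(\<Sum>\<^sub>\<infinity>e\<in>S. ((\<mu> e)\<^sup>2 - \<mu> e) * \<mu> e ^ m) =
        Re (\<Sum>\<^sub>\<infinity>(x, y). V_limit x y * nth_ell2 ((T ^^ m) (delta x)) y)"
      unfolding Re_complex_of_real by (rule infsumI)
    moreover have "Re (\<Sum>a\<in>I r. of_real (q r a ^ m) * complex_of_real (v r a)) = (\<Sum>a\<in>I r. v r a * q r a ^ m)" for r
      unfolding of_real_mult[symmetric] of_real_sum[symmetric] Re_complex_of_real by (simp only: mult.commute)
    ultimately show ?thesis using tendsto_Re[OF moment_tendsto[of m]] by simp
  qed
  obtain C where C: "\<forall>\<^sub>F r in at_top. (\<Sum>a\<in>I r. \<bar>v r a\<bar>) \<le> C" using sum_abs_v_bounded by blast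
  have q_le: "\<forall>\<^sub>F r in at_top. \<forall>a\<in>I r. \<bar>q r a\<bar> \<le> B"
    using B(3) eventually_gt_at_top[of 0]
  proof eventually_elim
    case (elim r)
    interpret sys: finite_eigensystem "disk vert r" "TQ r" "TV r" "e r" "q r" "v r" by (rule system[OF elim(2)])
    show ?case
    proof
      fix a assume a: "a \<in> I r"
      show "\<bar>q r a\<bar> \<le> B"
        by (rule eigenvalue_bound[where T = "TQ r" and e = "e r" and q = "q r", OF sys.on a sys.eigen(1)[OF a]])
          (use elim(1) in blast)
    qed
  qed
  have rel': "\<forall>\<^sub>F r in at_top. \<forall>a\<in>I r. v r a \<noteq> 0 \<longrightarrow> v r a = (q r a)\<^sup>2 - q r a"
    by (rule eventually_mono[OF eventually_gt_at_top[of 0]]) (use rel in blast)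
  have trace: "(\<Sum>\<^sub>\<infinity>e\<in>S. \<mu> e - (if \<mu> e > 1/2 then 1 else 0)) = vertex_trace (half_flux l P)"
    unfolding T(2) by (rule infsumI[OF vertex_trace_opr_of[OF T(1) S \<mu> v_sum]])
  have fin: "finite (I r)" for r using finite_disk by simp
  show thesis
    by (rule vertex_sum_tendsto[OF fin q_le C \<mu>_le v_sum lim rel'], assumption, rule that, unfold trace)
qed

end

section \<open>From the given matrices and eigenbases to the limit theorem\<close>

lemma common_eigenbasis_vec:
  fixes Q V W :: "(site \<times> 'n::finite) ell2 \<Rightarrow> (site \<times> 'n) ell2"
  assumes D: "finite D" and sym: "symmetric_op Q" "symmetric_op V" "symmetric_op W"
    and basis: "common_eigenbasis D (opr_of Q) (opr_of V) (opr_of W) \<phi> q v w" and a: "a \<in> D \<times> UNIV"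
  shows "\<phi> a \<in> l2" "Q (vec_of_state (\<phi> a)) = q a *\<^sub>R vec_of_state (\<phi> a)"
    "V (vec_of_state (\<phi> a)) = v a *\<^sub>R vec_of_state (\<phi> a)"
    "W (vec_of_state (\<phi> a)) = w a *\<^sub>R vec_of_state (\<phi> a)"
    "norm (vec_of_state (\<phi> a)) = 1"
proof -
  have zero: "\<phi> a x = 0" if "x \<notin> D" for x
    using basis a that unfolding common_eigenbasis_def by blast
  have "l2_inner (\<phi> a) (\<phi> a) = (if a = a then 1 else 0)"
    using basis a unfolding common_eigenbasis_def by blast
  then have one: "l2_inner (\<phi> a) (\<phi> a) = 1" by simp
  have "finite {x \<in> UNIV. (norm (\<phi> a x))\<^sup>2 \<noteq> 0}"
    by (rule finite_subset[OF _ D]) (use zero in force)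
  then show l2: "\<phi> a \<in> l2" unfolding l2_def by (simp add: finite_nonzero_values_imp_summable_on)
  have eig: "T (vec_of_state (\<phi> a)) = t *\<^sub>R vec_of_state (\<phi> a)"
    if T: "symmetric_op T" and "op_apply (opr_of T) (\<phi> a) = (\<lambda>x. t *\<^sub>R \<phi> a x)" for T t
  proof (rule ell2_eqI)
    fix z
    have "state_of_vec (T (vec_of_state (\<phi> a))) = (\<lambda>x. t *\<^sub>R \<phi> a x)"
      using that(2) unfolding op_apply_opr_of(2)[OF T l2] .
    then have "state_of_vec (T (vec_of_state (\<phi> a))) (fst z) $ snd z = t *\<^sub>R \<phi> a (fst z) $ snd z" by simp
    then show "nth_ell2 (T (vec_of_state (\<phi> a))) z = nth_ell2 (t *\<^sub>R vec_of_state (\<phi> a)) z"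
      by (simp add: nth_vec_of_state[OF l2] scaleR_conv_of_real[where ?'a = complex])
  qed
  have "op_apply (opr_of Q) (\<phi> a) = (\<lambda>x. q a *\<^sub>R \<phi> a x)" "op_apply (opr_of V) (\<phi> a) = (\<lambda>x. v a *\<^sub>R \<phi> a x)"
    "op_apply (opr_of W) (\<phi> a) = (\<lambda>x. w a *\<^sub>R \<phi> a x)"
    using basis a unfolding common_eigenbasis_def by blast+
  then show "Q (vec_of_state (\<phi> a)) = q a *\<^sub>R vec_of_state (\<phi> a)"
    "V (vec_of_state (\<phi> a)) = v a *\<^sub>R vec_of_state (\<phi> a)"
    "W (vec_of_state (\<phi> a)) = w a *\<^sub>R vec_of_state (\<phi> a)"
    using eig sym by blast+
  have "complex_of_real ((norm (vec_of_state (\<phi> a)))\<^sup>2) = 1"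
    using one unfolding l2_inner_vec[OF l2 l2] cinner_self .
  then have "(norm (vec_of_state (\<phi> a)))\<^sup>2 = 1\<^sup>2" by (simp only: of_real_eq_1_iff power_one)
  then show "norm (vec_of_state (\<phi> a)) = 1" by (simp only: power2_eq_iff_nonneg norm_ge_zero zero_le_one)
qed

lemma finite_eigensystem_common_eigenbasis:
  fixes Q V W :: "(site \<times> 'n::finite) ell2 \<Rightarrow> (site \<times> 'n) ell2"
  assumes D: "finite D" and sym: "symmetric_op Q" "symmetric_op V" "symmetric_op W"
    and basis: "common_eigenbasis D (opr_of Q) (opr_of V) (opr_of W) \<phi> q v w"
    and V: "supported_on D (opr_of V)"
  shows "finite_eigensystem D Q V (\<lambda>a. vec_of_state (\<phi> a)) q v"
proof
  note vec = common_eigenbasis_vec[OF D sym basis]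
  show "finite D" "symmetric_op Q" "symmetric_op V" by fact+
  show "orthonormal_family (D \<times> UNIV) (\<lambda>a. vec_of_state (\<phi> a))"
    unfolding orthonormal_family_def
  proof (intro ballI)
    fix a b :: "site \<times> 'n" assume ab: "a \<in> D \<times> UNIV" "b \<in> D \<times> UNIV"
    have "l2_inner (\<phi> a) (\<phi> b) = (if a = b then 1 else 0)"
      using basis ab unfolding common_eigenbasis_def by blast
    then show "cinner (vec_of_state (\<phi> a)) (vec_of_state (\<phi> b)) = (if a = b then 1 else 0)"
      unfolding l2_inner_vec[OF vec(1)[OF ab(1)] vec(1)[OF ab(2)]] .
  qed
  show "nth_ell2 (vec_of_state (\<phi> a)) z = 0" if "a \<in> D \<times> UNIV" "fst z \<notin> D" for a z
  proof -
    have "\<phi> a (fst z) = 0" using basis that unfolding common_eigenbasis_def by blast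
    then show ?thesis by (simp add: nth_vec_of_state[OF vec(1)[OF that(1)]])
  qed
  show "Q (vec_of_state (\<phi> a)) = q a *\<^sub>R vec_of_state (\<phi> a)" if "a \<in> D \<times> UNIV" for a by (rule vec(2)[OF that])
  show "V (vec_of_state (\<phi> a)) = v a *\<^sub>R vec_of_state (\<phi> a)" if "a \<in> D \<times> UNIV" for a by (rule vec(3)[OF that])
  show "fst z \<in> D \<and> fst w \<in> D" if "entry V z w \<noteq> 0" for z w
  proof (rule ccontr)
    assume "\<not> (fst z \<in> D \<and> fst w \<in> D)"
    then have "opr_of V (fst z) (fst w) = 0" using V unfolding supported_on_def by blast
    then have "opr_of V (fst z) (fst w) $ snd z $ snd w = 0" by simp
    then show False using that by simp
  qed
qed

text \<open>On a common eigenvector the product relation reads \<open>v * w = 0\<close>, so a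
  nonzero \<open>v\<close> forces \<open>w = 0\<close>: vertex states are the states with
  \<open>v \<noteq> 0\<close>, and on them the quadratic relation contains \<open>v\<close>
  alone.\<close>

lemma common_eigenbasis_relation:
  fixes Q V W :: "(site \<times> 'n::finite) ell2 \<Rightarrow> (site \<times> 'n) ell2"
  assumes D: "finite D" and sym: "symmetric_op Q" "symmetric_op V" "symmetric_op W"
    and basis: "common_eigenbasis D (opr_of Q) (opr_of V) (opr_of W) \<phi> q v w"
    and VW: "opr_of V \<odot> opr_of W = 0" and QQ: "opr_of Q \<odot> opr_of Q - opr_of Q = opr_of V + opr_of W"
    and a: "a \<in> D \<times> UNIV" "v a \<noteq> 0"
  shows "w a = 0" "v a = (q a)\<^sup>2 - q a"
proof -
  note vec = common_eigenbasis_vec[OF D sym basis a(1)]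
  let ?f = "vec_of_state (\<phi> a)"
  have f: "?f \<noteq> 0" using vec(5) by auto
  have "opr_of (\<lambda>f. V (W f)) = opr_of (\<lambda>f. 0)"
    using VW unfolding op_mult_opr_of[OF sym(2)] by (simp add: opr_eq_iff entry_def)
  then have "V (W ?f) = 0"
  proof (rule opr_of_inject_linear[rotated 4])
    show "bounded_linear (\<lambda>f. V (W f))"
      by (rule bounded_linear_compose[OF bounded_linear_symmetric_op[OF sym(2)] bounded_linear_symmetric_op[OF sym(3)]])
  qed (simp_all add: symmetric_op_scaleC[OF sym(2)] symmetric_op_scaleC[OF sym(3)] bounded_linear_zero)
  then have "(w a * v a) *\<^sub>R ?f = 0" unfolding vec(4) symmetric_op_scaleR[OF sym(2)] vec(3) by simp
  then show w: "w a = 0" using f a(2) by simp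
  have "opr_of (\<lambda>f. Q (Q f) - Q f) = opr_of (\<lambda>f. V f + W f)"
    using QQ unfolding op_mult_opr_of[OF sym(1)] by (simp add: opr_eq_iff entry_def)
  then have "(\<lambda>f. Q (Q f) - Q f) = (\<lambda>f. V f + W f)"
    by (intro opr_of_inject symmetric_op_minus symmetric_op_plus symmetric_op_compose_self sym)
  then have "Q (Q ?f) - Q ?f = V ?f + W ?f" by (rule fun_cong)
  then have "((q a)\<^sup>2 - q a - v a) *\<^sub>R ?f = 0"
    unfolding vec(2,3,4) symmetric_op_scaleR[OF sym(1)] w by (simp add: power2_eq_square scaleR_diff_left)
  then show "v a = (q a)\<^sup>2 - q a" using f by simp
qed

theorem mainTheorem2:
  fixes P :: "'n::finite opr"
    and K :: "site \<Rightarrow> complex ^ 'n \<Rightarrow> complex ^ 'n"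
    and vert :: "real \<times> real"
    and l :: "nat \<Rightarrow> real \<Rightarrow> real \<times> real"
    and C1 C2 c :: real
    and Q' V' W' :: "real \<Rightarrow> 'n opr"
    and \<epsilon> \<rho> F :: "real \<Rightarrow> real"
    and p :: "real poly"
    and \<phi> :: "real \<Rightarrow> site \<times> 'n \<Rightarrow> 'n state"
    and q v w :: "real \<Rightarrow> site \<times> 'n \<Rightarrow> real"
  assumes proj: "orthogonal_projection P"
    and decay: "C2 > 0"
      "\<And>x y. norm (P x y) < C1 * exp (- C2 * dist (pos x) (pos y))"
    and TR: "time_reversal K" "time_reversal_symmetric K P"
    and geometry: "boundary_curves vert l" "generic_position vert l"
    and eps_pos: "\<And>r. r > 0 \<Longrightarrow> \<epsilon> r > 0"
    and eps_bounds:
      "\<And>r. r > 0 \<Longrightarrow> op_norm (commutator (truncQ vert l P r) (truncV vert l P r)) \<le> \<epsilon> r"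
      "\<And>r. r > 0 \<Longrightarrow> op_norm (commutator (truncQ vert l P r) (truncW vert l P r)) \<le> \<epsilon> r"
      "\<And>r. r > 0 \<Longrightarrow> op_norm (truncV vert l P r \<odot> truncW vert l P r) \<le> \<epsilon> r"
      "\<And>r. r > 0 \<Longrightarrow> op_norm (truncW vert l P r \<odot> truncV vert l P r) \<le> \<epsilon> r"
    and eps_decay: "c > 0" "\<And>r. r > 0 \<Longrightarrow> \<epsilon> r \<le> poly p r * exp (- c * r)"
    and F_growth: "\<And>a. a > 0 \<Longrightarrow> ((\<lambda>t. F t / t powr a) \<longlongrightarrow> 0) at_top"
    and rho: "\<And>r. r > 0 \<Longrightarrow> \<rho> r = F (1 / \<epsilon> r) * \<epsilon> r powr (1 / 10)"
    and matrices: "\<And>r. r > 0 \<Longrightarrow> supported_on (disk vert r) (Q' r)"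
      "\<And>r. r > 0 \<Longrightarrow> supported_on (disk vert r) (V' r)"
      "\<And>r. r > 0 \<Longrightarrow> supported_on (disk vert r) (W' r)"
    and herm: "\<And>r. r > 0 \<Longrightarrow> hermitian (Q' r)"
      "\<And>r. r > 0 \<Longrightarrow> hermitian (V' r)"
      "\<And>r. r > 0 \<Longrightarrow> hermitian (W' r)"
    and TR': "\<And>r. r > 0 \<Longrightarrow> time_reversal_symmetric K (Q' r)"
      "\<And>r. r > 0 \<Longrightarrow> time_reversal_symmetric K (V' r)"
      "\<And>r. r > 0 \<Longrightarrow> time_reversal_symmetric K (W' r)"
    and approx: "\<And>r. r > 0 \<Longrightarrow> op_norm (truncQ vert l P r - Q' r) < (\<rho> r)\<^sup>2"
      "\<And>r. r > 0 \<Longrightarrow> op_norm (truncV vert l P r - V' r) < \<rho> r"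
      "\<And>r. r > 0 \<Longrightarrow> op_norm (truncW vert l P r - W' r) < \<rho> r"
    and relations: "\<And>r. r > 0 \<Longrightarrow> commutator (Q' r) (V' r) = 0"
      "\<And>r. r > 0 \<Longrightarrow> commutator (Q' r) (W' r) = 0"
      "\<And>r. r > 0 \<Longrightarrow> V' r \<odot> W' r = 0"
      "\<And>r. r > 0 \<Longrightarrow> W' r \<odot> V' r = 0"
      "\<And>r. r > 0 \<Longrightarrow> Q' r \<odot> Q' r - Q' r = V' r + W' r"
    and diag: "\<And>r. r > 0 \<Longrightarrow>
      common_eigenbasis (disk vert r) (Q' r) (V' r) (W' r) (\<phi> r) (q r) (v r) (w r)"
  shows "tendsto_mod2 (\<lambda>r. \<Sum>a\<in>vertex_states (disk vert r) (v r) (w r). q r a)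
           (vertex_trace (half_flux l P)) at_top"
proof -
  interpret half_flux_model P vert l C1 C2
    by unfold_locales (use proj decay geometry in auto)
  obtain T where T: "symmetric_op T" "half_flux l P = opr_of T"
    "\<And>z w. entry (\<lambda>f. T (T f) - T f) z w = V_limit z w"
    by (rule half_flux_operator, rule that)
  have ops: "\<exists>A. symmetric_op A \<and> Q' r = opr_of A" "\<exists>A. symmetric_op A \<and> V' r = opr_of A"
    "\<exists>A. symmetric_op A \<and> W' r = opr_of A" if "r > 0" for r
    using symmetric_op_of_finite_opr[OF finite_disk matrices(1)[OF that] herm(1)[OF that]]
      symmetric_op_of_finite_opr[OF finite_disk matrices(2)[OF that] herm(2)[OF that]]
      symmetric_op_of_finite_opr[OF finite_disk matrices(3)[OF that] herm(3)[OF that]] by metis+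
  \<comment> \<open>The matrices are known to come from operators for positive radii only, hence a
    choice that is unspecified for other \<open>r\<close>.\<close>
  define TQ where "TQ r = (SOME A. symmetric_op A \<and> Q' r = opr_of A)" for r
  define TV where "TV r = (SOME A. symmetric_op A \<and> V' r = opr_of A)" for r
  define TW where "TW r = (SOME A. symmetric_op A \<and> W' r = opr_of A)" for r
  have TQ: "symmetric_op (TQ r)" "Q' r = opr_of (TQ r)" if "r > 0" for r
    using someI_ex[OF ops(1)[OF that]] unfolding TQ_def by blast+
  have TV: "symmetric_op (TV r)" "V' r = opr_of (TV r)" if "r > 0" for r
    using someI_ex[OF ops(2)[OF that]] unfolding TV_def by blast+
  have TW: "symmetric_op (TW r)" "W' r = opr_of (TW r)" if "r > 0" for r
    using someI_ex[OF ops(3)[OF that]] unfolding TW_def by blast+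
  have basis: "common_eigenbasis (disk vert r) (opr_of (TQ r)) (opr_of (TV r)) (opr_of (TW r)) (\<phi> r) (q r) (v r) (w r)"
    if "r > 0" for r
    using diag[OF that] unfolding TQ(2)[OF that] TV(2)[OF that] TW(2)[OF that] .
  have system: "finite_eigensystem (disk vert r) (TQ r) (TV r) (\<lambda>a. vec_of_state (\<phi> r a)) (q r) (v r)"
    if "r > 0" for r
    using finite_eigensystem_common_eigenbasis[OF finite_disk TQ(1)[OF that] TV(1)[OF that] TW(1)[OF that] basis[OF that]]
      matrices(2)[OF that] unfolding TV(2)[OF that] by blast
  have rel: "w r a = 0" "v r a = (q r a)\<^sup>2 - q r a" if r: "r > 0" and a: "a \<in> disk vert r \<times> UNIV" "v r a \<noteq> 0" for r a
  proof -
    have VW: "opr_of (TV r) \<odot> opr_of (TW r) = 0"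
      using relations(3)[OF r] unfolding TV(2)[OF r] TW(2)[OF r] .
    have QQ: "opr_of (TQ r) \<odot> opr_of (TQ r) - opr_of (TQ r) = opr_of (TV r) + opr_of (TW r)"
      using relations(5)[OF r] unfolding TQ(2)[OF r] TV(2)[OF r] TW(2)[OF r] .
    show "w r a = 0" "v r a = (q r a)\<^sup>2 - q r a"
      by (rule common_eigenbasis_relation[OF finite_disk TQ(1)[OF r] TV(1)[OF r] TW(1)[OF r] basis[OF r] VW QQ a])+
  qed
  interpret lim: half_flux_limit P vert l C1 C2 T TQ TV "\<lambda>r a. vec_of_state (\<phi> r a)" q v \<rho>
  proof (rule half_flux_limit.intro[OF half_flux_model_axioms], rule half_flux_limit_axioms.intro)
    show "op_norm (truncQ vert l P r - opr_of (TQ r)) \<le> (\<rho> r)\<^sup>2" if "r > 0" for r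
      using approx(1)[OF that] unfolding TQ(2)[OF that] by simp
    show "op_norm (truncV vert l P r - opr_of (TV r)) \<le> \<rho> r" if "r > 0" for r
      using approx(2)[OF that] unfolding TV(2)[OF that] by simp
    show "((\<lambda>r. poly pp r * \<rho> r) \<longlongrightarrow> 0) at_top" for pp
      by (rule rho_poly_tendsto_0[OF eps_pos eps_decay F_growth rho])
  qed (rule T system rel(2); assumption)+
  obtain s where lim: "((\<lambda>r. (\<Sum>a\<in>{a \<in> disk vert r \<times> UNIV. v r a \<noteq> 0}. q r a)
      - real (card {a \<in> disk vert r \<times> UNIV. v r a \<noteq> 0 \<and> q r a > s})) \<longlongrightarrow> vertex_trace (half_flux l P)) at_top"
    by (rule lim.vertex_sum_limit, rule that)
  \<comment> \<open>Half the number of vertex states above the cut. By Kramers parity this number is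
    even, so subtracting it changes the sum by a multiple of 2.\<close>
  define k where "k r = int (card {a \<in> disk vert r \<times> UNIV. v r a \<noteq> 0 \<and> q r a > s} div 2)" for r
  have "(\<Sum>a\<in>{a \<in> disk vert r \<times> UNIV. v r a \<noteq> 0}. q r a)
      - real (card {a \<in> disk vert r \<times> UNIV. v r a \<noteq> 0 \<and> q r a > s})
      = (\<Sum>a\<in>vertex_states (disk vert r) (v r) (w r). q r a) - 2 * of_int (k r)" if r: "r > 0" for r
  proof -
    have "even (card {a \<in> disk vert r \<times> UNIV. v r a \<noteq> 0 \<and> q r a > s})"
      using finite_eigensystem.even_card_eigenstates[OF system[OF r] TR(1), where p = "\<lambda>q v. v \<noteq> 0 \<and> q > s"]
        TR'(1,2)[OF r] unfolding TQ(2)[OF r] TV(2)[OF r] by blast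
    then have "real (card {a \<in> disk vert r \<times> UNIV. v r a \<noteq> 0 \<and> q r a > s}) = 2 * of_int (k r)"
      unfolding k_def by auto
    moreover have "vertex_states (disk vert r) (v r) (w r) = {a \<in> disk vert r \<times> UNIV. v r a \<noteq> 0}"
      unfolding vertex_states_def using rel(1)[OF r] by blast
    ultimately show ?thesis by simp
  qed
  then have "((\<lambda>r. (\<Sum>a\<in>vertex_states (disk vert r) (v r) (w r). q r a) - 2 * of_int (k r))
      \<longlongrightarrow> vertex_trace (half_flux l P)) at_top"
    by (intro Lim_transform_eventually[OF lim] eventually_mono[OF eventually_gt_at_top[of 0]])
  then show ?thesis unfolding tendsto_mod2_def by blast
qed

end
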